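(* Let $d\ge 2$ be an integer, $m\ge 1$ real, $\beta\ge \frac{1}{2\log 2}$, and let $\mathcal{X}\subseteq[-\frac12,\frac12)^d$ be a finite non-empty set such that $\Delta_\infty(\mathcal{X})\ge \frac{\beta d}{m}$. Then $$\sqrt{(2-e^{1/(2\beta)})\,|Q_m|}\le \sigma_{\min}(\mathcal{F}_{Q_m,\mathcal{X}})\le \sigma_{\max}(\mathcal{F}_{Q_m,\mathcal{X}})\le \sqrt{e^{1/(2\beta)}\,|Q_m|},$$ $$\sqrt{(2-e^{1/(2\beta)})\,|Q_m|_*}\le \sigma_{\min}(\Phi_{Q_m,\mathcal{X}})\le \sigma_{\max}(\Phi_{Q_m,\mathcal{X}})\le \sqrt{e^{1/(2\beta)}\,|Q_m|_*}.$$
   Context: $Q_m=\{x\in\mathbb{R}^d:|x|_\infty\le m\}$. For compact $\Omega\subset\mathbb{R}^d$, $|\Omega|$ is its Lebesgue measure and $|\Omega|_*=|\Omega\cap\mathbb{Z}^d|$ is the number of integer points in $\Omega$. For $\mathcal{X}=\{x_k\}_{k=1}^s$ (distinct points), $\mathcal{F}_{\Omega,\mathcal{X}}:\mathbb{C}^s\to L^2(\Omega)$ is $(\mathcal{F}_{\Omega,\mathcal{X}}u)(\omega)=\sum_{k=1}^s u_ke^{-2\pi i\omega\cdot x_k}$, and $\Phi_{\Omega,\mathcal{X}}=[e^{-2\pi i\omega\cdot x}]_{\omega\in\Omega\cap\mathbb{Z}^d,\,x\in\mathcal{X}}$. $\sigma_{\min}$ and $\sigma_{\max}$ denote the minimum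 and maximum of $\|\mathcal{F}_{\Omega,\mathcal{X}}u\|_{L^2(\Omega)}$ (respectively $|\Phi_{\Omega,\mathcal{X}}u|_2$) over $u\in\mathbb{C}^s$ with $|u|_2=1$. The minimum separation is $\Delta_p(\mathcal{X})=\min_{x\ne x'\in\mathcal{X}}|x-x'|_p$ ($+\infty$ if $\mathcal{X}$ is a single point). Convention on metrics: in statements about $\mathcal{F}_{\Omega,\mathcal{X}}$, $|\cdot|_p$ is the usual $\ell^p$ norm on $\mathbb{R}^d$; in statements about $\Phi_{\Omega,\mathcal{X}}$, $\mathcal{X}$ is regarded as a subset of the torus $\mathbb{T}^d=(\mathbb{R}/\mathbb{Z})^d\cong[-\frac12,\frac12)^d$ and $|x|_p$ means $\min_{n\in\mathbb{Z}^d}|x+n|_p$. The hypothesis is read in the metric corresponding to the operator. *)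

theory Defs
  imports "HOL-Analysis.Analysis"
begin

definition Q_cube :: "real \<Rightarrow> (real ^ 'n) set" where
  "Q_cube m = {x. infnorm x \<le> m}"

definition int_lattice :: "(real ^ 'n) set" where
  "int_lattice = {x. \<forall>i. x $ i \<in> \<int>}"

definition vol :: "(real ^ 'n) set \<Rightarrow> real" where
  "vol \<Omega> = measure lebesgue \<Omega>"

definition num_int_points :: "(real ^ 'n) set \<Rightarrow> real" where
  "num_int_points \<Omega> = real (card (\<Omega> \<inter> int_lattice))"

definition unit_box :: "(real ^ 'n) set" where
  "unit_box = {x. \<forall>i. - (1 / 2) \<le> x $ i \<and> x $ i < 1 / 2}"

text \<open>The minimum defining the torus norm exists by \<open>torus_infnorm_attained\<close> below.\<close>

definition torus_infnorm :: "real ^ 'n \<Rightarrow> real" where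
  "torus_infnorm x = (LEAST r. r \<in> (\<lambda>n. infnorm (x + n)) ` int_lattice)"

text \<open>Minimum separation with respect to a norm-like function \<open>\<rho>\<close>. It takes values in \<^typ>\<open>ereal\<close>,
  where the infimum of the empty set is \<open>\<infinity>\<close>, so that a single point has separation \<open>\<infinity>\<close>.\<close>

definition min_sep :: "('a::minus \<Rightarrow> real) \<Rightarrow> 'a set \<Rightarrow> ereal" where
  "min_sep \<rho> X = Inf {ereal (\<rho> (x - y)) |x y. x \<in> X \<and> y \<in> X \<and> x \<noteq> y}"

definition expo :: "real ^ 'n \<Rightarrow> real ^ 'n \<Rightarrow> complex" where
  "expo \<omega> x = exp (- 2 * complex_of_real pi * \<i> * complex_of_real (\<omega> \<bullet> x))"

text \<open>The space of coefficient vectors is indexed by the points of \<open>X\<close> themselves rather than by an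
  enumeration of \<open>X\<close>; a vector is a function on \<open>X\<close>, extended by zero.\<close>

definition unit_sphere :: "'a set \<Rightarrow> ('a \<Rightarrow> complex) set" where
  "unit_sphere X = {u. (\<forall>x. x \<notin> X \<longrightarrow> u x = 0) \<and> L2_set (\<lambda>x. cmod (u x)) X = 1}"

text \<open>The restriction to \<open>\<Omega>\<close> of the function \<open>F_op X u\<close> is \<open>\<F>\<^bsub>\<Omega>,X\<^esub> u\<close>; the restriction is built
  into the norm below.\<close>

definition F_op :: "(real ^ 'n) set \<Rightarrow> (real ^ 'n \<Rightarrow> complex) \<Rightarrow> (real ^ 'n \<Rightarrow> complex)" where
  "F_op X u = (\<lambda>\<omega>. \<Sum>x\<in>X. u x * expo \<omega> x)"

definition L2_norm_on :: "(real ^ 'n) set \<Rightarrow> (real ^ 'n \<Rightarrow> complex) \<Rightarrow> real" where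
  "L2_norm_on \<Omega> f = sqrt (LINT \<omega>:\<Omega>|lebesgue. (cmod (f \<omega>))\<^sup>2)"

text \<open>The product of the matrix \<open>\<Phi>\<^bsub>\<Omega>,X\<^esub>\<close>, with entries \<open>expo \<omega> x\<close>, and the vector \<open>u\<close>; it is a vector
  indexed by the integer points of \<open>\<Omega>\<close>, extended by zero.\<close>

definition Phi_op ::
  "(real ^ 'n) set \<Rightarrow> (real ^ 'n) set \<Rightarrow> (real ^ 'n \<Rightarrow> complex) \<Rightarrow> (real ^ 'n \<Rightarrow> complex)" where
  "Phi_op \<Omega> X u = (\<lambda>\<omega>. if \<omega> \<in> \<Omega> \<inter> int_lattice then \<Sum>x\<in>X. expo \<omega> x * u x else 0)"

text \<open>These minima and maxima exist for compact \<open>\<Omega>\<close> and finite nonempty \<open>X\<close>, by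
  \<open>sigma_F_attained\<close> and \<open>sigma_Phi_attained\<close> below.\<close>

definition sigma_min_F :: "(real ^ 'n) set \<Rightarrow> (real ^ 'n) set \<Rightarrow> real" where
  "sigma_min_F \<Omega> X = (LEAST r. r \<in> (\<lambda>u. L2_norm_on \<Omega> (F_op X u)) ` unit_sphere X)"

definition sigma_max_F :: "(real ^ 'n) set \<Rightarrow> (real ^ 'n) set \<Rightarrow> real" where
  "sigma_max_F \<Omega> X = (GREATEST r. r \<in> (\<lambda>u. L2_norm_on \<Omega> (F_op X u)) ` unit_sphere X)"

definition sigma_min_Phi :: "(real ^ 'n) set \<Rightarrow> (real ^ 'n) set \<Rightarrow> real" where
  "sigma_min_Phi \<Omega> X =
    (LEAST r. r \<in> (\<lambda>u. L2_set (\<lambda>\<omega>. cmod (Phi_op \<Omega> X u \<omega>)) (\<Omega> \<inter> int_lattice)) ` unit_sphere X)"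

definition sigma_max_Phi :: "(real ^ 'n) set \<Rightarrow> (real ^ 'n) set \<Rightarrow> real" where
  "sigma_max_Phi \<Omega> X =
    (GREATEST r. r \<in> (\<lambda>u. L2_set (\<lambda>\<omega>. cmod (Phi_op \<Omega> X u \<omega>)) (\<Omega> \<inter> int_lattice)) ` unit_sphere X)"

lemma compact_Q_cube: "compact (Q_cube m :: (real ^ 'n) set)"
proof -
  have "closed (Q_cube m :: (real ^ 'n) set)"
    unfolding Q_cube_def by (intro closed_Collect_le continuous_intros)
  moreover have "bounded (Q_cube m :: (real ^ 'n) set)"
  proof (rule boundedI)
    fix x :: "real ^ 'n" assume "x \<in> Q_cube m"
    then have "infnorm x \<le> m" by (simp add: Q_cube_def)
    then show "norm x \<le> sqrt DIM(real ^ 'n) * m"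
      using norm_le_infnorm[of x] by (meson mult_left_mono order_trans real_sqrt_ge_zero of_nat_0_le_iff)
  qed
  ultimately show ?thesis by (simp add: compact_eq_bounded_closed)
qed

lemma closed_int_lattice: "closed (int_lattice :: (real ^ 'n) set)"
proof -
  have "int_lattice = (\<Inter>i. (\<lambda>x::real^'n. x $ i) -` \<int>)" by (auto simp: int_lattice_def)
  moreover have "closed ((\<lambda>x::real^'n. x $ i) -` \<int>)" for i
    by (intro closed_vimage continuous_intros) simp
  ultimately show ?thesis by (metis closed_INT)
qed

lemma finite_int_points:
  fixes \<Omega> :: "(real ^ 'n) set"
  assumes "bounded \<Omega>"
  shows "finite (\<Omega> \<inter> int_lattice)"
proof -
  obtain B where B: "\<And>x. x \<in> \<Omega> \<Longrightarrow> norm x \<le> B"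
    using assms unfolding bounded_iff by auto
  let ?f = "\<lambda>(x::real^'n) i. \<lfloor>x $ i\<rfloor>"
  have inj: "inj_on ?f (\<Omega> \<inter> int_lattice)"
  proof (rule inj_onI)
    fix x y :: "real ^ 'n"
    assume xy: "x \<in> \<Omega> \<inter> int_lattice" "y \<in> \<Omega> \<inter> int_lattice" and e: "?f x = ?f y"
    show "x = y"
    proof (rule vec_eq_iff[THEN iffD2], rule allI)
      fix i
      have "x $ i \<in> \<int>" "y $ i \<in> \<int>" using xy by (auto simp: int_lattice_def)
      moreover have "\<lfloor>x $ i\<rfloor> = \<lfloor>y $ i\<rfloor>" using fun_cong[OF e, of i] by simp
      ultimately show "x $ i = y $ i" by (auto elim!: Ints_cases)
    qed
  qed
  have "?f ` (\<Omega> \<inter> int_lattice) \<subseteq> PiE UNIV (\<lambda>_. {\<lfloor>- B\<rfloor>..\<lfloor>B\<rfloor>})"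
  proof -
    have "\<lfloor>x $ i\<rfloor> \<in> {\<lfloor>- B\<rfloor>..\<lfloor>B\<rfloor>}" if "x \<in> \<Omega>" for x i
    proof -
      have "\<bar>x $ i\<bar> \<le> B" using B[OF that] component_le_norm_cart[of x i] by linarith
      then show ?thesis by (auto intro: floor_mono)
    qed
    then show ?thesis by auto
  qed
  then have "finite (?f ` (\<Omega> \<inter> int_lattice))"
    by (rule finite_subset) (intro finite_PiE, auto)
  then show ?thesis using inj finite_imageD by blast
qed

lemma torus_infnorm_attained:
  fixes x :: "real ^ 'n"
  shows "\<exists>n\<in>int_lattice. torus_infnorm x = infnorm (x + n)
           \<and> (\<forall>k\<in>int_lattice. infnorm (x + n) \<le> infnorm (x + k))"
proof -
  let ?S = "((\<lambda>y. y - x) ` Q_cube (infnorm x)) \<inter> int_lattice"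
  have mem: "n \<in> ?S \<longleftrightarrow> infnorm (x + n) \<le> infnorm x \<and> n \<in> int_lattice" for n
    by (auto simp: Q_cube_def image_iff intro!: exI[of _ "x + n"])
  have "compact ?S"
    by (intro compact_Int_closed compact_continuous_image continuous_intros compact_Q_cube
        closed_int_lattice)
  moreover have "0 \<in> ?S" unfolding mem by (simp add: int_lattice_def)
  moreover have c: "continuous_on ?S (\<lambda>n. infnorm (x + n))"
    by (intro continuous_intros)
  ultimately obtain n where n: "n \<in> ?S" "\<And>k. k \<in> ?S \<Longrightarrow> infnorm (x + n) \<le> infnorm (x + k)"
    using continuous_attains_inf[of ?S "\<lambda>n. infnorm (x + n)"] c by blast
  have le: "infnorm (x + n) \<le> infnorm (x + k)" if "k \<in> int_lattice" for k
    using n that unfolding mem by (meson linear order_trans)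
  moreover have "torus_infnorm x = infnorm (x + n)"
    unfolding torus_infnorm_def by (rule Least_equality) (use n le in auto)
  ultimately show ?thesis using n by blast
qed

lemma compact_unit_sphere:
  assumes "finite X"
  shows "compact (unit_sphere X)"
proof -
  let ?P = "PiE UNIV (\<lambda>x. if x \<in> X then cball (0::complex) 1 else {0})"
  have "compactin (product_topology (\<lambda>_::'a. euclidean) UNIV) ?P"
    by (simp add: compactin_PiE)
  then have P: "compact ?P"
    by (simp add: euclidean_product_topology)
  have "closed {u :: 'a \<Rightarrow> complex. L2_set (\<lambda>x. cmod (u x)) X = 1}"
    unfolding L2_set_def by (intro closed_Collect_eq continuous_intros) auto
  then have "compact (?P \<inter> {u. L2_set (\<lambda>x. cmod (u x)) X = 1})"
    by (rule compact_Int_closed[OF P])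
  moreover have "unit_sphere X = ?P \<inter> {u. L2_set (\<lambda>x. cmod (u x)) X = 1}"
  proof -
    have "cmod (u x) \<le> 1" if "L2_set (\<lambda>x. cmod (u x)) X = 1" "x \<in> X" for u x
      using member_le_L2_set[OF assms that(2), of "\<lambda>x. cmod (u x)"] that by simp
    then show ?thesis by (auto simp: unit_sphere_def PiE_iff split: if_splits)
  qed
  ultimately show ?thesis by simp
qed

lemma unit_sphere_nonempty:
  assumes "finite X" "X \<noteq> {}"
  shows "unit_sphere X \<noteq> {}"
proof -
  obtain a where a: "a \<in> X" using assms by auto
  have "(\<Sum>x\<in>X. (cmod (if x = a then 1 else 0))\<^sup>2) = (\<Sum>x\<in>X. if x = a then 1 else 0)"
    by (intro sum.cong) auto
  then have "(\<lambda>x. if x = a then 1 else 0) \<in> unit_sphere X"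
    using a assms by (auto simp: unit_sphere_def L2_set_def)
  then show ?thesis by auto
qed

lemma unit_sphere_extrema:
  fixes N :: "('a \<Rightarrow> complex) \<Rightarrow> real"
  assumes "finite X" "X \<noteq> {}" "continuous_on UNIV N"
  shows "\<exists>u\<in>unit_sphere X. (LEAST r. r \<in> N ` unit_sphere X) = N u
           \<and> (\<forall>v\<in>unit_sphere X. N u \<le> N v)" (is ?A)
    and "\<exists>u\<in>unit_sphere X. (GREATEST r. r \<in> N ` unit_sphere X) = N u
           \<and> (\<forall>v\<in>unit_sphere X. N v \<le> N u)" (is ?B)
proof -
  note c = compact_unit_sphere[OF assms(1)] unit_sphere_nonempty[OF assms(1,2)]
    continuous_on_subset[OF assms(3) subset_UNIV[of "unit_sphere X"]]
  obtain u where u: "u \<in> unit_sphere X" "\<forall>v\<in>unit_sphere X. N u \<le> N v"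
    using continuous_attains_inf[OF c] by blast
  have "(LEAST r. r \<in> N ` unit_sphere X) = N u"
    by (rule Least_equality) (use u in auto)
  then show ?A using u by blast
  obtain v where v: "v \<in> unit_sphere X" "\<forall>w\<in>unit_sphere X. N w \<le> N v"
    using continuous_attains_sup[OF c] by blast
  have "(GREATEST r. r \<in> N ` unit_sphere X) = N v"
    by (rule Greatest_equality) (use v in auto)
  then show ?B using v by blast
qed

lemma integrable_on_compact:
  fixes f :: "real ^ 'n \<Rightarrow> 'b::euclidean_space"
  assumes "compact \<Omega>" "continuous_on UNIV f"
  shows "set_integrable lebesgue \<Omega> f"
proof -
  have "integrable lborel (\<lambda>x. indicator \<Omega> x *\<^sub>R f x)"
    using borel_integrable_compact[OF assms(1) continuous_on_subset[OF assms(2)]]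
    by (simp add: indicator_scaleR_eq_if)
  then show ?thesis
    unfolding set_integrable_def
    using integrable_completion borel_measurable_integrable by blast
qed

lemma continuous_F_op: "continuous_on UNIV (F_op X u)"
  unfolding F_op_def expo_def by (intro continuous_intros)

lemma F_op_square_integrable:
  "compact \<Omega> \<Longrightarrow> set_integrable lebesgue \<Omega> (\<lambda>\<omega>. (cmod (F_op X u \<omega>))\<^sup>2)"
  by (intro integrable_on_compact continuous_intros continuous_F_op)

lemma continuous_L2_norm_F_op:
  fixes \<Omega> X :: "(real ^ 'n) set"
  assumes "compact \<Omega>" "finite X"
  shows "continuous_on UNIV (\<lambda>u. L2_norm_on \<Omega> (F_op X u))"
proof -
  define G where "G x y = (LINT \<omega>:\<Omega>|lebesgue. expo \<omega> x * cnj (expo \<omega> y))" for x y :: "real ^ 'n"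
  have int: "set_integrable lebesgue \<Omega> (\<lambda>\<omega>. expo \<omega> x * cnj (expo \<omega> y))" for x y
    unfolding expo_def by (intro integrable_on_compact assms continuous_intros)
  have "(LINT \<omega>:\<Omega>|lebesgue. (cmod (F_op X u \<omega>))\<^sup>2)
      = Re (\<Sum>x\<in>X. \<Sum>y\<in>X. u x * cnj (u y) * G x y)" for u
  proof -
    have "complex_of_real (LINT \<omega>:\<Omega>|lebesgue. (cmod (F_op X u \<omega>))\<^sup>2)
        = (LINT \<omega>:\<Omega>|lebesgue. complex_of_real ((cmod (F_op X u \<omega>))\<^sup>2))"
      by (simp add: set_lebesgue_integral_def scaleR_conv_of_real flip: integral_complex_of_real)
    also have "\<dots> = (LINT \<omega>:\<Omega>|lebesgue.
        (\<Sum>x\<in>X. \<Sum>y\<in>X. (u x * cnj (u y)) * (expo \<omega> x * cnj (expo \<omega> y))))"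
      by (simp add: complex_norm_square F_op_def cnj_sum sum_product mult_ac
          del: of_real_power)
    also have "\<dots> = (\<Sum>x\<in>X. \<Sum>y\<in>X. u x * cnj (u y) * G x y)"
      using int unfolding G_def set_lebesgue_integral_def set_integrable_def
      by (simp add: scaleR_sum_right Bochner_Integration.integral_sum
          flip: mult_scaleR_right)
    finally show ?thesis by (metis Re_complex_of_real)
  qed
  then have "(\<lambda>u. L2_norm_on \<Omega> (F_op X u))
      = (\<lambda>u. sqrt (Re (\<Sum>x\<in>X. \<Sum>y\<in>X. u x * cnj (u y) * G x y)))"
    by (simp add: L2_norm_on_def)
  moreover have "continuous_on UNIV \<dots>"
    by (intro continuous_intros) auto
  ultimately show ?thesis by (simp only:)
qed

lemma continuous_L2_set_Phi_op:
  "continuous_on UNIV (\<lambda>u. L2_set (\<lambda>\<omega>. cmod (Phi_op \<Omega> X u \<omega>)) (\<Omega> \<inter> int_lattice))"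
proof -
  have "(\<lambda>u. L2_set (\<lambda>\<omega>. cmod (Phi_op \<Omega> X u \<omega>)) (\<Omega> \<inter> int_lattice))
      = (\<lambda>u. L2_set (\<lambda>\<omega>. cmod (\<Sum>x\<in>X. expo \<omega> x * u x)) (\<Omega> \<inter> int_lattice))"
    by (intro ext L2_set_cong) (auto simp: Phi_op_def)
  moreover have "continuous_on UNIV \<dots>"
    unfolding L2_set_def by (intro continuous_intros) auto
  ultimately show ?thesis by (simp only:)
qed

lemma sigma_F_attained:
  assumes "compact \<Omega>" "finite X" "X \<noteq> {}"
  shows "\<exists>u\<in>unit_sphere X. sigma_min_F \<Omega> X = L2_norm_on \<Omega> (F_op X u)
           \<and> (\<forall>v\<in>unit_sphere X. L2_norm_on \<Omega> (F_op X u) \<le> L2_norm_on \<Omega> (F_op X v))"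
    and "\<exists>u\<in>unit_sphere X. sigma_max_F \<Omega> X = L2_norm_on \<Omega> (F_op X u)
           \<and> (\<forall>v\<in>unit_sphere X. L2_norm_on \<Omega> (F_op X v) \<le> L2_norm_on \<Omega> (F_op X u))"
  unfolding sigma_min_F_def sigma_max_F_def
  by (rule unit_sphere_extrema[OF assms(2,3) continuous_L2_norm_F_op[OF assms(1,2)]])+

lemma sigma_Phi_attained:
  fixes \<Omega> X :: "(real ^ 'n) set"
  defines "N \<equiv> \<lambda>u. L2_set (\<lambda>\<omega>. cmod (Phi_op \<Omega> X u \<omega>)) (\<Omega> \<inter> int_lattice)"
  assumes "finite X" "X \<noteq> {}"
  shows "\<exists>u\<in>unit_sphere X. sigma_min_Phi \<Omega> X = N u \<and> (\<forall>v\<in>unit_sphere X. N u \<le> N v)"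
    and "\<exists>u\<in>unit_sphere X. sigma_max_Phi \<Omega> X = N u \<and> (\<forall>v\<in>unit_sphere X. N v \<le> N u)"
  unfolding sigma_min_Phi_def sigma_max_Phi_def N_def
  by (rule unit_sphere_extrema[OF assms(2,3) continuous_L2_set_Phi_op])+

end

theory Submission
  imports Defs
begin

text \<open>Write \<open>e(t) = exp(2\<pi>it)\<close> (\<open>unit_exp\<close>) and, for a summable weight \<open>w\<close> on the integers, \<open>fourier w \<xi> = \<Sum>\<^sub>k w(k) e(k\<xi>)\<close>.
Suppose that \<open>fourier w\<close> vanishes at every \<open>\<xi>\<close> whose distance from the integers is at least \<open>\<delta>\<close>, and that
any two distinct points of \<open>X\<close> have a coordinate in which they are \<open>\<delta>\<close>-separated modulo 1. Expanding the square,
\<open>\<Sum>\<^sub>\<kappa> w(\<kappa>\<^sub>1)\<cdots>w(\<kappa>\<^sub>d) |\<Sum>\<^sub>x u\<^sub>x e(-\<kappa>\<cdot>x)|\<^sup>2 = (fourier w 0)\<^sup>d |u|\<^sup>2\<close>, because for \<open>x \<noteq> y\<close> one of the \<open>d\<close> factors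
\<open>fourier w (y\<^sub>i - x\<^sub>i)\<close> is zero (\<open>quadratic_form_has_sum\<close>). Hence every pointwise inequality between the
indicator of a cube and products of such weights becomes an inequality for exponential sums.

Fix \<open>L \<ge> 2\<close> with \<open>L > 1/\<delta>\<close>. The weights are values at the points \<open>k/L\<close> of two functions of Beurling and Selberg type attached
to the interval \<open>[-\<nu>/L, \<nu>/L]\<close>: the majorant \<open>M\<close> of its indicator, for which the weights have total mass \<open>2\<nu> + \<sigma>\<close> with
\<open>\<sigma> \<le> L\<close>, and the mean \<open>H\<close> of this majorant and the corresponding minorant, whose total mass is exactly
\<open>2\<nu>\<close> (\<open>selberg_weights\<close>). The product of the \<open>M\<close> majorizes the cube and gives the upper bound. For the lower bound
one has \<open>0 \<le> H \<le> 1 \<le> M\<close> inside the interval and \<open>2|H| \<le> M\<close> outside, so that \<open>2 \<Prod>H - \<Prod>M\<close> minorizes the cube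
(\<open>product_minorant\<close>); its mass \<open>2(2\<nu>)\<^sup>d - (2\<nu> + \<sigma>)\<^sup>d\<close> is the source of the factor \<open>2 - e\<^bsup>1/(2\<beta>)\<^esup>\<close>.
With \<open>c = \<beta>d\<close> and \<open>n = \<lfloor>m\<rfloor>\<close> one can take \<open>m/c < L < (n + 1)/c\<close>. The integers in \<open>[-m, m]\<close> are those with
\<open>|k| \<le> n\<close>, equivalently \<open>|k| < n + 1\<close>; taking \<open>\<nu> = n\<close> above and \<open>\<nu> = n + 1\<close> below, both masses differ from
the number \<open>(2n+1)\<^sup>d\<close> of integer points by no more than the factors allow, as
\<open>(1 + 1/(2c))\<^sup>d \<le> e\<^bsup>d/(2c)\<^esup> = e\<^bsup>1/(2\<beta>)\<^esup>\<close> (\<open>expsum_box_bounds\<close>).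

That \<open>fourier M\<close> vanishes where it should is seen from differences. The function \<open>M(y) - M(y - 1)\<close> is a
finite combination of translates of \<open>sinc\<^sup>2(y)\<close> and \<open>y sinc\<^sup>2(y)\<close>, which are Fourier integrals over
\<open>[-1, 1]\<close>; Fejer summation shows that the Fourier series of its samples vanishes
(\<open>bandlimited_samples_vanish\<close>). If \<open>L = p/q\<close>, then translating \<open>M\<close> by \<open>q\<close> shifts its samples by \<open>p\<close> places,
so \<open>(1 - e(p\<xi>)) fourier M \<xi> = 0\<close>, and the zeros of the first factor are removed by continuity.

The bounds for the integral operator follow from those for the matrix: replacing \<open>X\<close> by \<open>X/K\<close> and \<open>m\<close> by
\<open>Km\<close> keeps the separation hypothesis, and after division by \<open>K\<^sup>d\<close> the sums over integer points are Riemann sums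
of the integral over the cube (\<open>riemann_sum_cube\<close>).\<close>

section \<open>The squared sinc function and its periodization\<close>

text \<open>Dominated convergence for unordered sums, that is, for integrals with respect to counting measure.\<close>

lemma tannery:
  fixes f :: "nat \<Rightarrow> 'i \<Rightarrow> 'b::{banach, second_countable_topology}"
  assumes b: "b summable_on A"
    and le: "\<And>N k. k \<in> A \<Longrightarrow> norm (f N k) \<le> b k"
    and lim: "\<And>k. k \<in> A \<Longrightarrow> (\<lambda>N. f N k) \<longlonglongrightarrow> g k"
  shows "(\<lambda>N. infsum (f N) A) \<longlonglongrightarrow> infsum g A"
proof -
  have b0: "0 \<le> b k" if "k \<in> A" for k
    using le[OF that, of 0] by (meson norm_ge_zero order_trans)
  have g: "norm (g k) \<le> b k" if "k \<in> A" for k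
    using tendsto_upperbound[OF tendsto_norm[OF lim[OF that]]] le[OF that] by auto
  have bi: "integrable (count_space A) b"
    using b b0 abs_summable_equivalent[of b A] summable_on_cong[of A b "\<lambda>x. norm (b x)"]
    by (auto simp: abs_summable_on_def)
  have si: "infsum h A = (LINT k|count_space A. h k)" if "\<And>k. k \<in> A \<Longrightarrow> norm (h k) \<le> b k" for h :: "'i \<Rightarrow> 'b"
  proof -
    have "Infinite_Set_Sum.abs_summable_on h A"
      unfolding abs_summable_on_def
      by (rule Bochner_Integration.integrable_bound[OF bi]) (use that b0 in \<open>auto simp: AE_count_space\<close>)
    then show ?thesis
      using infsetsum_infsum[of h A] by (simp add: infsetsum_def)
  qed
  have "(\<lambda>N. LINT k|count_space A. f N k) \<longlonglongrightarrow> (LINT k|count_space A. g k)"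
    by (rule integral_dominated_convergence[where w = b]) (use bi le lim in \<open>auto simp: AE_count_space\<close>)
  then show ?thesis using si le g by simp
qed

lemma summable_on_inverse_quadratic:
  fixes L s :: real
  assumes "L > 0"
  shows "(\<lambda>k::int. 1 / (1 + (of_int k / L - s)\<^sup>2)) summable_on A"
proof -
  have n: "(\<lambda>n::nat. 1 / (1 + (real n)\<^sup>2)) summable_on UNIV"
  proof (rule norm_summable_imp_summable_on, rule summable_comparison_test)
    show "\<exists>N. \<forall>n\<ge>N. norm (norm (1 / (1 + (real n)\<^sup>2))) \<le> inverse ((real n)^2)"
      by (intro exI[of _ 1]) (auto simp: divide_simps add_pos_nonneg)
    show "summable (\<lambda>n. inverse ((real n)^2))"
      by (rule inverse_power_summable) auto
  qed
  define g where "g = (\<lambda>k::int. 1 / (1 + (real_of_int k)\<^sup>2))"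
  have 1: "g summable_on range int"
    using n by (subst summable_on_reindex) (auto simp: g_def o_def)
  have 2: "g summable_on range (\<lambda>n. - int n)"
    using n by (subst summable_on_reindex) (auto simp: g_def o_def inj_on_def)
  have UNIV_split: "(UNIV::int set) = range int \<union> range (\<lambda>n. - int n)"
    by (auto simp: image_iff) (metis int_cases2)
  have g: "g summable_on UNIV"
    unfolding UNIV_split using summable_on_union[OF 1 2] .
  define C where "C = 1 + 2 * L\<^sup>2 + 2 * L\<^sup>2 * s\<^sup>2"
  have le: "1 / (1 + (of_int k / L - s)\<^sup>2) \<le> C * g k" for k :: int
  proof -
    define y where "y = of_int k / L - s"
    have k: "of_int k = L * (y + s)" using assms by (simp add: y_def)
    have "(y + s)\<^sup>2 \<le> 2 * y\<^sup>2 + 2 * s\<^sup>2"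
      using zero_le_power2[of "y - s"] by (simp add: power2_eq_square algebra_simps)
    then have "L\<^sup>2 * (y + s)\<^sup>2 \<le> L\<^sup>2 * (2 * y\<^sup>2 + 2 * s\<^sup>2)" by (intro mult_left_mono) auto
    moreover have "0 \<le> L\<^sup>2 * (s\<^sup>2 * y\<^sup>2)" by simp
    moreover have "0 \<le> y\<^sup>2" "0 \<le> L\<^sup>2" by simp_all
    ultimately have "1 + (of_int k)\<^sup>2 \<le> C * (1 + y\<^sup>2)"
      unfolding k C_def power_mult_distrib
      unfolding distrib_left distrib_right by (simp only: mult.assoc mult_1_left mult_1_right)
    moreover have "1 + y\<^sup>2 > 0" "1 + (real_of_int k)\<^sup>2 > 0" by (auto intro: add_pos_nonneg)
    ultimately show ?thesis
      unfolding g_def y_def[symmetric] by (simp add: field_simps)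
  qed
  have "(\<lambda>k. 1 / (1 + (of_int k / L - s)\<^sup>2)) summable_on UNIV"
  proof (rule summable_on_comparison_test)
    show "(\<lambda>k. C * g k) summable_on UNIV" using g by (rule summable_on_cmult_right)
  qed (use le in auto)
  then show ?thesis using summable_on_subset_banach by blast
qed

definition sinc_sq :: "real \<Rightarrow> real" where
  "sinc_sq y = (if y = 0 then 1 else (sin (pi * y) / (pi * y))\<^sup>2)"

text \<open>This is \<open>y sinc\<^sup>2(y)\<close>; the junk value of the division at \<open>y = 0\<close> is the correct one. It interpolates zero at
all integers and has derivative \<open>1\<close> at \<open>0\<close> and \<open>0\<close> at the other integers, and so corrects derivatives in
interpolation formulas.\<close>

definition lin_sinc_sq :: "real \<Rightarrow> real" where
  "lin_sinc_sq y = (sin (pi * y))\<^sup>2 / (pi\<^sup>2 * y)"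

lemma sinc_sq_nonneg: "0 \<le> sinc_sq y" by (simp add: sinc_sq_def)
lemma sinc_sq_minus [simp]: "sinc_sq (- y) = sinc_sq y" by (simp add: sinc_sq_def)
lemma lin_sinc_sq_minus [simp]: "lin_sinc_sq (- y) = - lin_sinc_sq y" by (simp add: lin_sinc_sq_def)
lemma sinc_sq_0 [simp]: "sinc_sq 0 = 1" by (simp add: sinc_sq_def)

lemma sinc_sq_le_1: "sinc_sq y \<le> 1"
proof (cases "y = 0")
  case False
  then have "\<bar>sin (pi * y) / (pi * y)\<bar> \<le> 1"
    using abs_sin_x_le_abs_x[of "pi * y"] by (simp add: abs_divide abs_mult)
  then show ?thesis using False by (simp add: sinc_sq_def abs_square_le_1)
qed auto

lemma sinc_sq_le: "sinc_sq y \<le> 2 * (1 / (1 + y\<^sup>2))"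
proof (cases "y\<^sup>2 \<le> 1")
  case True
  have "1 + y\<^sup>2 > 0" by (auto intro: add_pos_nonneg)
  then have "1 \<le> 2 * (1 / (1 + y\<^sup>2))" using True by (simp add: field_simps)
  then show ?thesis using sinc_sq_le_1[of y] by linarith
next
  case False
  then have y: "y \<noteq> 0" by auto
  have "(sin (pi * y))\<^sup>2 \<le> 1" by (simp add: abs_square_le_1)
  moreover have "1 \<le> pi\<^sup>2" using pi_gt3 by (intro one_le_power) simp
  ultimately have "sinc_sq y \<le> 1 / (1 * y\<^sup>2)"
    unfolding sinc_sq_def power_divide power_mult_distrib using y
    by (simp only: if_False) (intro frac_le mult_right_mono, auto)
  also have "\<dots> \<le> 2 * (1 / (1 + y\<^sup>2))"
  proof -
    have "1 + y\<^sup>2 > 0" by (auto intro: add_pos_nonneg)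
    then show ?thesis using False y by (simp add: field_simps)
  qed
  finally show ?thesis .
qed

lemma sinc_sq_summable:
  assumes "L > 0"
  shows "(\<lambda>k::int. sinc_sq (of_int k / L - s)) summable_on A"
proof (rule summable_on_comparison_test)
  show "(\<lambda>k. 2 * (1 / (1 + (of_int k / L - s)\<^sup>2))) summable_on A"
    by (rule summable_on_cmult_right[OF summable_on_inverse_quadratic[OF assms]])
qed (use sinc_sq_le sinc_sq_nonneg in auto)

lemma sinc_sq_summable_shifts: "(\<lambda>k::int. sinc_sq (y - of_int k)) summable_on A"
proof -
  have "sinc_sq (y - of_int k) = sinc_sq (of_int k / 1 - y)" for k :: int
    using sinc_sq_minus[of "y - of_int k"] by simp
  then show ?thesis using sinc_sq_summable[of 1 y A] by simp
qed

lemma isCont_sinc_sq: "isCont sinc_sq y"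
proof (cases "y = 0")
  case True
  have "(\<lambda>y. (sin (pi * y) / (pi * y))) \<midarrow>0\<rightarrow> 1"
  proof -
    have "(\<lambda>x::real. sin x / x) \<midarrow>0\<rightarrow> 1"
      using DERIV_sin[of 0] by (simp add: DERIV_def)
    moreover have "filterlim (\<lambda>y. pi * y) (at 0) (at 0)"
      by (rule filterlim_atI) (auto intro!: tendsto_eq_intros simp: eventually_at_filter)
    ultimately show ?thesis by (rule filterlim_compose)
  qed
  then have "(\<lambda>y. (sin (pi * y) / (pi * y))\<^sup>2) \<midarrow>0\<rightarrow> 1"
    by (auto intro: tendsto_eq_intros)
  moreover have "(sinc_sq \<midarrow>0\<rightarrow> 1) \<longleftrightarrow> (\<lambda>y. (sin (pi * y) / (pi * y))\<^sup>2) \<midarrow>0\<rightarrow> 1"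
    by (rule filterlim_cong) (auto simp: eventually_at_filter sinc_sq_def)
  ultimately show ?thesis using True by (simp add: isCont_def)
next
  case False
  have "isCont (\<lambda>y. (sin (pi * y) / (pi * y))\<^sup>2) y"
    using False by (intro continuous_intros) auto
  moreover have "eventually (\<lambda>y. sinc_sq y = (sin (pi * y) / (pi * y))\<^sup>2) (nhds y)"
    using False t1_space_nhds[of y 0] by (auto elim: eventually_mono simp: sinc_sq_def)
  ultimately show ?thesis using isCont_cong by force
qed

lemma cos_shift_squared: "(cos (a - pi * of_int k))\<^sup>2 = (cos a)\<^sup>2"
proof -
  have "(cos (pi * of_int k))\<^sup>2 = 1"
    using sin_cos_squared_add[of "pi * of_int k"] sin_npi_int[of k] by simp
  then show ?thesis
    using sin_npi_int[of k] by (simp add: cos_diff power_mult_distrib)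
qed

text \<open>From \<open>sin 2\<theta> = 2 sin \<theta> cos \<theta>\<close>. Together with the corresponding identity for odd shifts this makes the
periodization of \<open>sinc\<^sup>2\<close> at \<open>y\<close> a weighted mean of its values at \<open>y/2\<close> and \<open>(y - 1)/2\<close>.\<close>

lemma sinc_sq_halve: "sinc_sq y = (cos (pi * y / 2))\<^sup>2 * sinc_sq (y / 2)"
proof (cases "y = 0")
  case False
  have "sin (pi * y) = 2 * sin (pi * y / 2) * cos (pi * y / 2)"
    using sin_double[of "pi * y / 2"] by simp
  then show ?thesis using False by (simp add: sinc_sq_def field_simps power2_eq_square)
qed auto

text \<open>For non-integral \<open>y\<close> this is \<open>\<Sum>\<^sub>k 1/(y - k)\<^sup>2 = \<pi>\<^sup>2/sin\<^sup>2(\<pi>y)\<close>, proved by a maximum principle in the style of Herglotz.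
The sum \<open>g\<close> is continuous and periodic, and \<open>g(y)\<close> is a mean of \<open>g(y/2)\<close> and \<open>g((y - 1)/2)\<close> with weights
\<open>cos\<^sup>2(\<pi>y/2)\<close> and \<open>sin\<^sup>2(\<pi>y/2)\<close>. At a point where the maximum is attained both values equal the maximum, so it is
also attained at \<open>y/2, y/4, \<dots>\<close> and hence at \<open>0\<close>, where \<open>g = 1\<close>; the same holds for the minimum.\<close>

lemma sinc_sq_partition: "(\<Sum>\<^sub>\<infinity>k::int. sinc_sq (y - of_int k)) = 1"
proof -
  define g where "g y = (\<Sum>\<^sub>\<infinity>k::int. sinc_sq (y - of_int k))" for y
  have g_halve: "g y = (cos (pi * y / 2))\<^sup>2 * g (y / 2) + (sin (pi * y / 2))\<^sup>2 * g ((y - 1) / 2)" for y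
  proof -
    let ?f = "\<lambda>k::int. sinc_sq (y - of_int k)"
    have UNIV_split: "(UNIV :: int set) = range (\<lambda>k. 2 * k) \<union> range (\<lambda>k. 2 * k + 1)"
      by (auto simp: image_iff) presburger
    have disj: "range (\<lambda>k::int. 2 * k) \<inter> range (\<lambda>k. 2 * k + 1) = {}"
      by auto presburger
    have "g y = infsum ?f (range (\<lambda>k. 2 * k)) + infsum ?f (range (\<lambda>k. 2 * k + 1))"
      unfolding g_def by (subst UNIV_split, rule infsum_Un_disjoint) (use disj sinc_sq_summable_shifts in auto)
    also have "infsum ?f (range (\<lambda>k. 2 * k)) = (\<Sum>\<^sub>\<infinity>k::int. (cos (pi * y / 2))\<^sup>2 * sinc_sq (y / 2 - of_int k))"
    proof (subst infsum_reindex)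
      have "?f (2 * k) = (cos (pi * y / 2))\<^sup>2 * sinc_sq (y / 2 - of_int k)" for k
      proof -
        have decomp: "pi * (y - 2 * of_int k) / 2 = pi * y / 2 - pi * of_int k" by (simp add: algebra_simps diff_divide_distrib)
        have "(cos (pi * (y - 2 * of_int k) / 2))\<^sup>2 = (cos (pi * y / 2))\<^sup>2"
          unfolding decomp by (rule cos_shift_squared)
        then show ?thesis using sinc_sq_halve[of "y - 2 * of_int k"] by (simp add: diff_divide_distrib)
      qed
      then show "infsum (?f \<circ> (\<lambda>k. 2 * k)) UNIV = (\<Sum>\<^sub>\<infinity>k::int. (cos (pi * y / 2))\<^sup>2 * sinc_sq (y / 2 - of_int k))"
        by (simp add: o_def)
    qed (auto simp: inj_on_def)
    also have "\<dots> = (cos (pi * y / 2))\<^sup>2 * g (y / 2)"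
      unfolding g_def by (rule infsum_cmult_right) (use sinc_sq_summable_shifts in auto)
    also have "infsum ?f (range (\<lambda>k. 2 * k + 1)) = (\<Sum>\<^sub>\<infinity>k::int. (sin (pi * y / 2))\<^sup>2 * sinc_sq ((y - 1) / 2 - of_int k))"
    proof (subst infsum_reindex)
      have "?f (2 * k + 1) = (sin (pi * y / 2))\<^sup>2 * sinc_sq ((y - 1) / 2 - of_int k)" for k
      proof -
        have decomp: "pi * (y - (2 * of_int k + 1)) / 2 = (pi * y / 2 - pi / 2) - pi * of_int k"
          by (simp add: algebra_simps diff_divide_distrib add_divide_distrib)
        have "(cos (pi * (y - (2 * of_int k + 1)) / 2))\<^sup>2 = (sin (pi * y / 2))\<^sup>2"
          unfolding decomp cos_shift_squared by (simp add: cos_diff)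
        moreover have "(y - (2 * of_int k + 1)) / 2 = (y - 1) / 2 - of_int k" by (simp add: field_simps)
        ultimately show ?thesis using sinc_sq_halve[of "y - (2 * of_int k + 1)"] by (simp only: of_int_add of_int_mult of_int_numeral of_int_1)
      qed
      then show "infsum (?f \<circ> (\<lambda>k. 2 * k + 1)) UNIV = (\<Sum>\<^sub>\<infinity>k::int. (sin (pi * y / 2))\<^sup>2 * sinc_sq ((y - 1) / 2 - of_int k))"
        by (simp add: o_def)
    qed (auto simp: inj_on_def)
    also have "\<dots> = (sin (pi * y / 2))\<^sup>2 * g ((y - 1) / 2)"
      unfolding g_def by (rule infsum_cmult_right) (use sinc_sq_summable_shifts in auto)
    finally show ?thesis .
  qed
  have g_per: "g (y + of_int m) = g y" for y m
    unfolding g_def by (rule infsum_reindex_bij_witness[of UNIV "\<lambda>k. k + m" "\<lambda>k. k - m"]) (auto simp: algebra_simps)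
  have g0: "g 0 = 1"
  proof -
    have "sinc_sq (0 - of_int k) = (if k = 0 then 1 else 0)" for k :: int
      using sin_npi_int[of k] by (simp add: sinc_sq_def)
    then have "g 0 = (\<Sum>\<^sub>\<infinity>k::int. if k = 0 then 1 else 0)" by (simp add: g_def)
    also have "\<dots> = (\<Sum>\<^sub>\<infinity>k\<in>{0::int}. 1)" by (rule infsum_cong_neutral) auto
    finally show ?thesis by simp
  qed
  have cont: "continuous_on {-1..1} g"
  proof (rule continuous_on_sequentiallyI)
    fix u :: "nat \<Rightarrow> real" and a
    assume u: "\<forall>n. u n \<in> {-1..1}" and a: "a \<in> {-1..1}" and lim: "u \<longlonglongrightarrow> a"
    have le: "norm (sinc_sq (u n - of_int k)) \<le> 6 * (1 / (1 + (of_int k / 1 - 0)\<^sup>2))" for n k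
    proof -
      have "1 + (of_int k)\<^sup>2 \<le> 3 * (1 + (u n - of_int k)\<^sup>2)"
      proof -
        have "(u n)\<^sup>2 \<le> 1" using u[rule_format, of n] by (simp add: abs_square_le_1 abs_le_iff)
        \<comment> \<open>Completing the square in \<open>k\<close>.\<close>
        moreover have "0 \<le> (3 * u n - 2 * of_int k)\<^sup>2" by simp
        ultimately show ?thesis by (simp add: power2_eq_square algebra_simps)
      qed
      moreover have "1 + (u n - of_int k)\<^sup>2 > 0" "1 + (real_of_int k)\<^sup>2 > 0" by (auto intro: add_pos_nonneg)
      ultimately have "2 * (1 / (1 + (u n - of_int k)\<^sup>2)) \<le> 6 * (1 / (1 + (of_int k)\<^sup>2))"
        by (simp add: field_simps)
      then show ?thesis using sinc_sq_le[of "u n - of_int k"] sinc_sq_nonneg[of "u n - of_int k"] by simp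
    qed
    show "(\<lambda>n. g (u n)) \<longlonglongrightarrow> g a"
      unfolding g_def
    proof (rule tannery[where b = "\<lambda>k. 6 * (1 / (1 + (of_int k / 1 - 0)\<^sup>2))"])
      show "(\<lambda>k::int. 6 * (1 / (1 + (of_int k / 1 - 0)\<^sup>2 :: real))) summable_on UNIV"
        by (intro summable_on_cmult_right summable_on_inverse_quadratic) auto
      show "(\<lambda>n. sinc_sq (u n - of_int k)) \<longlonglongrightarrow> sinc_sq (a - of_int k)" for k
        by (intro isCont_tendsto_compose[OF isCont_sinc_sq] tendsto_intros lim)
    qed (use le in auto)
  qed
  \<comment> \<open>The maximum principle, in a form that applies to both \<open>g\<close> and \<open>-g\<close>.\<close>
  have ext: "h y \<le> h 0" if h: "continuous_on {-1..1} h"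
      "\<And>y. h y = (cos (pi * y / 2))\<^sup>2 * h (y / 2) + (sin (pi * y / 2))\<^sup>2 * h ((y - 1) / 2)"
      "\<And>y m. h (y + of_int m) = h y" for h :: "real \<Rightarrow> real" and y
  proof -
    obtain z where z: "z \<in> {-1..1}" "\<And>x. x \<in> {-1..1} \<Longrightarrow> h x \<le> h z"
      using continuous_attains_sup[OF _ _ h(1)] by auto
    have max: "h x \<le> h z" for x
    proof -
      have "h x = h (frac x)" using h(3)[of "frac x" "\<lfloor>x\<rfloor>"] by (simp add: frac_def)
      then show ?thesis using z(2)[of "frac x"] frac_lt_1[of x] frac_ge_0[of x] by simp
    qed
    have step: "h (w / 2) = h z" if "h w = h z" "cos (pi * w / 2) \<noteq> 0" for w
    proof (rule ccontr)
      assume "h (w / 2) \<noteq> h z"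
      then have "h (w / 2) < h z" using max[of "w/2"] by linarith
      then have "(cos (pi * w / 2))\<^sup>2 * h (w / 2) < (cos (pi * w / 2))\<^sup>2 * h z"
        using that(2) by simp
      moreover have "(sin (pi * w / 2))\<^sup>2 * h ((w - 1) / 2) \<le> (sin (pi * w / 2))\<^sup>2 * h z"
        by (intro mult_left_mono max) auto
      ultimately have "h w < ((sin (pi * w / 2))\<^sup>2 + (cos (pi * w / 2))\<^sup>2) * h z"
        unfolding h(2)[of w] distrib_right by linarith
      then show False using that by simp
    qed
    \<comment> \<open>Reduction to \<open>[0, 1)\<close> keeps the weight of \<open>h (w / 2)\<close> positive along the halving sequence.\<close>
    define v where "v = frac z"
    have v: "h v = h z" "0 \<le> v" "v < 1"
      using h(3)[of "frac z" "\<lfloor>z\<rfloor>"] frac_lt_1[of z] frac_ge_0[of z] by (simp_all add: v_def frac_def)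
    have "h (v / 2 ^ n) = h z" for n
    proof (induction n)
      case (Suc n)
      have *: "v / 2 ^ n \<le> v" using v by (simp add: divide_le_eq mult_le_cancel_left1)
      have "cos (pi * (v / 2 ^ n) / 2) > 0"
      proof (rule cos_gt_zero_pi)
        have "pi * (v / 2 ^ n) < pi * 1" using le_less_trans[OF * v(3)] by (intro mult_strict_left_mono) auto
        then show "pi * (v / 2 ^ n) / 2 < pi / 2" by simp
        have "0 \<le> pi * (v / 2 ^ n) / 2" using v by simp
        then show "- (pi / 2) < pi * (v / 2 ^ n) / 2" using pi_gt_zero by linarith
      qed
      then show ?case using step[OF Suc.IH] by (simp add: field_simps)
    qed (use v in auto)
    moreover have "(\<lambda>n. h (v / 2 ^ n)) \<longlonglongrightarrow> h 0"
    proof (rule continuous_on_tendsto_compose[OF h(1)])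
      show "(\<lambda>n. v / 2 ^ n) \<longlonglongrightarrow> 0"
        using LIMSEQ_divide_realpow_zero[of 2 v] by simp
      have "v / 2 ^ n \<in> {-1..1}" for n
      proof -
        have "0 \<le> v / 2 ^ n" using v by simp
        moreover have "v / 2 ^ n \<le> 1 / 1" using v by (intro frac_le one_le_power) auto
        ultimately show ?thesis by simp
      qed
      then show "\<forall>\<^sub>F n in sequentially. v / 2 ^ n \<in> {-1..1}" by simp
    qed auto
    ultimately have "h z = h 0" using LIMSEQ_const_iff by auto
    then show ?thesis using max[of y] by simp
  qed
  have "g y \<le> 1" using ext[OF cont g_halve g_per] g0 by simp
  moreover have "- g y \<le> - g 0"
  proof (rule ext[of "\<lambda>y. - g y"])
    show "continuous_on {-1..1} (\<lambda>y. - g y)" using cont by (intro continuous_intros)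
    show "- g y = (cos (pi * y / 2))\<^sup>2 * - g (y / 2) + (sin (pi * y / 2))\<^sup>2 * - g ((y - 1) / 2)" for y
      using g_halve[of y] by simp
  qed (use g_per in auto)
  ultimately show ?thesis using g0 by (simp add: g_def)
qed

section \<open>Beurling's majorant of the unit step and Selberg's majorant of an interval\<close>

text \<open>Up to an affine change this is Beurling's function \<open>B\<close>, namely \<open>(1 + B)/2\<close>: it interpolates the indicator of
\<open>[0, \<infinity>)\<close> at the integers, and its derivative vanishes at all integers except \<open>0\<close>.\<close>

definition step_maj :: "real \<Rightarrow> real" where
  "step_maj y = (\<Sum>\<^sub>\<infinity>k\<in>{0::int..}. sinc_sq (y - of_int k)) + lin_sinc_sq y"

text \<open>Although the function itself is an infinite sum, its differences are finite sums; this is what later makes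
its Fourier transform accessible.\<close>

lemma step_maj_unit_diff: "step_maj y - step_maj (y - 1) = sinc_sq y + (lin_sinc_sq y - lin_sinc_sq (y - 1))"
proof -
  have decomp: "{0::int..} = {0} \<union> {1..}" by auto
  have "(\<Sum>\<^sub>\<infinity>k\<in>{0::int..}. sinc_sq (y - of_int k)) = sinc_sq y + (\<Sum>\<^sub>\<infinity>k\<in>{1::int..}. sinc_sq (y - of_int k))"
    unfolding decomp by (subst infsum_Un_disjoint) (use sinc_sq_summable_shifts in auto)
  also have "(\<Sum>\<^sub>\<infinity>k\<in>{1::int..}. sinc_sq (y - of_int k)) = (\<Sum>\<^sub>\<infinity>k\<in>{0::int..}. sinc_sq (y - 1 - of_int k))"
    by (rule infsum_reindex_bij_witness[of _ "\<lambda>k. k + 1" "\<lambda>k. k - 1"]) (auto simp: algebra_simps)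
  finally show ?thesis by (simp add: step_maj_def)
qed

text \<open>By the partition of unity, the deviation from \<open>1\<close> is an interpolation sum over the negative integers, where for
\<open>y > 0\<close> no term is singular.\<close>

lemma step_maj_minus_1: "step_maj y - 1 = lin_sinc_sq y - (\<Sum>\<^sub>\<infinity>k\<in>{..<0::int}. sinc_sq (y - of_int k))"
proof -
  have decomp: "(UNIV::int set) = {..<0} \<union> {0..}" by auto
  have "1 = (\<Sum>\<^sub>\<infinity>k\<in>{..<0::int}. sinc_sq (y - of_int k)) + (\<Sum>\<^sub>\<infinity>k\<in>{0::int..}. sinc_sq (y - of_int k))"
    unfolding sinc_sq_partition[of y, symmetric]
    by (subst decomp, rule infsum_Un_disjoint) (use sinc_sq_summable_shifts in auto)
  then show ?thesis by (simp add: step_maj_def)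
qed

text \<open>So the values at negative arguments are controlled by those at positive ones.\<close>

lemma step_maj_reflect: "step_maj y + step_maj (- y) = 1 + sinc_sq y"
proof -
  have decomp: "{..0::int} = {0} \<union> {..<0}" by auto
  have "(\<Sum>\<^sub>\<infinity>k\<in>{0::int..}. sinc_sq (- y - of_int k)) = (\<Sum>\<^sub>\<infinity>k\<in>{..0::int}. sinc_sq (y - of_int k))"
  proof (rule infsum_reindex_bij_witness[of _ uminus uminus])
    show "sinc_sq (y - of_int (- k)) = sinc_sq (- y - of_int k)" for k
      using sinc_sq_minus[of "y + of_int k"] by simp
  qed auto
  also have "\<dots> = sinc_sq y + (\<Sum>\<^sub>\<infinity>k\<in>{..<0::int}. sinc_sq (y - of_int k))"
    unfolding decomp by (subst infsum_Un_disjoint) (use sinc_sq_summable_shifts in auto)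
  finally show ?thesis using step_maj_minus_1[of y] by (simp add: step_maj_def)
qed

lemma step_maj_0 [simp]: "step_maj 0 = 1" using step_maj_reflect[of 0] by simp

lemma step_maj_pos_eq:
  assumes "y > 0"
  shows "summable (\<lambda>n. 1 / (y + real n + 1)\<^sup>2)"
    and "step_maj y - 1 = (sin (pi * y) / pi)\<^sup>2 * (1 / y - (\<Sum>n. 1 / (y + real n + 1)\<^sup>2))"
proof -
  show s: "summable (\<lambda>n. 1 / (y + real n + 1)\<^sup>2)"
  proof (rule summable_comparison_test)
    show "\<exists>N. \<forall>n\<ge>N. norm (1 / (y + real n + 1)\<^sup>2) \<le> inverse ((real (Suc n))\<^sup>2)"
      using assms by (intro exI[of _ 0]) (auto simp: divide_simps intro!: power_mono)
    show "summable (\<lambda>n. inverse ((real (Suc n))\<^sup>2))"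
      using inverse_power_summable[of 2, where ?'a = real] by (subst summable_Suc_iff) auto
  qed
  let ?c = "(sin (pi * y) / pi)\<^sup>2"
  have "(\<Sum>\<^sub>\<infinity>k\<in>{..<0::int}. sinc_sq (y - of_int k)) = (\<Sum>\<^sub>\<infinity>n::nat. ?c * (1 / (y + real n + 1)\<^sup>2))"
  proof (rule infsum_reindex_bij_witness[of _ "\<lambda>n. - int n - 1" "\<lambda>k. nat (- k - 1)"])
    fix k :: int assume k: "k \<in> {..<0}"
    have "(sin (pi * (y - of_int k)))\<^sup>2 = (sin (pi * y))\<^sup>2"
    proof -
      have "(cos (pi * y - pi * of_int k))\<^sup>2 = (cos (pi * y))\<^sup>2" by (rule cos_shift_squared)
      then show ?thesis using sin_squared_eq[of "pi * y - pi * of_int k"] sin_squared_eq[of "pi * y"]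
        by (simp only: right_diff_distrib)
    qed
    note sin = this
    have nz: "y - of_int k \<noteq> 0" using k assms by simp
    have "sinc_sq (y - of_int k) = (sin (pi * (y - of_int k)))\<^sup>2 / (pi * (y - of_int k))\<^sup>2"
      using nz by (simp add: sinc_sq_def power_divide)
    also have "\<dots> = ?c * (1 / (y - of_int k)\<^sup>2)"
      unfolding sin by (simp add: power_divide power_mult_distrib)
    also have "\<dots> = ?c * (1 / (y + real (nat (- k - 1)) + 1)\<^sup>2)" using k by simp
    finally show "?c * (1 / (y + real (nat (- k - 1)) + 1)\<^sup>2) = sinc_sq (y - of_int k)" by simp
  qed auto
  also have "\<dots> = (\<Sum>n. ?c * (1 / (y + real n + 1)\<^sup>2))"
  proof (rule infsumI, rule norm_summable_imp_has_sum)
    show "summable (\<lambda>n. norm (?c * (1 / (y + real n + 1)\<^sup>2)))"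
      using summable_mult[OF s, of ?c] by (simp add: abs_mult)
    show "(\<lambda>n. ?c * (1 / (y + real n + 1)\<^sup>2)) sums (\<Sum>n. ?c * (1 / (y + real n + 1)\<^sup>2))"
      using summable_mult[OF s, of ?c] by (rule summable_sums)
  qed
  also have "\<dots> = ?c * (\<Sum>n. 1 / (y + real n + 1)\<^sup>2)" by (rule suminf_mult[OF s])
  finally show "step_maj y - 1 = ?c * (1 / y - (\<Sum>n. 1 / (y + real n + 1)\<^sup>2))"
    using assms unfolding step_maj_minus_1 by (simp add: lin_sinc_sq_def power_divide power2_eq_square right_diff_distrib)
qed

text \<open>Comparison with telescoping sums. Put \<open>a = y + n\<close>. The upper bounds rest on
\<open>1/(a+1)\<^sup>2 \<le> 1/(a(a+1)) = 1/a - 1/(a+1)\<close> and on the sharper \<open>1/(a+1)\<^sup>2 \<le> 1/((a+1/2)(a+3/2))\<close>. The lower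
bound is the trapezoidal rule: by the inequality of arithmetic and geometric means, the mean of
\<open>1/a\<^sup>2\<close> and \<open>1/(a+1)\<^sup>2\<close> is at least \<open>1/a - 1/(a+1)\<close>.\<close>

lemma telescoping_bounds:
  fixes y :: real
  assumes "y > 0"
  defines "Z \<equiv> (\<Sum>n. 1 / (y + real n + 1)\<^sup>2)"
  shows "Z \<le> 1 / y" and "1 / y - 1 / (2 * y\<^sup>2) \<le> Z" and "Z \<le> 1 / (y + 1/2)"
proof -
  have inf: "filterlim (\<lambda>n. y + real n + c) at_top sequentially" for c
    using filterlim_tendsto_add_at_top[OF tendsto_const[of "y + c"] filterlim_real_sequentially]
    by (simp add: add_ac)
  have lim: "(\<lambda>n. 1 / (y + real n + c)) \<longlonglongrightarrow> 0" for c
    by (rule tendsto_divide_0[OF tendsto_const filterlim_at_top_imp_at_infinity[OF inf]])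
  have lim2: "(\<lambda>n. 1 / (2 * (y + real n)\<^sup>2)) \<longlonglongrightarrow> 0"
    using tendsto_mult[OF tendsto_mult[OF tendsto_const[of "1/2"] lim[of 0]] lim[of 0]]
    by (simp add: power2_eq_square field_simps)
  have s: "summable (\<lambda>n. 1 / (y + real n + 1)\<^sup>2)" by (rule step_maj_pos_eq(1)[OF assms(1)])
  have up: "Z \<le> g 0" if "g \<longlonglongrightarrow> 0" "\<And>n. 1 / (y + real n + 1)\<^sup>2 \<le> g n - g (Suc n)" for g
    using suminf_le[OF that(2) s sums_summable[OF telescope_sums'[OF that(1)]]]
      sums_unique[OF telescope_sums'[OF that(1)]] by (simp add: Z_def)
  have lo: "g 0 \<le> Z" if "g \<longlonglongrightarrow> 0" "\<And>n. g n - g (Suc n) \<le> 1 / (y + real n + 1)\<^sup>2" for g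
    using suminf_le[OF that(2) sums_summable[OF telescope_sums'[OF that(1)]] s]
      sums_unique[OF telescope_sums'[OF that(1)]] by (simp add: Z_def)
  have "1 / (y + real n + 1)\<^sup>2 \<le> 1 / (y + real n) - 1 / (y + real (Suc n))" for n
  proof -
    define a where "a = y + real n"
    have a: "a > 0" using assms by (simp add: a_def add_pos_nonneg)
    have "1 / (a + 1)\<^sup>2 \<le> 1 / a - 1 / (a + 1)"
      using a by (simp add: divide_simps power2_eq_square)
    then show ?thesis by (simp add: a_def algebra_simps)
  qed
  from up[OF lim[of 0, simplified] this] show "Z \<le> 1 / y" by simp
  have "1 / (y + real n + 1)\<^sup>2 \<le> 1 / (y + real n + 1/2) - 1 / (y + real (Suc n) + 1/2)" for n
  proof -
    define a where "a = y + real n"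
    have a: "a > 0" using assms by (simp add: a_def add_pos_nonneg)
    have "1 / (a + 1)\<^sup>2 \<le> 1 / (a + 1/2) - 1 / (a + 3/2)"
    proof -
      have "1 / (a + 1/2) - 1 / (a + 3/2) = 1 / ((a + 1/2) * (a + 3/2))"
        using a by (simp add: field_simps)
      moreover have "(a + 1/2) * (a + 3/2) \<le> (a + 1)\<^sup>2"
        by (simp add: power2_eq_square field_simps)
      ultimately show ?thesis using a by (simp add: frac_le)
    qed
    then show ?thesis by (simp add: a_def algebra_simps)
  qed
  from up[OF lim[of "1/2"] this] show "Z \<le> 1 / (y + 1/2)" by simp
  have "(1 / (y + real n) - 1 / (2 * (y + real n)\<^sup>2)) - (1 / (y + real (Suc n)) - 1 / (2 * (y + real (Suc n))\<^sup>2))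
      \<le> 1 / (y + real n + 1)\<^sup>2" for n
  proof -
    define a where "a = y + real n"
    have a: "a > 0" using assms by (simp add: a_def add_pos_nonneg)
    define p r where "p = 1 / a" and "r = 1 / (a + 1)"
    have "p - r = p * r" using a by (simp add: p_def r_def field_simps)
    moreover have "0 \<le> (p - r)\<^sup>2" by simp
    then have "0 \<le> p\<^sup>2 + r\<^sup>2 - 2 * (p * r)" by (simp only: power2_diff mult.assoc)
    ultimately have "p - p\<^sup>2 / 2 - (r - r\<^sup>2 / 2) \<le> r\<^sup>2" by linarith
    then have "1 / a - 1 / (2 * a\<^sup>2) - (1 / (a + 1) - 1 / (2 * (a + 1)\<^sup>2)) \<le> 1 / (a + 1)\<^sup>2"
      by (simp add: p_def r_def power_divide mult.commute[of _ 2])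
    then show ?thesis by (simp add: a_def algebra_simps)
  qed
  from lo[OF _ this] tendsto_diff[OF lim[of 0] lim2] show "1 / y - 1 / (2 * y\<^sup>2) \<le> Z" by simp
qed

lemma sinc_sq_pos_eq: "y > 0 \<Longrightarrow> sinc_sq y = (sin (pi * y) / pi)\<^sup>2 * (1 / y\<^sup>2)"
  by (simp add: sinc_sq_def power_divide power_mult_distrib)

lemma step_maj_ge_1: "y \<ge> 0 \<Longrightarrow> 1 \<le> step_maj y"
proof (cases "y = 0")
  case False
  assume "y \<ge> 0"
  with False have y: "y > 0" by simp
  have "0 \<le> step_maj y - 1"
    unfolding step_maj_pos_eq(2)[OF y] by (intro mult_nonneg_nonneg) (use telescoping_bounds(1)[OF y] in auto)
  then show ?thesis by simp
qed auto

lemma step_maj_le: "y \<ge> 0 \<Longrightarrow> step_maj y \<le> 1 + sinc_sq y / 2"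
proof (cases "y = 0")
  case False
  assume "y \<ge> 0"
  with False have y: "y > 0" by simp
  have "step_maj y - 1 \<le> (sin (pi * y) / pi)\<^sup>2 * (1 / (2 * y\<^sup>2))"
    unfolding step_maj_pos_eq(2)[OF y] by (intro mult_left_mono) (use telescoping_bounds(2)[OF y] in auto)
  then show ?thesis by (simp add: sinc_sq_pos_eq[OF y])
qed auto

text \<open>A lower bound for the excess over the step: the difference of \<open>1/y\<close> and the third telescoping bound
\<open>1/(y + 1/2)\<close> is at least \<open>1/(3y\<^sup>2)\<close> exactly when \<open>y \<ge> 1\<close>.\<close>

lemma sinc_sq_le_step_maj: 
  assumes "y \<ge> 1"
  shows "sinc_sq y \<le> 3 * (step_maj y - 1)"
proof -
  have y: "y > 0" using assms by simp
  have "1 / (y + 1/2) \<le> 1 / y - 1 / (3 * y\<^sup>2)"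
  proof -
    have "1 / y - 1 / (3 * y\<^sup>2) = (3 * y - 1) / (3 * y\<^sup>2)"
      using y by (simp add: field_simps power2_eq_square)
    moreover have "1 / (y + 1/2) \<le> (3 * y - 1) / (3 * y\<^sup>2)"
      using y assms by (subst frac_le_eq) (auto simp: power2_eq_square algebra_simps divide_le_0_iff add_pos_pos)
    ultimately show ?thesis by simp
  qed
  then have "1 / (3 * y\<^sup>2) \<le> 1 / y - (\<Sum>n. 1 / (y + real n + 1)\<^sup>2)"
    using telescoping_bounds(3)[OF y] by linarith
  then have "(sin (pi * y) / pi)\<^sup>2 * (1 / (3 * y\<^sup>2)) \<le> step_maj y - 1"
    unfolding step_maj_pos_eq(2)[OF y] by (intro mult_left_mono) auto
  then show ?thesis by (simp add: sinc_sq_pos_eq[OF y])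
qed

lemma step_maj_nonpos: "y \<le> 0 \<Longrightarrow> sinc_sq y / 2 \<le> step_maj y" "y \<le> 0 \<Longrightarrow> step_maj y \<le> sinc_sq y"
  using step_maj_ge_1[of "- y"] step_maj_le[of "- y"] step_maj_reflect[of y] by auto

text \<open>Selberg's majorant of \<open>[-\<mu>, \<mu>]\<close>: the indicator is a sum of two steps minus \<open>1\<close>.\<close>

definition interval_maj :: "real \<Rightarrow> real \<Rightarrow> real" where
  "interval_maj \<mu> y = step_maj (y + \<mu>) + step_maj (\<mu> - y) - 1"

text \<open>The mean of Selberg's majorant and minorant of \<open>[-\<mu>, \<mu>]\<close>: subtracting \<open>sinc\<^sup>2\<close> at both ends instead of half
of it would give the minorant.\<close>

definition interval_mid :: "real \<Rightarrow> real \<Rightarrow> real" where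
  "interval_mid \<mu> y = interval_maj \<mu> y - (sinc_sq (y + \<mu>) + sinc_sq (\<mu> - y)) / 2"

lemma interval_maj_minus: "interval_maj \<mu> (- y) = interval_maj \<mu> y" by (simp add: interval_maj_def add.commute)
lemma interval_mid_minus: "interval_mid \<mu> (- y) = interval_mid \<mu> y" by (simp add: interval_mid_def interval_maj_minus add.commute)

lemma interval_maj_mid_inside:
  assumes "\<bar>y\<bar> \<le> \<mu>"
  shows "1 \<le> interval_maj \<mu> y" "0 \<le> interval_mid \<mu> y" "interval_mid \<mu> y \<le> 1"
  using assms step_maj_ge_1[of "y + \<mu>"] step_maj_ge_1[of "\<mu> - y"] step_maj_le[of "y + \<mu>"] step_maj_le[of "\<mu> - y"]
    sinc_sq_le_1[of "y + \<mu>"] sinc_sq_le_1[of "\<mu> - y"]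
  by (auto simp: interval_maj_def interval_mid_def abs_le_iff add_divide_distrib)

text \<open>For \<open>y \<ge> \<mu>\<close> let \<open>P\<close> be the excess over \<open>1\<close> of the step majorant at \<open>y + \<mu>\<close> and \<open>Q\<close> its value at \<open>\<mu> - y\<close>, so
that \<open>M = P + Q\<close> and \<open>H = M - (s + t)/2\<close> with \<open>s\<close>, \<open>t\<close> the values of \<open>sinc\<^sup>2\<close> there. The claim amounts to
\<open>s + t \<le> 3M\<close> and \<open>M \<le> s + t\<close>. It is here that the length of the interval must be at least \<open>1\<close>:
\<open>s \<le> 3P\<close> is available only for \<open>y + \<mu> \<ge> 1\<close>.\<close>

lemma interval_maj_mid_outside:
  assumes "\<mu> \<ge> 1/2" "\<bar>y\<bar> \<ge> \<mu>"
  shows "2 * \<bar>interval_mid \<mu> y\<bar> \<le> interval_maj \<mu> y"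
proof -
  have *: "2 * \<bar>interval_mid \<mu> y\<bar> \<le> interval_maj \<mu> y" if "y \<ge> \<mu>" for y
    using assms that step_maj_le[of "y + \<mu>"] sinc_sq_le_step_maj[of "y + \<mu>"] step_maj_nonpos[of "\<mu> - y"]
      sinc_sq_nonneg[of "y + \<mu>"] sinc_sq_nonneg[of "\<mu> - y"]
    unfolding interval_mid_def interval_maj_def add_divide_distrib by (simp only: abs_if split: if_split) (linarith | simp)+
  show ?thesis
  proof (cases "y \<ge> 0")
    case False
    then show ?thesis using *[of "- y"] assms(2) by (simp add: interval_maj_minus interval_mid_minus)
  qed (use * assms(2) in auto)
qed

lemma interval_maj_nonneg: "\<mu> \<ge> 0 \<Longrightarrow> 0 \<le> interval_maj \<mu> y"
proof -
  assume \<mu>: "\<mu> \<ge> 0"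
  have *: "0 \<le> interval_maj \<mu> y" if "y \<ge> \<mu>" for y
    using \<mu> that step_maj_ge_1[of "y + \<mu>"] step_maj_nonpos[of "\<mu> - y"] sinc_sq_nonneg[of "\<mu> - y"] by (simp add: interval_maj_def)
  show ?thesis
    using interval_maj_mid_inside(1)[of y \<mu>] *[of y] *[of "- y"] by (cases "\<bar>y\<bar> \<le> \<mu>") (auto simp: interval_maj_minus abs_if split: if_splits)
qed

lemma interval_maj_le:
  assumes "\<mu> \<ge> 0"
  shows "interval_maj \<mu> y \<le> (if \<bar>y\<bar> \<le> \<mu> then 1 else 0) + (sinc_sq (y + \<mu>) + sinc_sq (y - \<mu>))"
proof -
  have *: "interval_maj \<mu> y \<le> sinc_sq (y + \<mu>) + sinc_sq (y - \<mu>)" if "y \<ge> \<mu>" for y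
    using assms that step_maj_le[of "y + \<mu>"] step_maj_nonpos[of "\<mu> - y"] sinc_sq_nonneg[of "y + \<mu>"] sinc_sq_minus[of "\<mu> - y"]
    by (simp add: interval_maj_def)
  show ?thesis
  proof (cases "\<bar>y\<bar> \<le> \<mu>")
    case True
    then have "interval_maj \<mu> y \<le> 1 + sinc_sq (y + \<mu>) / 2 + sinc_sq (\<mu> - y) / 2"
      using step_maj_le[of "y + \<mu>"] step_maj_le[of "\<mu> - y"] by (simp add: interval_maj_def abs_le_iff)
    then show ?thesis using True sinc_sq_nonneg[of "y + \<mu>"] sinc_sq_nonneg[of "\<mu> - y"] sinc_sq_minus[of "\<mu> - y"] by simp
  next
    case False
    then consider "y \<ge> \<mu>" | "- y \<ge> \<mu>" by linarith
    then show ?thesis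
    proof cases
      case 2
      then show ?thesis using *[OF 2] False sinc_sq_minus[of "y + \<mu>"] sinc_sq_minus[of "y - \<mu>"] by (simp add: interval_maj_minus)
    qed (use * False in auto)
  qed
qed

lemma interval_maj_unit_diff:
  "interval_maj \<mu> y - interval_maj \<mu> (y - 1) = sinc_sq (y + \<mu>) + (lin_sinc_sq (y + \<mu>) - lin_sinc_sq (y + \<mu> - 1))
      - sinc_sq (y - \<mu> - 1) - (lin_sinc_sq (y - \<mu>) - lin_sinc_sq (y - \<mu> - 1))"
  using step_maj_unit_diff[of "y + \<mu>"] step_maj_unit_diff[of "\<mu> - y + 1"] sinc_sq_minus[of "\<mu> - y + 1"] lin_sinc_sq_minus[of "\<mu> - y + 1"]
     lin_sinc_sq_minus[of "\<mu> - y"]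
  by (simp add: interval_maj_def algebra_simps)

section \<open>Bandlimited functions and Fejer summation\<close>

definition unit_exp :: "real \<Rightarrow> complex" where "unit_exp t = cis (2 * pi * t)"

lemma unit_exp_add: "unit_exp (s + t) = unit_exp s * unit_exp t" by (simp add: unit_exp_def cis_mult algebra_simps)
lemma norm_unit_exp [simp]: "norm (unit_exp t) = 1" by (simp add: unit_exp_def)
lemma unit_exp_0 [simp]: "unit_exp 0 = 1" by (simp add: unit_exp_def)
lemma unit_exp_of_int [simp]: "unit_exp (of_int k) = 1"
  using cis_multiple_2pi[of "of_int k"] by (simp add: unit_exp_def)
lemma unit_exp_power: "unit_exp t ^ n = unit_exp (real n * t)" unfolding unit_exp_def Complex.DeMoivre by (simp add: mult_ac)
lemma cnj_unit_exp: "cnj (unit_exp t) = unit_exp (- t)" by (simp add: unit_exp_def cis_cnj)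
lemma continuous_on_unit_exp [continuous_intros]: "continuous_on A f \<Longrightarrow> continuous_on A (\<lambda>x. unit_exp (f x))"
  unfolding unit_exp_def by (intro continuous_intros)
lemma unit_exp_eq_1_iff: "unit_exp t = 1 \<longleftrightarrow> t \<in> \<int>"
proof
  assume "unit_exp t = 1"
  then have "cos (2 * pi * t) = 1" by (simp add: unit_exp_def complex_eq_iff)
  then obtain n :: int where "2 * pi * t = of_int n * 2 * pi" by (auto simp: cos_one_2pi_int)
  then have "t = of_int n" by simp
  then show "t \<in> \<int>" by simp
next
  assume "t \<in> \<int>"
  then show "unit_exp t = 1" by (auto elim!: Ints_cases)
qed

definition fejer_weight :: "nat \<Rightarrow> int \<Rightarrow> real" where
  "fejer_weight N k = max 0 (1 - \<bar>of_int k\<bar> / real N)"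

definition fejer :: "nat \<Rightarrow> real \<Rightarrow> complex" where
  "fejer N \<theta> = (\<Sum>k\<in>{- int N..int N}. fejer_weight N k * unit_exp (of_int k * \<theta>))"

text \<open>There are \<open>N - |k|\<close> pairs of indices below \<open>N\<close> with difference \<open>k\<close>.\<close>

lemma sum_differences:
  fixes g :: "int \<Rightarrow> 'a::comm_ring_1"
  shows "(\<Sum>i<N. \<Sum>j<N. g (int i - int j)) = (\<Sum>k\<in>{- int N..int N}. of_int (int N - \<bar>k\<bar>) * g k)"
proof (induction N)
  case (Suc N)
  have row: "(\<Sum>j<N. g (int N - int j)) = (\<Sum>k\<in>{1..int N}. g k)"
    by (rule sum.reindex_bij_witness[of _ "\<lambda>k. nat (int N - k)" "\<lambda>j. int N - int j"]) auto
  have col: "(\<Sum>j<N. g (int j - int N)) = (\<Sum>k\<in>{- int N..-1}. g k)"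
    by (rule sum.reindex_bij_witness[of _ "\<lambda>k. nat (int N + k)" "\<lambda>j. int j - int N"]) auto
  have split: "{- int N..int N} = {- int N..-1} \<union> ({0} \<union> {1..int N})" by auto
  have all: "(\<Sum>k\<in>{- int N..int N}. g k) = (\<Sum>k\<in>{- int N..-1}. g k) + (g 0 + (\<Sum>k\<in>{1..int N}. g k))"
    unfolding split by (subst sum.union_disjoint; (subst sum.union_disjoint)?) auto
  have ends: "(\<Sum>k\<in>{- int (Suc N)..int (Suc N)}. of_int (int (Suc N) - \<bar>k\<bar>) * g k)
      = (\<Sum>k\<in>{- int N..int N}. of_int (int (Suc N) - \<bar>k\<bar>) * g k)"
  proof (rule sum.mono_neutral_right)
    show "\<forall>k\<in>{- int (Suc N)..int (Suc N)} - {- int N..int N}. of_int (int (Suc N) - \<bar>k\<bar>) * g k = 0"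
    proof
      fix k assume "k \<in> {- int (Suc N)..int (Suc N)} - {- int N..int N}"
      then have "int (Suc N) - \<bar>k\<bar> = 0" by auto
      then show "of_int (int (Suc N) - \<bar>k\<bar>) * g k = 0" by (simp only: of_int_0 mult_zero_left)
    qed
  qed auto
  have "(\<Sum>i<Suc N. \<Sum>j<Suc N. g (int i - int j))
      = (\<Sum>i<N. \<Sum>j<N. g (int i - int j)) + (\<Sum>i<N. g (int i - int N)) + ((\<Sum>j<N. g (int N - int j)) + g 0)"
    by (simp add: sum.distrib)
  also have "\<dots> = (\<Sum>k\<in>{- int N..int N}. of_int (int N - \<bar>k\<bar>) * g k) + (\<Sum>k\<in>{- int N..int N}. g k)"
    unfolding Suc.IH row col all by simp
  also have "\<dots> = (\<Sum>k\<in>{- int N..int N}. of_int (int (Suc N) - \<bar>k\<bar>) * g k)"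
    by (simp add: sum.distrib[symmetric] algebra_simps)
  finally show ?case unfolding ends .
qed simp

text \<open>The closed form as a square shows that the kernel is nonnegative and, in \<open>norm_fejer_le\<close>, that it tends to zero
uniformly away from the integers.\<close>

lemma fejer_eq:
  assumes "N > 0"
  shows "fejer N \<theta> = of_real ((norm (\<Sum>j<N. unit_exp (real j * \<theta>)))\<^sup>2 / real N)"
proof -
  have "complex_of_real ((norm (\<Sum>j<N. unit_exp (real j * \<theta>)))\<^sup>2) = (\<Sum>i<N. \<Sum>j<N. unit_exp (of_int (int i - int j) * \<theta>))"
    unfolding complex_norm_square cnj_sum sum_product cnj_unit_exp unit_exp_add[symmetric]
    by (simp add: algebra_simps)
  also have "\<dots> = (\<Sum>k\<in>{- int N..int N}. of_int (int N - \<bar>k\<bar>) * unit_exp (of_int k * \<theta>))"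
    by (rule sum_differences)
  also have "\<dots> = of_nat N * fejer N \<theta>"
    unfolding fejer_def sum_distrib_left
  proof (rule sum.cong)
    fix k assume k: "k \<in> {- int N..int N}"
    then have "real N * fejer_weight N k = of_int (int N - \<bar>k\<bar>)"
      using assms by (simp add: fejer_weight_def max_def field_simps) linarith?
    then have "of_int (int N - \<bar>k\<bar>) = (of_nat N * of_real (fejer_weight N k) :: complex)"
      by (metis of_real_mult of_real_of_int_eq of_real_of_nat_eq)
    then show "of_int (int N - \<bar>k\<bar>) * unit_exp (of_int k * \<theta>) = of_nat N * (of_real (fejer_weight N k) * unit_exp (of_int k * \<theta>))"
      by (simp only: mult.assoc)
  qed auto
  finally show ?thesis using assms by (simp add: field_simps)
qed

lemma norm_fejer_le:
  assumes "N > 0" "\<kappa> > 0" "\<kappa> \<le> norm (unit_exp \<theta> - 1)"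
  shows "norm (fejer N \<theta>) \<le> 4 / \<kappa>\<^sup>2 / real N"
proof -
  have "(\<Sum>j<N. unit_exp (real j * \<theta>)) * (unit_exp \<theta> - 1) = unit_exp (real N * \<theta>) - 1"
    using power_diff_1_eq[of "unit_exp \<theta>" N] by (simp add: unit_exp_power mult.commute)
  then have "norm (\<Sum>j<N. unit_exp (real j * \<theta>)) * norm (unit_exp \<theta> - 1) = norm (unit_exp (real N * \<theta>) - 1)"
    by (metis norm_mult)
  also have "\<dots> \<le> 2" using norm_triangle_ineq4[of "unit_exp (real N * \<theta>)" 1] by simp
  finally have "norm (\<Sum>j<N. unit_exp (real j * \<theta>)) * \<kappa> \<le> 2"
    using mult_left_mono[OF assms(3), of "norm (\<Sum>j<N. unit_exp (real j * \<theta>))"] by simp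
  then have "norm (\<Sum>j<N. unit_exp (real j * \<theta>)) \<le> 2 / \<kappa>" using assms by (simp add: field_simps)
  then have "(norm (\<Sum>j<N. unit_exp (real j * \<theta>)))\<^sup>2 \<le> (2 / \<kappa>)\<^sup>2" by (intro power_mono) auto
  then have "(norm (\<Sum>j<N. unit_exp (real j * \<theta>)))\<^sup>2 / real N \<le> (2 / \<kappa>)\<^sup>2 / real N"
    by (intro divide_right_mono) auto
  then show ?thesis
    unfolding fejer_eq[OF assms(1)] norm_of_real by (simp add: power_divide)
qed

lemma cesaro_tendsto:
  fixes c :: "int \<Rightarrow> complex"
  assumes "(\<lambda>k. norm (c k)) summable_on UNIV"
  shows "(\<lambda>N. \<Sum>k\<in>{- int N..int N}. fejer_weight N k * c k) \<longlonglongrightarrow> infsum c UNIV"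
proof -
  have "(\<lambda>N. \<Sum>\<^sub>\<infinity>k. fejer_weight N k * c k) \<longlonglongrightarrow> infsum c UNIV"
  proof (rule tannery[OF assms])
    show "norm (fejer_weight N k * c k) \<le> norm (c k)" for N k
      by (simp add: norm_mult fejer_weight_def mult_left_le_one_le)
    have "(\<lambda>N. max 0 (1 - \<bar>of_int k\<bar> / real N)) \<longlonglongrightarrow> max 0 (1 - 0)" for k :: int
      by (intro tendsto_intros tendsto_divide_0[OF tendsto_const] filterlim_at_top_imp_at_infinity filterlim_real_sequentially)
    then have "(\<lambda>N. complex_of_real (fejer_weight N k) * c k) \<longlonglongrightarrow> of_real 1 * c k" for k
      unfolding fejer_weight_def by (intro tendsto_intros) simp
    then show "(\<lambda>N. complex_of_real (fejer_weight N k) * c k) \<longlonglongrightarrow> c k" for k by simp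
  qed
  moreover have "(\<Sum>\<^sub>\<infinity>k. fejer_weight N k * c k) = (\<Sum>k\<in>{- int N..int N}. fejer_weight N k * c k)" if "N > 0" for N
  proof -
    have "(\<Sum>\<^sub>\<infinity>k. fejer_weight N k * c k) = (\<Sum>\<^sub>\<infinity>k\<in>{- int N..int N}. fejer_weight N k * c k)"
    proof (rule infsum_cong_neutral)
      fix k assume "k \<in> UNIV - {- int N..int N}"
      then have "real N < \<bar>of_int k\<bar>" by (auto simp: abs_if)
      then show "fejer_weight N k * c k = 0" using that by (simp add: fejer_weight_def max_def field_simps)
    qed auto
    then show ?thesis by simp
  qed
  ultimately show ?thesis
    by (elim Lim_transform_eventually) (auto intro: eventually_sequentiallyI[of 1])
qed

text \<open>The Fourier transform is supported in \<open>[-1, 1]\<close>; \<open>\<phi>\<close> and \<open>\<psi>\<close> are the densities on the positive and on the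
(reflected) negative half. Keeping the halves apart admits the transform of \<open>y sinc\<^sup>2(y)\<close>, which jumps at \<open>0\<close>.\<close>

definition bandlimited :: "(real \<Rightarrow> complex) \<Rightarrow> bool" where
  "bandlimited f \<longleftrightarrow> (\<exists>\<phi> \<psi>. continuous_on {0..1} \<phi> \<and> continuous_on {0..1} \<psi> \<and>
     (\<forall>y. ((\<lambda>t. \<phi> t * unit_exp (y * t) + \<psi> t * unit_exp (- (y * t))) has_integral f y) {0..1}))"

lemma bandlimitedI:
  assumes "continuous_on {0..1} \<phi>" "continuous_on {0..1} \<psi>"
    "\<And>y. ((\<lambda>t. \<phi> t * unit_exp (y * t) + \<psi> t * unit_exp (- (y * t))) has_integral f y) {0..1}"
  shows "bandlimited f"
  using assms unfolding bandlimited_def by blast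

lemma bandlimited_add:
  assumes "bandlimited f" "bandlimited g"
  shows "bandlimited (\<lambda>y. f y + g y)"
proof -
  from assms obtain \<phi> \<psi> \<phi>' \<psi>' where c: "continuous_on {0..1} \<phi>" "continuous_on {0..1} \<psi>"
      "continuous_on {0..1} \<phi>'" "continuous_on {0..1} \<psi>'"
    and i: "\<And>y. ((\<lambda>t. \<phi> t * unit_exp (y * t) + \<psi> t * unit_exp (- (y * t))) has_integral f y) {0..1}"
      "\<And>y. ((\<lambda>t. \<phi>' t * unit_exp (y * t) + \<psi>' t * unit_exp (- (y * t))) has_integral g y) {0..1}"
    unfolding bandlimited_def by blast
  show ?thesis
  proof (rule bandlimitedI)
    show "((\<lambda>t. (\<phi> t + \<phi>' t) * unit_exp (y * t) + (\<psi> t + \<psi>' t) * unit_exp (- (y * t))) has_integral f y + g y) {0..1}" for y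
      using has_integral_add[OF i(1)[of y] i(2)[of y]] by (simp add: algebra_simps)
  qed (use c in \<open>auto intro: continuous_intros\<close>)
qed

lemma bandlimited_uminus:
  assumes "bandlimited f"
  shows "bandlimited (\<lambda>y. - f y)"
proof -
  from assms obtain \<phi> \<psi> where c: "continuous_on {0..1} \<phi>" "continuous_on {0..1} \<psi>"
    and i: "\<And>y. ((\<lambda>t. \<phi> t * unit_exp (y * t) + \<psi> t * unit_exp (- (y * t))) has_integral f y) {0..1}"
    unfolding bandlimited_def by blast
  show ?thesis
  proof (rule bandlimitedI)
    show "((\<lambda>t. (- \<phi> t) * unit_exp (y * t) + (- \<psi> t) * unit_exp (- (y * t))) has_integral - f y) {0..1}" for y
      using has_integral_neg[OF i[of y]] by simp
  qed (use c in \<open>auto intro: continuous_intros\<close>)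
qed

lemma bandlimited_diff:
  assumes "bandlimited f" "bandlimited g"
  shows "bandlimited (\<lambda>y. f y - g y)"
  using bandlimited_add[OF assms(1) bandlimited_uminus[OF assms(2)]] by simp

lemma bandlimited_shift:
  assumes "bandlimited f"
  shows "bandlimited (\<lambda>y. f (y + s))"
proof -
  from assms obtain \<phi> \<psi> where c: "continuous_on {0..1} \<phi>" "continuous_on {0..1} \<psi>"
    and i: "\<And>y. ((\<lambda>t. \<phi> t * unit_exp (y * t) + \<psi> t * unit_exp (- (y * t))) has_integral f y) {0..1}"
    unfolding bandlimited_def by blast
  show ?thesis
  proof (rule bandlimitedI)
    show "((\<lambda>t. (\<phi> t * unit_exp (s * t)) * unit_exp (y * t) + (\<psi> t * unit_exp (- (s * t))) * unit_exp (- (y * t))) has_integral f (y + s)) {0..1}" for y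
    proof -
      have "(\<phi> t * unit_exp (s * t)) * unit_exp (y * t) = \<phi> t * unit_exp ((y + s) * t)"
        "(\<psi> t * unit_exp (- (s * t))) * unit_exp (- (y * t)) = \<psi> t * unit_exp (- ((y + s) * t))" for t
        by (simp_all add: unit_exp_add[symmetric] algebra_simps)
      then show ?thesis using i[of "y + s"] by (simp only:)
    qed
  qed (use c in \<open>auto intro!: continuous_intros\<close>)
qed

lemma sinc_sq_has_integral: "((\<lambda>t. 2 * (1 - t) * cos (2 * pi * y * t)) has_integral sinc_sq y) {0..1}"
proof (cases "y = 0")
  case True
  have "((\<lambda>t::real. 2 * (1 - t)) has_integral (2 * 1 - 1\<^sup>2) - (2 * 0 - 0\<^sup>2)) {0..1}"
    by (rule fundamental_theorem_of_calculus)
       (auto simp flip: has_real_derivative_iff_has_vector_derivative intro!: derivative_eq_intros)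
  then show ?thesis using True by simp
next
  case False
  define F where "F t = 2 * (1 - t) * sin (2 * pi * y * t) / (2 * pi * y) - 2 * cos (2 * pi * y * t) / (2 * pi * y)\<^sup>2" for t
  have "((\<lambda>t. 2 * (1 - t) * cos (2 * pi * y * t)) has_integral F 1 - F 0) {0..1}"
  proof (rule fundamental_theorem_of_calculus)
    fix t :: real
    have "(F has_real_derivative 2 * (1 - t) * cos (2 * pi * y * t)) (at t within {0..1})"
      unfolding F_def using False
      by (auto intro!: derivative_eq_intros simp: field_simps power2_eq_square)
    then show "(F has_vector_derivative 2 * (1 - t) * cos (2 * pi * y * t)) (at t within {0..1})"
      by (simp add: has_real_derivative_iff_has_vector_derivative)
  qed auto
  moreover have "F 1 - F 0 = sinc_sq y"
  proof -
    have "F 1 - F 0 = 2 * (1 - cos (2 * pi * y)) / (2 * pi * y)\<^sup>2"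
      using False by (simp add: F_def diff_divide_distrib)
    also have "1 - cos (2 * pi * y) = 2 * (sin (pi * y))\<^sup>2"
      using cos_double_sin[of "pi * y"] by (simp add: mult.assoc)
    finally show ?thesis using False by (simp add: sinc_sq_def power_divide power_mult_distrib power2_eq_square)
  qed
  ultimately show ?thesis by simp
qed

lemma lin_sinc_sq_has_integral: "((\<lambda>t. sin (2 * pi * y * t) / pi) has_integral lin_sinc_sq y) {0..1}"
proof (cases "y = 0")
  case False
  define F where "F t = - cos (2 * pi * y * t) / (2 * pi * y) / pi" for t
  have "((\<lambda>t. sin (2 * pi * y * t) / pi) has_integral F 1 - F 0) {0..1}"
  proof (rule fundamental_theorem_of_calculus)
    fix t :: real
    have "(F has_real_derivative sin (2 * pi * y * t) / pi) (at t within {0..1})"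
      unfolding F_def using False
      by (auto intro!: derivative_eq_intros simp: field_simps)
    then show "(F has_vector_derivative sin (2 * pi * y * t) / pi) (at t within {0..1})"
      by (simp add: has_real_derivative_iff_has_vector_derivative)
  qed auto
  moreover have "F 1 - F 0 = lin_sinc_sq y"
  proof -
    have "F 1 - F 0 = (1 - cos (2 * pi * y)) / (2 * pi * y) / pi"
      using False by (simp add: F_def diff_divide_distrib)
    also have "1 - cos (2 * pi * y) = 2 * (sin (pi * y))\<^sup>2"
      using cos_double_sin[of "pi * y"] by (simp add: mult.assoc)
    finally show ?thesis using False by (simp add: lin_sinc_sq_def power_divide power_mult_distrib power2_eq_square)
  qed
  ultimately show ?thesis by simp
qed (simp add: lin_sinc_sq_def)

lemma bandlimited_sinc_sq: "bandlimited (\<lambda>y. of_real (sinc_sq y))"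
proof (rule bandlimitedI)
  show "((\<lambda>t. of_real (1 - t) * unit_exp (y * t) + of_real (1 - t) * unit_exp (- (y * t))) has_integral of_real (sinc_sq y)) {0..1}" for y
  proof -
    have "of_real (1 - t) * unit_exp (y * t) + of_real (1 - t) * unit_exp (- (y * t)) = complex_of_real (2 * (1 - t) * cos (2 * pi * y * t))" for t
      by (simp add: unit_exp_def complex_eq_iff algebra_simps)
    then show ?thesis using has_integral_of_real[OF sinc_sq_has_integral[of y], where ?'b = complex] by simp
  qed
qed (auto intro!: continuous_intros)

lemma bandlimited_lin_sinc_sq: "bandlimited (\<lambda>y. of_real (lin_sinc_sq y))"
proof (rule bandlimitedI)
  show "((\<lambda>t. (- \<i> / (2 * pi)) * unit_exp (y * t) + (\<i> / (2 * pi)) * unit_exp (- (y * t))) has_integral of_real (lin_sinc_sq y)) {0..1}" for y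
  proof -
    have "(- \<i> / (2 * pi)) * unit_exp (y * t) + (\<i> / (2 * pi)) * unit_exp (- (y * t)) = complex_of_real (sin (2 * pi * y * t) / pi)" for t
      by (simp add: unit_exp_def complex_eq_iff field_simps)
    then show ?thesis using has_integral_of_real[OF lin_sinc_sq_has_integral[of y], where ?'b = complex] by simp
  qed
qed (auto intro!: continuous_intros)

text \<open>A half of Poisson summation. The Cesaro means of the series are integrals of the densities of \<open>f\<close> against
Fejer kernels centred at \<open>-\<xi>\<close>. By hypothesis the support \<open>[-1/L, 1/L]\<close> stays away from the points where
these kernels concentrate, so the means tend to zero; on the other hand they tend to the sum of the series.\<close>

lemma bandlimited_samples_vanish:
  assumes bl: "bandlimited f" and L: "L > 0"
    and sum: "(\<lambda>k::int. norm (f (of_int k / L))) summable_on UNIV"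
    and \<xi>: "\<And>j::int. 1 / L < \<bar>\<xi> + of_int j\<bar>"
  shows "(\<Sum>\<^sub>\<infinity>k::int. f (of_int k / L) * unit_exp (of_int k * \<xi>)) = 0"
proof -
  from bl obtain \<phi> \<psi> where c: "continuous_on {0..1} \<phi>" "continuous_on {0..1} \<psi>"
    and i: "\<And>y. ((\<lambda>t. \<phi> t * unit_exp (y * t) + \<psi> t * unit_exp (- (y * t))) has_integral f y) {0..1}"
    unfolding bandlimited_def by blast
  let ?c = "\<lambda>N. \<Sum>k\<in>{- int N..int N}. fejer_weight N k * (f (of_int k / L) * unit_exp (of_int k * \<xi>))"
  have nonint: "\<xi> + s * t / L \<notin> \<int>" if t: "t \<in> {0..1}" and s: "s \<in> {-1, 1}" for s t :: real
  proof
    assume "\<xi> + s * t / L \<in> \<int>"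
    then obtain j where j: "\<xi> + s * t / L = of_int j" by (auto elim: Ints_cases)
    then have "\<xi> + of_int (- j) = - (s * t / L)" by simp
    then have "\<bar>\<xi> + of_int (- j)\<bar> = t / L" using t s L by auto
    moreover have "t / L \<le> 1 / L" using t L by (simp add: divide_right_mono)
    ultimately show False using \<xi>[of "- j"] by simp
  qed
  have lower: "\<exists>\<kappa>>0. \<forall>t\<in>{0..1}. \<kappa> \<le> norm (unit_exp (\<xi> + s * t / L) - 1)" if s: "s \<in> {-1, 1}" for s :: real
  proof -
    have "continuous_on {0..1} (\<lambda>t. norm (unit_exp (\<xi> + s * t / L) - 1))"
      using L by (intro continuous_intros) auto
    then obtain t where t: "t \<in> {0..1}" "\<And>t'. t' \<in> {0..1} \<Longrightarrow> norm (unit_exp (\<xi> + s * t / L) - 1) \<le> norm (unit_exp (\<xi> + s * t' / L) - 1)"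
      using continuous_attains_inf[of "{0..1::real}" "\<lambda>t. norm (unit_exp (\<xi> + s * t / L) - 1)"] by auto
    then show ?thesis using nonint[OF t(1) s]
      by (intro exI[of _ "norm (unit_exp (\<xi> + s * t / L) - 1)"]) (auto simp: unit_exp_eq_1_iff)
  qed
  from lower[of 1] lower[of "-1"] obtain \<kappa>1 \<kappa>2 where \<kappa>12: "\<kappa>1 > 0" "\<And>t. t \<in> {0..1} \<Longrightarrow> \<kappa>1 \<le> norm (unit_exp (\<xi> + t / L) - 1)"
      "\<kappa>2 > 0" "\<And>t. t \<in> {0..1} \<Longrightarrow> \<kappa>2 \<le> norm (unit_exp (\<xi> - t / L) - 1)"
    by auto
  define \<kappa> where "\<kappa> = min \<kappa>1 \<kappa>2"
  have \<kappa>: "\<kappa> > 0" "\<And>t. t \<in> {0..1} \<Longrightarrow> \<kappa> \<le> norm (unit_exp (\<xi> + t / L) - 1)" "\<And>t. t \<in> {0..1} \<Longrightarrow> \<kappa> \<le> norm (unit_exp (\<xi> - t / L) - 1)"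
    using \<kappa>12 by (fastforce simp: \<kappa>_def)+
  have "bounded (\<phi> ` {0..1})" "bounded (\<psi> ` {0..1})"
    using c by (auto intro!: compact_imp_bounded compact_continuous_image)
  then obtain B1 B2 where B12: "\<And>t. t \<in> {0..1} \<Longrightarrow> norm (\<phi> t) \<le> B1" "\<And>t. t \<in> {0..1} \<Longrightarrow> norm (\<psi> t) \<le> B2"
    unfolding bounded_iff by (metis imageI)
  have B0: "0 \<le> B1" "0 \<le> B2" using B12[of 0] norm_ge_zero order_trans by (meson atLeastAtMost_iff order_refl zero_le_one)+
  have bound: "norm (?c N) \<le> (B1 + B2) * (4 / \<kappa>\<^sup>2 / real N)" if N: "N > 0" for N
  proof -
    have "((\<lambda>t. \<phi> t * fejer N (\<xi> + t / L) + \<psi> t * fejer N (\<xi> - t / L)) has_integral ?c N) {0..1}"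
    proof -
      have "((\<lambda>t. \<Sum>k\<in>{- int N..int N}. (fejer_weight N k * unit_exp (of_int k * \<xi>)) *
          (\<phi> t * unit_exp (of_int k / L * t) + \<psi> t * unit_exp (- (of_int k / L * t)))) has_integral
          (\<Sum>k\<in>{- int N..int N}. (fejer_weight N k * unit_exp (of_int k * \<xi>)) * f (of_int k / L))) {0..1}"
        by (intro has_integral_sum has_integral_mult_right i) auto
      moreover have "(\<Sum>k\<in>{- int N..int N}. (fejer_weight N k * unit_exp (of_int k * \<xi>)) *
          (\<phi> t * unit_exp (of_int k / L * t) + \<psi> t * unit_exp (- (of_int k / L * t))))
          = \<phi> t * fejer N (\<xi> + t / L) + \<psi> t * fejer N (\<xi> - t / L)" for t
      proof -
        have "unit_exp (of_int k * (\<xi> + t / L)) = unit_exp (of_int k * \<xi>) * unit_exp (of_int k / L * t)"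
          "unit_exp (of_int k * (\<xi> - t / L)) = unit_exp (of_int k * \<xi>) * unit_exp (- (of_int k / L * t))" for k
          by (simp_all add: unit_exp_add[symmetric] algebra_simps)
        then show ?thesis
          unfolding fejer_def sum_distrib_left sum.distrib[symmetric]
          by (intro sum.cong) (auto simp: algebra_simps)
      qed
      ultimately show ?thesis by (simp add: mult_ac)
    qed
    note int = this
    have "norm (?c N) \<le> ((B1 + B2) * (4 / \<kappa>\<^sup>2 / real N)) * measure lborel {0..1::real}"
    proof (rule has_integral_bound_real[OF _ finite.emptyI int])
      fix t :: real assume t: "t \<in> {0..1} - {}"
      have "norm (\<phi> t * fejer N (\<xi> + t / L) + \<psi> t * fejer N (\<xi> - t / L))
          \<le> norm (\<phi> t) * norm (fejer N (\<xi> + t / L)) + norm (\<psi> t) * norm (fejer N (\<xi> - t / L))"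
        by (metis norm_mult norm_triangle_ineq)
      also have "\<dots> \<le> B1 * (4 / \<kappa>\<^sup>2 / real N) + B2 * (4 / \<kappa>\<^sup>2 / real N)"
        using B12 B0 t \<kappa> N by (intro add_mono mult_mono norm_fejer_le) auto
      finally show "norm (\<phi> t * fejer N (\<xi> + t / L) + \<psi> t * fejer N (\<xi> - t / L)) \<le> (B1 + B2) * (4 / \<kappa>\<^sup>2 / real N)"
        by (simp only: distrib_right)
    qed (use B0 in auto)
    then show ?thesis by simp
  qed
  have "(\<lambda>N. (B1 + B2) * (4 / \<kappa>\<^sup>2 / real N)) \<longlonglongrightarrow> (B1 + B2) * 0"
    by (intro tendsto_intros tendsto_divide_0[OF tendsto_const] filterlim_at_top_imp_at_infinity filterlim_real_sequentially)
  then have "?c \<longlonglongrightarrow> 0"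
    by (intro Lim_null_comparison[of ?c "\<lambda>N. (B1 + B2) * (4 / \<kappa>\<^sup>2 / real N)"])
       (intro eventually_sequentiallyI[of 1] bound, simp, simp only: mult_zero_right)
  moreover have "?c \<longlonglongrightarrow> (\<Sum>\<^sub>\<infinity>k::int. f (of_int k / L) * unit_exp (of_int k * \<xi>))"
    by (rule cesaro_tendsto) (use sum in \<open>simp add: norm_mult\<close>)
  ultimately show ?thesis using LIMSEQ_unique by blast
qed

text \<open>The Cesaro means are integrals of the triangle \<open>1 - |t|\<close>, which is at most \<open>1\<close>, against a nonnegative
Fejer kernel of period \<open>L\<close> and mean \<open>1\<close>; for \<open>L \<ge> 2\<close> the interval \<open>[-1, 1]\<close> lies in a single period.\<close>

lemma sinc_sq_total_le:
  assumes "L \<ge> 2"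
  shows "(\<Sum>\<^sub>\<infinity>k::int. sinc_sq (of_int k / L)) \<le> L"
proof -
  have L: "L > 0" using assms by simp
  define FR where "FR N \<theta> = (\<Sum>k\<in>{- int N..int N}. fejer_weight N k * cos (2 * pi * of_int k * \<theta>))" for N \<theta>
  have FR: "FR N \<theta> = Re (fejer N \<theta>)" for N \<theta>
    by (simp add: FR_def fejer_def unit_exp_def mult.assoc)
  have FR0: "0 \<le> FR N \<theta>" if "N > 0" for N \<theta>
    unfolding FR fejer_eq[OF that] by (simp del: of_real_divide)
  have cosint: "((\<lambda>t. 2 * cos (2 * pi * of_int k * (t / L))) has_integral (if k = 0 then L else 0)) {0..L / 2}" for k :: int
  proof (cases "k = 0")
    case True
    then show ?thesis using has_integral_const_real[of "2::real" 0 "L / 2"] L by simp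
  next
    case False
    define F where "F t = 2 * (sin (2 * pi * of_int k * (t / L)) * L / (2 * pi * of_int k))" for t
    have "((\<lambda>t. 2 * cos (2 * pi * of_int k * (t / L))) has_integral F (L / 2) - F 0) {0..L / 2}"
    proof (rule fundamental_theorem_of_calculus)
      fix t :: real
      have "(F has_real_derivative 2 * cos (2 * pi * of_int k * (t / L))) (at t within {0..L / 2})"
        unfolding F_def using False L
        by (auto intro!: derivative_eq_intros simp: field_simps)
      then show "(F has_vector_derivative 2 * cos (2 * pi * of_int k * (t / L))) (at t within {0..L / 2})"
        by (simp add: has_real_derivative_iff_has_vector_derivative)
    qed (use L in auto)
    moreover have "F (L / 2) - F 0 = 0"
      using sin_npi_int[of k] L by (simp add: F_def)
    ultimately show ?thesis using False by simp
  qed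
  have le: "(\<Sum>k\<in>{- int N..int N}. fejer_weight N k * sinc_sq (of_int k / L)) \<le> L" if N: "N > 0" for N
  proof -
    have 1: "((\<lambda>t. 2 * (1 - t) * FR N (t / L)) has_integral (\<Sum>k\<in>{- int N..int N}. fejer_weight N k * sinc_sq (of_int k / L))) {0..1}"
    proof -
      have "((\<lambda>t. \<Sum>k\<in>{- int N..int N}. fejer_weight N k * (2 * (1 - t) * cos (2 * pi * (of_int k / L) * t)))
          has_integral (\<Sum>k\<in>{- int N..int N}. fejer_weight N k * sinc_sq (of_int k / L))) {0..1}"
        by (intro has_integral_sum has_integral_mult_right sinc_sq_has_integral) auto
      moreover have "(\<Sum>k\<in>{- int N..int N}. fejer_weight N k * (2 * (1 - t) * cos (2 * pi * (of_int k / L) * t))) = 2 * (1 - t) * FR N (t / L)" for t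
        by (simp add: FR_def sum_distrib_left algebra_simps)
      ultimately show ?thesis by simp
    qed
    have 2: "((\<lambda>t. 2 * FR N (t / L)) has_integral L) {0..L / 2}"
    proof -
      have "((\<lambda>t. \<Sum>k\<in>{- int N..int N}. fejer_weight N k * (2 * cos (2 * pi * of_int k * (t / L))))
          has_integral (\<Sum>k\<in>{- int N..int N}. fejer_weight N k * (if k = 0 then L else 0))) {0..L / 2}"
        by (intro has_integral_sum has_integral_mult_right cosint) auto
      moreover have "(\<Sum>k\<in>{- int N..int N}. fejer_weight N k * (if k = 0 then L else 0)) = L"
        by (simp add: if_distrib[of "\<lambda>x. _ * x"] fejer_weight_def cong: if_cong)
      moreover have "(\<Sum>k\<in>{- int N..int N}. fejer_weight N k * (2 * cos (2 * pi * of_int k * (t / L)))) = 2 * FR N (t / L)" for t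
        by (simp add: FR_def sum_distrib_left algebra_simps)
      ultimately show ?thesis by simp
    qed
    have c: "continuous_on A (\<lambda>t. 2 * FR N (t / L))" for A
      unfolding FR_def using L by (intro continuous_intros) auto
    have "(\<Sum>k\<in>{- int N..int N}. fejer_weight N k * sinc_sq (of_int k / L)) \<le> integral {0..1} (\<lambda>t. 2 * FR N (t / L))"
    proof (rule has_integral_le[OF 1 integrable_integral])
      show "(\<lambda>t. 2 * FR N (t / L)) integrable_on {0..1}" by (intro integrable_continuous_interval c)
      show "2 * (1 - t) * FR N (t / L) \<le> 2 * FR N (t / L)" if "t \<in> {0..1}" for t
        using that FR0[OF N, of "t / L"] by (intro mult_right_mono) auto
    qed
    also have "\<dots> \<le> integral {0..L / 2} (\<lambda>t. 2 * FR N (t / L))"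
      using assms FR0[OF N] by (intro integral_subset_le integrable_continuous_interval c) auto
    also have "\<dots> = L" using 2 by (rule integral_unique)
    finally show ?thesis .
  qed
  have sum_S: "(\<lambda>k::int. sinc_sq (of_int k / L)) summable_on UNIV" using sinc_sq_summable[OF L, of 0 UNIV] by simp
  have "(\<lambda>N. \<Sum>k\<in>{- int N..int N}. fejer_weight N k * complex_of_real (sinc_sq (of_int k / L))) \<longlonglongrightarrow> (\<Sum>\<^sub>\<infinity>k::int. complex_of_real (sinc_sq (of_int k / L)))"
    by (rule cesaro_tendsto) (use sum_S sinc_sq_nonneg in simp)
  moreover have "(\<Sum>\<^sub>\<infinity>k::int. complex_of_real (sinc_sq (of_int k / L))) = complex_of_real (\<Sum>\<^sub>\<infinity>k::int. sinc_sq (of_int k / L))"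
    by (rule infsumI, rule has_sum_of_real, rule has_sum_infsum[OF sum_S])
  ultimately have "(\<lambda>N. complex_of_real (\<Sum>k\<in>{- int N..int N}. fejer_weight N k * sinc_sq (of_int k / L))) \<longlonglongrightarrow> complex_of_real (\<Sum>\<^sub>\<infinity>k::int. sinc_sq (of_int k / L))"
    by simp
  then have "(\<lambda>N. \<Sum>k\<in>{- int N..int N}. fejer_weight N k * sinc_sq (of_int k / L)) \<longlonglongrightarrow> (\<Sum>\<^sub>\<infinity>k::int. sinc_sq (of_int k / L))"
    by (simp only: tendsto_of_real_iff)
  then show ?thesis
    by (rule tendsto_upperbound) (auto intro!: eventually_sequentiallyI[of 1] le)
qed

section \<open>Band-limited weights on the integers\<close>

lemma infsum_minus:
  fixes f g :: "'i \<Rightarrow> 'b::real_normed_vector"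
  assumes "f summable_on A" "g summable_on A"
  shows "(\<Sum>\<^sub>\<infinity>k\<in>A. f k - g k) = infsum f A - infsum g A"
  using infsum_add[OF assms(1) summable_on_uminus[THEN iffD2, OF assms(2)]] by (simp add: infsum_uminus)

definition fourier :: "(int \<Rightarrow> real) \<Rightarrow> real \<Rightarrow> complex" where
  "fourier w \<xi> = (\<Sum>\<^sub>\<infinity>k. of_real (w k) * unit_exp (of_int k * \<xi>))"

text \<open>This is what makes the off-diagonal terms of the quadratic forms below vanish; \<open>\<xi> + j\<close> runs through the
representatives of \<open>\<xi>\<close> modulo 1.\<close>

definition band_weight :: "real \<Rightarrow> (int \<Rightarrow> real) \<Rightarrow> bool" where
  "band_weight \<delta> w \<longleftrightarrow> w summable_on UNIV \<and>
     (\<forall>\<xi>. (\<forall>j::int. \<delta> \<le> \<bar>\<xi> + of_int j\<bar>) \<longrightarrow> fourier w \<xi> = 0)"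

lemma summable_fourier:
  assumes "w summable_on UNIV"
  shows "(\<lambda>k. of_real (w k) * unit_exp (of_int k * \<xi>)) summable_on UNIV"
proof (rule abs_summable_summable)
  show "(\<lambda>k. norm (of_real (w k) * unit_exp (of_int k * \<xi>))) summable_on UNIV"
    using summable_on_iff_abs_summable_on_real[of w UNIV] assms by (simp add: norm_mult)
qed

lemma band_weight_lincomb:
  assumes "band_weight \<delta> v" "band_weight \<delta> w"
  shows "band_weight \<delta> (\<lambda>k. v k + c * w k)"
proof -
  have s: "v summable_on UNIV" "w summable_on UNIV" using assms by (auto simp: band_weight_def)
  have "(\<Sum>\<^sub>\<infinity>k. of_real (v k + c * w k) * unit_exp (of_int k * \<xi>))
      = (\<Sum>\<^sub>\<infinity>k. of_real (v k) * unit_exp (of_int k * \<xi>)) + of_real c * (\<Sum>\<^sub>\<infinity>k. of_real (w k) * unit_exp (of_int k * \<xi>))" for \<xi>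
  proof -
    have "(\<Sum>\<^sub>\<infinity>k. of_real (v k) * unit_exp (of_int k * \<xi>) + of_real c * (of_real (w k) * unit_exp (of_int k * \<xi>)))
      = (\<Sum>\<^sub>\<infinity>k. of_real (v k) * unit_exp (of_int k * \<xi>)) + (\<Sum>\<^sub>\<infinity>k. of_real c * (of_real (w k) * unit_exp (of_int k * \<xi>)))"
      by (intro infsum_add summable_on_cmult_right summable_fourier s)
    also have "(\<Sum>\<^sub>\<infinity>k. of_real c * (of_real (w k) * unit_exp (of_int k * \<xi>))) = of_real c * (\<Sum>\<^sub>\<infinity>k. of_real (w k) * unit_exp (of_int k * \<xi>))"
      by (intro infsum_cmult_right summable_fourier s)
    finally show ?thesis by (simp add: algebra_simps)
  qed
  moreover have "(\<lambda>k. v k + c * w k) summable_on UNIV"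
    by (intro summable_on_add summable_on_cmult_right s)
  ultimately show ?thesis using assms unfolding band_weight_def fourier_def by simp
qed

lemma band_weight_sinc_sq:
  assumes "L > 0" "\<delta> > 1 / L"
  shows "band_weight \<delta> (\<lambda>k. sinc_sq (of_int k / L + s))"
proof -
  have sum: "(\<lambda>k::int. sinc_sq (of_int k / L + s)) summable_on UNIV"
    using sinc_sq_summable[OF assms(1), of "- s" UNIV] by simp
  have "(\<Sum>\<^sub>\<infinity>k::int. of_real (sinc_sq (of_int k / L + s)) * unit_exp (of_int k * \<xi>)) = 0" if "\<forall>j::int. \<delta> \<le> \<bar>\<xi> + of_int j\<bar>" for \<xi>
  proof (rule bandlimited_samples_vanish[OF bandlimited_shift[OF bandlimited_sinc_sq, of s] assms(1)])
    show "(\<lambda>k::int. norm (complex_of_real (sinc_sq (of_int k / L + s)))) summable_on UNIV"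
      using sum sinc_sq_nonneg by simp
    show "1 / L < \<bar>\<xi> + of_int j\<bar>" for j :: int
      using assms(2) that[rule_format, of j] by linarith
  qed
  then show ?thesis using sum by (simp add: band_weight_def fourier_def)
qed

text \<open>Although defined through infinite sums, the majorant exceeds the indicator of the interval by no more than
the two values of \<open>sinc\<^sup>2\<close> at the endpoints, so it decays quadratically.\<close>

lemma interval_maj_summable:
  assumes "L > 0" "\<mu> \<ge> 0"
  shows "(\<lambda>k::int. interval_maj \<mu> (of_int k / L + s)) summable_on UNIV"
proof (rule summable_on_comparison_test)
  show "(\<lambda>k::int. (if \<bar>of_int k / L + s\<bar> \<le> \<mu> then 1 else 0) +
      (sinc_sq (of_int k / L + s + \<mu>) + sinc_sq (of_int k / L + s - \<mu>))) summable_on UNIV"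
  proof (intro summable_on_add)
    have "finite {k::int. \<bar>of_int k / L + s\<bar> \<le> \<mu>}"
    proof (rule finite_subset)
      show "{k::int. \<bar>of_int k / L + s\<bar> \<le> \<mu>} \<subseteq> {\<lfloor>L * (- \<mu> - s)\<rfloor>..\<lceil>L * (\<mu> - s)\<rceil>}"
      proof
        fix k :: int assume "k \<in> {k. \<bar>of_int k / L + s\<bar> \<le> \<mu>}"
        then have "of_int k / L \<le> \<mu> - s" "- \<mu> - s \<le> of_int k / L" by (auto simp: abs_le_iff)
        then have "of_int k \<le> L * (\<mu> - s)" "L * (- \<mu> - s) \<le> of_int k"
          using assms(1) by (auto simp: field_simps)
        then show "k \<in> {\<lfloor>L * (- \<mu> - s)\<rfloor>..\<lceil>L * (\<mu> - s)\<rceil>}" by (simp add: le_ceiling_iff floor_le_iff)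
      qed
    qed simp
    then show "(\<lambda>k::int. if \<bar>of_int k / L + s\<bar> \<le> \<mu> then 1 else 0 :: real) summable_on UNIV"
      by (subst summable_on_cong_neutral[where T = "{k::int. \<bar>of_int k / L + s\<bar> \<le> \<mu>}"]) auto
    show "(\<lambda>k::int. sinc_sq (of_int k / L + s + \<mu>)) summable_on UNIV"
      using sinc_sq_summable[OF assms(1), of "- s - \<mu>" UNIV] by (simp add: algebra_simps)
    show "(\<lambda>k::int. sinc_sq (of_int k / L + s - \<mu>)) summable_on UNIV"
      using sinc_sq_summable[OF assms(1), of "- s + \<mu>" UNIV] by (simp add: algebra_simps)
  qed
qed (use interval_maj_le[OF assms(2)] interval_maj_nonneg[OF assms(2)] in auto)

lemma bandlimited_interval_maj_unit_diff: "bandlimited (\<lambda>y. of_real (interval_maj \<mu> y - interval_maj \<mu> (y - 1)))"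
proof -
  note shifts = bandlimited_shift[OF bandlimited_sinc_sq] bandlimited_shift[OF bandlimited_lin_sinc_sq]
  have "bandlimited (\<lambda>y. of_real (sinc_sq (y + \<mu>)) + (of_real (lin_sinc_sq (y + \<mu>)) - of_real (lin_sinc_sq (y + (\<mu> - 1))))
      - of_real (sinc_sq (y + (- \<mu> - 1))) - (of_real (lin_sinc_sq (y + (- \<mu>))) - of_real (lin_sinc_sq (y + (- \<mu> - 1)))))"
    by (intro bandlimited_diff bandlimited_add shifts)
  then show ?thesis unfolding interval_maj_unit_diff by (simp add: algebra_simps)
qed

lemma bandlimited_interval_maj_diff: "bandlimited (\<lambda>y. of_real (interval_maj \<mu> y - interval_maj \<mu> (y - real q)))"
proof (induction q)
  case 0
  have "bandlimited (\<lambda>y. of_real (sinc_sq y) - of_real (sinc_sq y))" by (intro bandlimited_diff bandlimited_sinc_sq)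
  then show ?case by simp
next
  case (Suc q)
  have "bandlimited (\<lambda>y. of_real (interval_maj \<mu> (y + (- real q)) - interval_maj \<mu> (y + (- real q) - 1)))"
    by (rule bandlimited_shift[OF bandlimited_interval_maj_unit_diff])
  from bandlimited_add[OF Suc.IH this] show ?case by (simp add: algebra_simps)
qed

text \<open>Translation by the integer \<open>q\<close> is a shift of the samples by \<open>p = qL\<close> places. The samples of
\<open>M(y) - M(y - q)\<close> have vanishing Fourier series at \<open>\<xi>\<close>, and this series is \<open>1 - e(p\<xi>)\<close> times that of
the samples of \<open>M\<close>. If \<open>p\<xi>\<close> is an integer, \<open>\<xi>\<close> is approached by points where the first factor is nonzero.
This is where the rationality of \<open>L\<close> enters; the margin between \<open>\<delta>\<close> and \<open>1/L\<close> leaves room for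
the approximation.\<close>

lemma band_weight_interval_maj:
  assumes p: "p > 0" and q: "q > 0" and L: "L = real p / real q" and \<delta>: "\<delta> > 1 / L" and \<mu>: "\<mu> \<ge> 0"
  shows "band_weight \<delta> (\<lambda>k. interval_maj \<mu> (of_int k / L))"
proof -
  have L0: "L > 0" using p q L by simp
  have sum: "(\<lambda>k::int. interval_maj \<mu> (of_int k / L)) summable_on UNIV"
    using interval_maj_summable[OF L0 \<mu>, of 0] by simp
  define h where "h \<xi> = (\<Sum>\<^sub>\<infinity>k::int. complex_of_real (interval_maj \<mu> (of_int k / L)) * unit_exp (of_int k * \<xi>))" for \<xi>
  have eq: "h \<xi> * (1 - unit_exp (real p * \<xi>)) = 0" if "\<And>j::int. 1 / L < \<bar>\<xi> + of_int j\<bar>" for \<xi>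
  proof -
    have sum': "(\<lambda>k::int. interval_maj \<mu> (of_int k / L - real q)) summable_on UNIV"
      using interval_maj_summable[OF L0 \<mu>, of "- real q"] by simp
    have "(\<Sum>\<^sub>\<infinity>k::int. of_real (interval_maj \<mu> (of_int k / L) - interval_maj \<mu> (of_int k / L - real q)) * unit_exp (of_int k * \<xi>)) = 0"
    proof (rule bandlimited_samples_vanish[OF bandlimited_interval_maj_diff L0 _ that])
      show "(\<lambda>k::int. norm (complex_of_real (interval_maj \<mu> (of_int k / L) - interval_maj \<mu> (of_int k / L - real q)))) summable_on UNIV"
        using summable_on_add[OF sum summable_on_uminus[THEN iffD2, OF sum']]
        unfolding norm_of_real real_norm_def[symmetric] summable_on_iff_abs_summable_on_real[symmetric] by simp
    qed
    moreover have "(\<Sum>\<^sub>\<infinity>k::int. of_real (interval_maj \<mu> (of_int k / L) - interval_maj \<mu> (of_int k / L - real q)) * unit_exp (of_int k * \<xi>))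
       = h \<xi> - (\<Sum>\<^sub>\<infinity>k::int. of_real (interval_maj \<mu> (of_int k / L - real q)) * unit_exp (of_int k * \<xi>))"
      unfolding h_def of_real_diff left_diff_distrib
      by (intro infsum_minus summable_fourier sum sum')
    moreover have "(\<Sum>\<^sub>\<infinity>k::int. of_real (interval_maj \<mu> (of_int k / L - real q)) * unit_exp (of_int k * \<xi>))
        = (\<Sum>\<^sub>\<infinity>k::int. unit_exp (real p * \<xi>) * (of_real (interval_maj \<mu> (of_int k / L)) * unit_exp (of_int k * \<xi>)))"
    proof (rule infsum_reindex_bij_witness[of _ "\<lambda>k. k + int p" "\<lambda>k. k - int p"])
      fix k :: int
      have "of_int (k - int p) / L = of_int k / L - real q" using p q by (simp add: L field_simps)
      moreover have "unit_exp (real p * \<xi>) * unit_exp (of_int (k - int p) * \<xi>) = unit_exp (of_int k * \<xi>)"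
        by (simp add: unit_exp_add[symmetric] algebra_simps)
      ultimately show "unit_exp (real p * \<xi>) * (of_real (interval_maj \<mu> (of_int (k - int p) / L)) * unit_exp (of_int (k - int p) * \<xi>))
          = of_real (interval_maj \<mu> (of_int k / L - real q)) * unit_exp (of_int k * \<xi>)"
        by (simp add: mult_ac)
    qed auto
    moreover have "\<dots> = unit_exp (real p * \<xi>) * h \<xi>"
      unfolding h_def by (intro infsum_cmult_right summable_fourier sum)
    ultimately show ?thesis by (simp add: algebra_simps)
  qed
  have "h \<xi> = 0" if \<xi>: "\<forall>j::int. \<delta> \<le> \<bar>\<xi> + of_int j\<bar>" for \<xi>
  proof (cases "real p * \<xi> \<in> \<int>")
    case False
    have "1 / L < \<bar>\<xi> + of_int j\<bar>" for j :: int
      using \<delta> \<xi>[rule_format, of j] by linarith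
    then have "h \<xi> * (1 - unit_exp (real p * \<xi>)) = 0" by (rule eq)
    then show ?thesis using False unit_exp_eq_1_iff[of "real p * \<xi>"] by simp
  next
    case True
    then obtain i where i: "real p * \<xi> = of_int i" by (auto elim: Ints_cases)
    \<comment> \<open>Displacements up to \<open>\<eta>\<close> stay in the admissible region, and multiplied by \<open>p\<close> they are not integers.\<close>
    define \<eta> where "\<eta> = min ((\<delta> - 1 / L) / 2) (1 / (2 * real p))"
    have \<eta>: "\<eta> > 0" "\<eta> < \<delta> - 1 / L" "real p * \<eta> < 1"
    proof -
      show "\<eta> > 0" using \<delta> p by (simp add: \<eta>_def)
      have "\<eta> \<le> (\<delta> - 1 / L) / 2" unfolding \<eta>_def by (rule min.cobounded1)
      moreover have "(\<delta> - 1 / L) / 2 < \<delta> - 1 / L" using \<delta> by simp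
      ultimately show "\<eta> < \<delta> - 1 / L" by (rule le_less_trans)
      have "\<eta> \<le> 1 / (2 * real p)" unfolding \<eta>_def by (rule min.cobounded2)
      then have "real p * \<eta> \<le> real p * (1 / (2 * real p))" by (intro mult_left_mono) auto
      then show "real p * \<eta> < 1" using p by simp
    qed
    define x where "x n = \<xi> + \<eta> / real (Suc n)" for n
    have d: "0 < \<eta> / real (Suc n)" "\<eta> / real (Suc n) \<le> \<eta>" for n
      using \<eta> by (auto simp: divide_le_eq mult_le_cancel_left1)
    have h0: "h (x n) = 0" for n
    proof -
      have "1 / L < \<bar>x n + of_int j\<bar>" for j :: int
        using \<xi>[rule_format, of j] d[of n] \<eta>(2) by (simp add: x_def abs_if split: if_splits)
      moreover have "unit_exp (real p * x n) \<noteq> 1"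
      proof
        assume "unit_exp (real p * x n) = 1"
        then obtain j where "real p * x n = of_int j" by (auto simp: unit_exp_eq_1_iff elim: Ints_cases)
        then have j: "real p * (\<eta> / real (Suc n)) = of_int (j - i)" using i by (simp add: x_def distrib_left)
        have "real p * (\<eta> / real (Suc n)) \<le> real p * \<eta>" using d[of n] by (intro mult_left_mono) auto
        moreover have "0 < real p * (\<eta> / real (Suc n))" using d[of n] p by (intro mult_pos_pos) auto
        ultimately have "0 < real_of_int (j - i)" "real_of_int (j - i) < 1" using j \<eta>(3) by linarith+
        then show False by (simp only: of_int_0_less_iff of_int_less_1_iff)
      qed
      ultimately show ?thesis using eq[of "x n"] by simp
    qed
    have "(\<lambda>n. h (x n)) \<longlonglongrightarrow> h \<xi>"
      unfolding h_def
    proof (rule tannery[where b = "\<lambda>k::int. interval_maj \<mu> (of_int k / L)"])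
      show "(\<lambda>k::int. interval_maj \<mu> (of_int k / L)) summable_on UNIV" by (rule sum)
      show "norm (of_real (interval_maj \<mu> (of_int k / L)) * unit_exp (of_int k * x n)) \<le> interval_maj \<mu> (of_int k / L)" for n and k :: int
        using interval_maj_nonneg[OF \<mu>] by (simp add: norm_mult)
      have "x \<longlonglongrightarrow> \<xi> + 0"
        unfolding x_def by (intro tendsto_intros LIMSEQ_Suc[OF lim_const_over_n])
      then have "(\<lambda>n. unit_exp (of_int k * x n)) \<longlonglongrightarrow> unit_exp (of_int k * \<xi>)" for k :: int
        unfolding unit_exp_def by (intro tendsto_intros) simp
      then show "(\<lambda>n. of_real (interval_maj \<mu> (of_int k / L)) * unit_exp (of_int k * x n)) \<longlonglongrightarrow> of_real (interval_maj \<mu> (of_int k / L)) * unit_exp (of_int k * \<xi>)" for k :: int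
        by (intro tendsto_intros)
    qed
    then show ?thesis using h0 LIMSEQ_unique[of "\<lambda>n. h (x n)" "h \<xi>" 0] by simp
  qed
  then show ?thesis using sum by (simp add: band_weight_def fourier_def h_def)
qed

lemma infsum_symmetric_limit:
  fixes f :: "int \<Rightarrow> real"
  assumes "f summable_on UNIV"
  shows "(\<lambda>N. \<Sum>k\<in>{- int N..int N}. f k) \<longlonglongrightarrow> infsum f UNIV"
proof -
  have "(sum f \<longlongrightarrow> infsum f UNIV) (finite_subsets_at_top UNIV)"
    using has_sum_infsum[OF assms] by (simp add: has_sum_def)
  moreover have "filterlim (\<lambda>N. {- int N..int N}) (finite_subsets_at_top UNIV) sequentially"
    unfolding filterlim_finite_subsets_at_top
  proof safe
    fix F :: "int set" assume F: "finite F"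
    show "\<forall>\<^sub>F N in sequentially. finite {- int N..int N} \<and> F \<subseteq> {- int N..int N} \<and> {- int N..int N} \<subseteq> UNIV"
    proof (rule eventually_sequentiallyI)
      fix N :: nat assume N: "nat (\<Sum>k\<in>F. \<bar>k\<bar>) \<le> N"
      have "\<bar>k\<bar> \<le> int N" if "k \<in> F" for k
        using member_le_sum[OF that, of "\<lambda>k. \<bar>k\<bar>"] F N by simp
      then show "finite {- int N..int N} \<and> F \<subseteq> {- int N..int N} \<and> {- int N..int N} \<subseteq> UNIV"
        by (auto simp: abs_le_iff) (metis minus_le_iff)
    qed
  qed
  ultimately show ?thesis by (rule filterlim_compose)
qed

text \<open>Increasing \<open>\<nu>\<close> by one shifts each of the two steps by one sample; the difference telescopes and its sum is
the total rise of a step, once for each end. For \<open>\<nu> = 0\<close> the majorant is \<open>sinc\<^sup>2\<close> itself.\<close>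

lemma interval_maj_total:
  assumes L: "L > 0"
  shows "(\<Sum>\<^sub>\<infinity>k::int. interval_maj (real \<nu> / L) (of_int k / L)) = 2 * real \<nu> + (\<Sum>\<^sub>\<infinity>k::int. sinc_sq (of_int k / L))"
proof (induction \<nu>)
  case 0
  have "interval_maj 0 y = sinc_sq y" for y using step_maj_reflect[of y] by (simp add: interval_maj_def)
  then show ?case by simp
next
  case (Suc \<nu>)
  let ?u = "\<lambda>i::int. step_maj (of_int i / L)"
  have s: "(\<lambda>k::int. interval_maj (real n / L) (of_int k / L)) summable_on UNIV" for n
    using interval_maj_summable[OF L, of "real n / L" 0] L by simp
  have step: "interval_maj (real (Suc \<nu>) / L) (of_int k / L) - interval_maj (real \<nu> / L) (of_int k / L)
      = (?u (k + int \<nu> + 1) - ?u (k + int \<nu>)) + (?u (int \<nu> + 1 - k) - ?u (int \<nu> - k))" for k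
    by (simp add: interval_maj_def diff_divide_distrib add_divide_distrib algebra_simps)
  have tele: "(\<Sum>k\<in>{- int N..int N}. g (k + 1) - g k) = g (int N + 1) - g (- int N)" for N and g :: "int \<Rightarrow> real"
  proof (induction N)
    case (Suc N)
    have "{- int (Suc N)..int (Suc N)} = insert (int (Suc N)) (insert (- int (Suc N)) {- int N..int N})" by auto
    then show ?case using Suc by (simp add: add.commute)
  qed simp
  have flip: "(\<Sum>k\<in>{- int N..int N}. g (- k)) = (\<Sum>k\<in>{- int N..int N}. g k)" for N and g :: "int \<Rightarrow> real"
    by (rule sum.reindex_bij_witness[of _ uminus uminus]) auto
  have "(\<Sum>k\<in>{- int N..int N}. interval_maj (real (Suc \<nu>) / L) (of_int k / L) - interval_maj (real \<nu> / L) (of_int k / L))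
      = 2 * (?u (int N + 1 + int \<nu>) - ?u (- int N + int \<nu>))" for N
  proof -
    have "(\<Sum>k\<in>{- int N..int N}. ?u (k + int \<nu> + 1) - ?u (k + int \<nu>)) = ?u (int N + 1 + int \<nu>) - ?u (- int N + int \<nu>)"
      using tele[of "\<lambda>k. ?u (k + int \<nu>)" N] by (simp add: algebra_simps)
    moreover have "(\<Sum>k\<in>{- int N..int N}. ?u (int \<nu> + 1 - k) - ?u (int \<nu> - k)) = (\<Sum>k\<in>{- int N..int N}. ?u (k + int \<nu> + 1) - ?u (k + int \<nu>))"
      using flip[of "\<lambda>k. ?u (k + int \<nu> + 1) - ?u (k + int \<nu>)" N] by (simp add: algebra_simps)
    ultimately show ?thesis unfolding step sum.distrib by simp
  qed
  moreover have "(\<lambda>N. \<Sum>k\<in>{- int N..int N}. interval_maj (real (Suc \<nu>) / L) (of_int k / L) - interval_maj (real \<nu> / L) (of_int k / L))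
     \<longlonglongrightarrow> (\<Sum>\<^sub>\<infinity>k::int. interval_maj (real (Suc \<nu>) / L) (of_int k / L)) - (\<Sum>\<^sub>\<infinity>k::int. interval_maj (real \<nu> / L) (of_int k / L))"
    unfolding sum_subtractf by (intro tendsto_diff infsum_symmetric_limit s)
  moreover have "(\<lambda>N. 2 * (?u (int N + 1 + int \<nu>) - ?u (- int N + int \<nu>))) \<longlonglongrightarrow> 2 * (1 - 0)"
  proof -
    have S0: "(\<lambda>N. sinc_sq ((c + real N) / L)) \<longlonglongrightarrow> 0" for c
    proof (rule tendsto_sandwich[of "\<lambda>_. 0" _ _ "\<lambda>N. 2 * (1 / (1 + ((c + real N) / L)\<^sup>2))"])
      have lim: "filterlim (\<lambda>N. (c + real N) / L) at_top sequentially"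
        using filterlim_tendsto_pos_mult_at_top[OF tendsto_const[of "1 / L"] _ filterlim_tendsto_add_at_top[OF tendsto_const[of c] filterlim_real_sequentially]] L
        by simp
      have "(\<lambda>N. 2 * (1 / (1 + ((c + real N) / L)\<^sup>2))) \<longlonglongrightarrow> 2 * 0"
        by (intro tendsto_intros tendsto_divide_0[OF tendsto_const] filterlim_at_top_imp_at_infinity
            filterlim_tendsto_add_at_top[OF tendsto_const] filterlim_pow_at_top lim) auto
      then show "(\<lambda>N. 2 * (1 / (1 + ((c + real N) / L)\<^sup>2))) \<longlonglongrightarrow> 0" by simp
    qed (use sinc_sq_le sinc_sq_nonneg in auto)
    have "(\<lambda>N. ?u (int N + 1 + int \<nu>)) \<longlonglongrightarrow> 1"
    proof (rule tendsto_sandwich[of "\<lambda>_. 1" _ _ "\<lambda>N. 1 + sinc_sq ((real \<nu> + 1 + real N) / L) / 2"])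
      show "(\<lambda>N. 1 + sinc_sq ((real \<nu> + 1 + real N) / L) / 2) \<longlonglongrightarrow> 1"
        using tendsto_add[OF tendsto_const[of 1] tendsto_divide[OF S0[of "real \<nu> + 1"] tendsto_const[of 2]]] by simp
      show "\<forall>\<^sub>F N in sequentially. 1 \<le> ?u (int N + 1 + int \<nu>)"
        using L by (intro always_eventually allI step_maj_ge_1) simp
      have "?u (int N + 1 + int \<nu>) \<le> 1 + sinc_sq ((real \<nu> + 1 + real N) / L) / 2" for N
        using step_maj_le[of "(real \<nu> + 1 + real N) / L"] L by (simp add: add_ac)
      then show "\<forall>\<^sub>F N in sequentially. ?u (int N + 1 + int \<nu>) \<le> 1 + sinc_sq ((real \<nu> + 1 + real N) / L) / 2"
        by (intro always_eventually allI)
    qed auto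
    moreover have "(\<lambda>N. ?u (- int N + int \<nu>)) \<longlonglongrightarrow> 0"
    proof (rule tendsto_sandwich[of "\<lambda>_. 0" _ _ "\<lambda>N. sinc_sq ((- real \<nu> + real N) / L)"])
      have eq: "of_int (- int N + int \<nu>) / L = - ((- real \<nu> + real N) / L)" for N
        by (simp add: diff_divide_distrib add_divide_distrib)
      have neg: "of_int (- int N + int \<nu>) / L \<le> 0" if "N \<ge> \<nu>" for N using that L by (simp add: divide_le_0_iff)
      show "\<forall>\<^sub>F N in sequentially. 0 \<le> ?u (- int N + int \<nu>)"
        by (intro eventually_sequentiallyI[of \<nu>] order_trans[OF _ step_maj_nonpos(1)[OF neg]]) (auto simp: sinc_sq_nonneg)
      have "?u (- int N + int \<nu>) \<le> sinc_sq ((- real \<nu> + real N) / L)" if "N \<ge> \<nu>" for N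
        using step_maj_nonpos(2)[OF neg[OF that]] unfolding eq sinc_sq_minus .
      then show "\<forall>\<^sub>F N in sequentially. ?u (- int N + int \<nu>) \<le> sinc_sq ((- real \<nu> + real N) / L)"
        by (rule eventually_sequentiallyI)
    qed (use S0[of "- real \<nu>"] in auto)
    ultimately show ?thesis by (intro tendsto_intros)
  qed
  ultimately have "(\<Sum>\<^sub>\<infinity>k::int. interval_maj (real (Suc \<nu>) / L) (of_int k / L)) - (\<Sum>\<^sub>\<infinity>k::int. interval_maj (real \<nu> / L) (of_int k / L)) = 2 * (1 - 0)"
    using LIMSEQ_unique by fastforce
  then show ?case using Suc by simp
qed

text \<open>At the endpoints \<open>|k| = \<nu>\<close> both \<open>1 \<le> M\<close> and \<open>2|H| \<le> M\<close> hold. A minorant for the integers \<open>|k| \<le> n\<close> can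
therefore be built with \<open>\<nu> = n + 1\<close>, a majorant with \<open>\<nu> = n\<close>.\<close>

lemma selberg_weights:
  fixes L \<delta> :: real and \<nu> :: nat
  assumes p: "p > 0" and q: "q > 0" and L: "L = real p / real q" and L2: "L \<ge> 2" and \<delta>: "\<delta> > 1 / L"
  obtains M H :: "int \<Rightarrow> real" and \<sigma> where "band_weight \<delta> M" "band_weight \<delta> H" "0 \<le> \<sigma>" "\<sigma> \<le> L"
    "infsum M UNIV = 2 * real \<nu> + \<sigma>" "infsum H UNIV = 2 * real \<nu>"
    "\<And>k. 0 \<le> M k" "\<And>k. \<bar>k\<bar> \<le> int \<nu> \<Longrightarrow> 1 \<le> M k"
    "\<And>k. \<bar>k\<bar> < int \<nu> \<Longrightarrow> 0 \<le> H k \<and> H k \<le> 1"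
    "\<And>k. L \<le> 2 * real \<nu> \<Longrightarrow> int \<nu> \<le> \<bar>k\<bar> \<Longrightarrow> 2 * \<bar>H k\<bar> \<le> M k"
proof
  let ?\<mu> = "real \<nu> / L" and ?\<sigma> = "\<Sum>\<^sub>\<infinity>k::int. sinc_sq (of_int k / L)"
  let ?M = "\<lambda>k::int. interval_maj ?\<mu> (of_int k / L)" and ?H = "\<lambda>k::int. interval_mid ?\<mu> (of_int k / L)"
  have L0: "L > 0" using L2 by simp
  have \<mu>: "0 \<le> ?\<mu>" using L0 by simp
  show M: "band_weight \<delta> ?M" by (rule band_weight_interval_maj[OF p q L \<delta> \<mu>])
  have H_eq: "?H = (\<lambda>k. (?M k + (- 1 / 2) * sinc_sq (of_int k / L + ?\<mu>)) + (- 1 / 2) * sinc_sq (of_int k / L + (- ?\<mu>)))"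
  proof
    fix k :: int
    show "?H k = (?M k + (- 1 / 2) * sinc_sq (of_int k / L + ?\<mu>)) + (- 1 / 2) * sinc_sq (of_int k / L + (- ?\<mu>))"
      using sinc_sq_minus[of "of_int k / L - ?\<mu>"] by (simp add: interval_mid_def add_divide_distrib)
  qed
  show H: "band_weight \<delta> ?H" unfolding H_eq by (intro band_weight_lincomb M band_weight_sinc_sq L0 \<delta>)
  show "0 \<le> ?\<sigma>" by (intro infsum_nonneg sinc_sq_nonneg)
  show "?\<sigma> \<le> L" by (rule sinc_sq_total_le[OF L2])
  show tot: "infsum ?M UNIV = 2 * real \<nu> + ?\<sigma>" by (rule interval_maj_total[OF L0])
  have shift: "(\<Sum>\<^sub>\<infinity>k::int. sinc_sq (of_int k / L + of_int j / L)) = ?\<sigma>" for j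
    by (rule infsum_reindex_bij_witness[of _ "\<lambda>k. k - j" "\<lambda>k. k + j"]) (auto simp: add_divide_distrib)
  have sS: "(\<lambda>k::int. sinc_sq (of_int k / L + s)) summable_on UNIV" for s
    using sinc_sq_summable[OF L0, of "- s" UNIV] by simp
  have sM: "?M summable_on UNIV" using M by (simp add: band_weight_def fourier_def)
  show "infsum ?H UNIV = 2 * real \<nu>"
  proof -
    have "infsum ?H UNIV = infsum (\<lambda>k. ?M k + (- 1 / 2) * sinc_sq (of_int k / L + ?\<mu>)) UNIV + infsum (\<lambda>k::int. (- 1 / 2) * sinc_sq (of_int k / L + (- ?\<mu>))) UNIV"
      unfolding H_eq by (intro infsum_add summable_on_add summable_on_cmult_right sM sS)
    also have "infsum (\<lambda>k. ?M k + (- 1 / 2) * sinc_sq (of_int k / L + ?\<mu>)) UNIV = infsum ?M UNIV + infsum (\<lambda>k::int. (- 1 / 2) * sinc_sq (of_int k / L + ?\<mu>)) UNIV"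
      by (intro infsum_add summable_on_add summable_on_cmult_right sM sS)
    also have "infsum (\<lambda>k::int. (- 1 / 2) * sinc_sq (of_int k / L + ?\<mu>)) UNIV = (- 1 / 2) * ?\<sigma>"
      using shift[of "int \<nu>"] by (subst infsum_cmult_right) (use sS in auto)
    also have "infsum (\<lambda>k::int. (- 1 / 2) * sinc_sq (of_int k / L + (- ?\<mu>))) UNIV = (- 1 / 2) * ?\<sigma>"
      using shift[of "- int \<nu>"] sS[of "- ?\<mu>"] by (subst infsum_cmult_right) auto
    finally show ?thesis unfolding tot by simp
  qed
  show "0 \<le> ?M k" for k by (rule interval_maj_nonneg[OF \<mu>])
  have abs: "\<bar>of_int k / L\<bar> = of_int \<bar>k\<bar> / L" for k :: int using L0 by simp
  have le: "\<bar>of_int k / L\<bar> \<le> ?\<mu>" if "\<bar>k\<bar> \<le> int \<nu>" for k :: int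
    unfolding abs using that L0 by (intro divide_right_mono) linarith+
  show "1 \<le> ?M k" if "\<bar>k\<bar> \<le> int \<nu>" for k by (intro interval_maj_mid_inside le that)
  show "0 \<le> ?H k \<and> ?H k \<le> 1" if "\<bar>k\<bar> < int \<nu>" for k
    using interval_maj_mid_inside[OF le[of k]] that by simp
  show "2 * \<bar>?H k\<bar> \<le> ?M k" if "L \<le> 2 * real \<nu>" "int \<nu> \<le> \<bar>k\<bar>" for k
  proof (rule interval_maj_mid_outside)
    show "1 / 2 \<le> ?\<mu>" using that L0 by (simp add: field_simps)
    show "?\<mu> \<le> \<bar>of_int k / L\<bar>" unfolding abs using that L0 by (intro divide_right_mono) linarith+
  qed
qed

section \<open>Exponential sums over integer boxes\<close>

text \<open>The points are given by their coordinates \<open>a x i\<close> and indexed by an arbitrary set, so that rescaling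
them does not change the index set of the coefficients.\<close>

definition expsum :: "'a set \<Rightarrow> ('a \<Rightarrow> 'n::finite \<Rightarrow> real) \<Rightarrow> ('a \<Rightarrow> complex) \<Rightarrow> ('n \<Rightarrow> int) \<Rightarrow> complex" where
  "expsum X a u \<kappa> = (\<Sum>x\<in>X. u x * unit_exp (- (\<Sum>i\<in>UNIV. of_int (\<kappa> i) * a x i)))"

lemma unit_exp_sum: "finite I \<Longrightarrow> unit_exp (sum f I) = (\<Prod>i\<in>I. unit_exp (f i))"
  by (induction I rule: finite_induct) (auto simp: unit_exp_add)

lemma prod_fourier:
  fixes w :: "int \<Rightarrow> real" and z :: "'n::finite \<Rightarrow> real"
  assumes "w summable_on UNIV"
  shows "((\<lambda>\<kappa>. of_real (\<Prod>i\<in>UNIV. w (\<kappa> i)) * unit_exp (\<Sum>i\<in>UNIV. of_int (\<kappa> i) * z i)) has_sum (\<Prod>i\<in>UNIV. fourier w (z i))) UNIV"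
proof -
  let ?f = "\<lambda>(i::'n) k. complex_of_real (w k) * unit_exp (of_int k * z i)"
  have abs: "Infinite_Sum.abs_summable_on (?f i) UNIV" for i
    using summable_on_iff_abs_summable_on_real[of w UNIV] assms by (simp add: norm_mult)
  have P: "PiE UNIV (\<lambda>_. UNIV) = (UNIV :: ('n \<Rightarrow> int) set)" by (simp add: PiE_UNIV_domain)
  have "Infinite_Set_Sum.abs_summable_on (\<lambda>\<kappa>. \<Prod>i\<in>UNIV. ?f i (\<kappa> i)) (PiE UNIV (\<lambda>_. UNIV))"
    by (rule abs_summable_on_prod_PiE) (use abs abs_summable_equivalent in auto)
  then have "(\<lambda>\<kappa>. \<Prod>i\<in>UNIV. ?f i (\<kappa> i)) summable_on UNIV"
    unfolding P abs_summable_equivalent[symmetric] by (rule abs_summable_summable)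
  moreover have "infsum (\<lambda>\<kappa>. \<Prod>i\<in>UNIV. ?f i (\<kappa> i)) (PiE UNIV (\<lambda>_. UNIV)) = (\<Prod>i\<in>UNIV. infsum (?f i) UNIV)"
    by (rule infsum_prod_PiE_abs) (use abs in auto)
  ultimately have "((\<lambda>\<kappa>. \<Prod>i\<in>UNIV. ?f i (\<kappa> i)) has_sum (\<Prod>i\<in>UNIV. fourier w (z i))) UNIV"
    unfolding P by (simp add: has_sum_iff fourier_def)
  moreover have "(\<Prod>i\<in>UNIV. ?f i (\<kappa> i)) = of_real (\<Prod>i\<in>UNIV. w (\<kappa> i)) * unit_exp (\<Sum>i\<in>UNIV. of_int (\<kappa> i) * z i)" for \<kappa> :: "'n \<Rightarrow> int"
    by (simp add: unit_exp_sum prod.distrib)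
  ultimately show ?thesis by simp
qed

lemma has_sum_finite_sum:
  fixes f :: "'i \<Rightarrow> 'k \<Rightarrow> 'b::topological_comm_monoid_add"
  assumes "finite I" "\<And>i. i \<in> I \<Longrightarrow> (f i has_sum s i) A"
  shows "((\<lambda>k. \<Sum>i\<in>I. f i k) has_sum (\<Sum>i\<in>I. s i)) A"
  using assms by (induction I rule: finite_induct) (auto intro: has_sum_add)

lemma quadratic_form_has_sum:
  fixes a :: "'a \<Rightarrow> 'n::finite \<Rightarrow> real"
  assumes X: "finite X" and w: "band_weight \<delta> w"
    and sep: "\<And>x y. x \<in> X \<Longrightarrow> y \<in> X \<Longrightarrow> x \<noteq> y \<Longrightarrow> \<exists>i. \<forall>j::int. \<delta> \<le> \<bar>a x i - a y i + of_int j\<bar>"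
  shows "((\<lambda>\<kappa>. (\<Prod>i\<in>UNIV. w (\<kappa> i)) * (cmod (expsum X a u \<kappa>))\<^sup>2) has_sum
    (infsum w UNIV) ^ CARD('n) * (\<Sum>x\<in>X. (cmod (u x))\<^sup>2)) UNIV"
proof -
  have sw: "w summable_on UNIV" using w by (simp add: band_weight_def)
  let ?W = "\<lambda>\<kappa>::'n \<Rightarrow> int. \<Prod>i\<in>UNIV. w (\<kappa> i)"
  have "((\<lambda>\<kappa>. \<Sum>x\<in>X. \<Sum>y\<in>X. (u x * cnj (u y)) * (of_real (?W \<kappa>) * unit_exp (\<Sum>i\<in>UNIV. of_int (\<kappa> i) * (a y i - a x i)))) has_sum
      (\<Sum>x\<in>X. \<Sum>y\<in>X. (u x * cnj (u y)) * (\<Prod>i\<in>UNIV. fourier w (a y i - a x i)))) UNIV"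
    by (intro has_sum_finite_sum X has_sum_cmult_right prod_fourier sw)
  moreover have "(\<Sum>x\<in>X. \<Sum>y\<in>X. (u x * cnj (u y)) * (of_real (?W \<kappa>) * unit_exp (\<Sum>i\<in>UNIV. of_int (\<kappa> i) * (a y i - a x i))))
      = of_real (?W \<kappa> * (cmod (expsum X a u \<kappa>))\<^sup>2)" for \<kappa>
  proof -
    have "unit_exp (\<Sum>i\<in>UNIV. of_int (\<kappa> i) * (a y i - a x i)) = unit_exp (- (\<Sum>i\<in>UNIV. of_int (\<kappa> i) * a x i)) * unit_exp (\<Sum>i\<in>UNIV. of_int (\<kappa> i) * a y i)" for x y
      by (simp add: unit_exp_add[symmetric] right_diff_distrib sum_subtractf)
    note unit_exp_split = this
    have "expsum X a u \<kappa> * cnj (expsum X a u \<kappa>) = (\<Sum>x\<in>X. \<Sum>y\<in>X.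
        (u x * unit_exp (- (\<Sum>i\<in>UNIV. of_int (\<kappa> i) * a x i))) * (cnj (u y) * unit_exp (\<Sum>i\<in>UNIV. of_int (\<kappa> i) * a y i)))"
      by (simp only: expsum_def cnj_sum complex_cnj_mult cnj_unit_exp minus_minus sum_product)
    then have "of_real (?W \<kappa> * (cmod (expsum X a u \<kappa>))\<^sup>2) = (\<Sum>x\<in>X. \<Sum>y\<in>X. of_real (?W \<kappa>) *
        ((u x * unit_exp (- (\<Sum>i\<in>UNIV. of_int (\<kappa> i) * a x i))) * (cnj (u y) * unit_exp (\<Sum>i\<in>UNIV. of_int (\<kappa> i) * a y i))))"
      by (simp only: of_real_mult complex_norm_square sum_distrib_left)
    then show ?thesis by (simp only: unit_exp_split mult_ac)
  qed
  moreover have "(\<Sum>x\<in>X. \<Sum>y\<in>X. (u x * cnj (u y)) * (\<Prod>i\<in>UNIV. fourier w (a y i - a x i)))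
      = of_real ((infsum w UNIV) ^ CARD('n) * (\<Sum>x\<in>X. (cmod (u x))\<^sup>2))"
  proof -
    have f0: "fourier w 0 = of_real (infsum w UNIV)"
      using has_sum_of_real[OF has_sum_infsum[OF sw]] unfolding fourier_def by (intro infsumI) simp
    have "(\<Prod>i\<in>UNIV. fourier w (a y i - a x i)) = (if y = x then of_real (infsum w UNIV) ^ CARD('n) else 0)"
      if xy: "x \<in> X" "y \<in> X" for x y
    proof (cases "y = x")
      case False
      then obtain i where "\<forall>j::int. \<delta> \<le> \<bar>a y i - a x i + of_int j\<bar>" using sep[OF xy(2,1)] by auto
      then have "fourier w (a y i - a x i) = 0" using w by (simp add: band_weight_def fourier_def)
      then have "(\<Prod>i\<in>UNIV. fourier w (a y i - a x i)) = 0" by (intro prod_zero) auto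
      then show ?thesis using False by simp
    qed (simp add: f0)
    then have "(\<Sum>x\<in>X. \<Sum>y\<in>X. (u x * cnj (u y)) * (\<Prod>i\<in>UNIV. fourier w (a y i - a x i)))
       = (\<Sum>x\<in>X. \<Sum>y\<in>X. if y = x then (u x * cnj (u x)) * of_real (infsum w UNIV) ^ CARD('n) else 0)"
      by (intro sum.cong) auto
    also have "\<dots> = (\<Sum>x\<in>X. (u x * cnj (u x)) * of_real (infsum w UNIV) ^ CARD('n))"
      using X by (simp add: sum.delta)
    also have "\<dots> = of_real ((infsum w UNIV) ^ CARD('n) * (\<Sum>x\<in>X. (cmod (u x))\<^sup>2))"
      by (simp add: complex_norm_square sum_distrib_left mult_ac del: of_real_power flip: of_real_power)
    finally show ?thesis .
  qed
  ultimately have "((\<lambda>\<kappa>. complex_of_real (?W \<kappa> * (cmod (expsum X a u \<kappa>))\<^sup>2)) has_sum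
      of_real ((infsum w UNIV) ^ CARD('n) * (\<Sum>x\<in>X. (cmod (u x))\<^sup>2))) UNIV"
    by (simp only:)
  then show ?thesis by (simp only: has_sum_of_real_iff)
qed

definition int_box :: "nat \<Rightarrow> ('n::finite \<Rightarrow> int) set" where
  "int_box n = {\<kappa>. \<forall>i. \<bar>\<kappa> i\<bar> \<le> int n}"

lemma int_box_PiE: "int_box n = PiE UNIV (\<lambda>_. {- int n..int n})"
proof -
  have "\<bar>k\<bar> \<le> int n \<longleftrightarrow> k \<in> {- int n..int n}" for k by auto
  then show ?thesis by (simp add: int_box_def PiE_UNIV_domain Pi_def)
qed

lemma finite_int_box: "finite (int_box n :: ('n::finite \<Rightarrow> int) set)"
  unfolding int_box_PiE by (intro finite_PiE) auto

lemma card_int_box: "card (int_box n :: ('n::finite \<Rightarrow> int) set) = (2 * n + 1) ^ CARD('n)"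
proof -
  have "nat (int n + 1 + int n) = 2 * n + 1" by simp
  then show ?thesis unfolding int_box_PiE by (simp add: card_PiE)
qed

lemma expsum_box_upper:
  fixes a :: "'a \<Rightarrow> 'n::finite \<Rightarrow> real"
  assumes X: "finite X" and w: "band_weight \<delta> w"
    and sep: "\<And>x y. x \<in> X \<Longrightarrow> y \<in> X \<Longrightarrow> x \<noteq> y \<Longrightarrow> \<exists>i. \<forall>j::int. \<delta> \<le> \<bar>a x i - a y i + of_int j\<bar>"
    and maj: "\<And>k. 0 \<le> w k" "\<And>k. \<bar>k\<bar> \<le> int n \<Longrightarrow> 1 \<le> w k"
  shows "(\<Sum>\<kappa>\<in>int_box n. (cmod (expsum X a u \<kappa>))\<^sup>2) \<le> (infsum w UNIV) ^ CARD('n) * (\<Sum>x\<in>X. (cmod (u x))\<^sup>2)"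
proof (rule has_sum_mono_neutral)
  show "((\<lambda>\<kappa>. (\<Prod>i\<in>UNIV. w (\<kappa> i)) * (cmod (expsum X a u \<kappa>))\<^sup>2) has_sum
    (infsum w UNIV) ^ CARD('n) * (\<Sum>x\<in>X. (cmod (u x))\<^sup>2)) UNIV"
    by (rule quadratic_form_has_sum[OF X w sep])
  show "((\<lambda>\<kappa>. (cmod (expsum X a u \<kappa>))\<^sup>2) has_sum (\<Sum>\<kappa>\<in>int_box n. (cmod (expsum X a u \<kappa>))\<^sup>2)) (int_box n)"
    by (intro has_sum_finite finite_int_box)
  show "(cmod (expsum X a u \<kappa>))\<^sup>2 \<le> (\<Prod>i\<in>UNIV. w (\<kappa> i)) * (cmod (expsum X a u \<kappa>))\<^sup>2" if "\<kappa> \<in> int_box n \<inter> UNIV" for \<kappa>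
  proof -
    have "1 \<le> (\<Prod>i\<in>UNIV. w (\<kappa> i))" using that maj(2) by (intro prod_ge_1) (auto simp: int_box_def)
    then show ?thesis by (simp add: mult_le_cancel_right1)
  qed
  show "0 \<le> (\<Prod>i\<in>UNIV. w (\<kappa> i)) * (cmod (expsum X a u \<kappa>))\<^sup>2" for \<kappa>
    using maj(1) by (intro mult_nonneg_nonneg prod_nonneg) auto
qed auto

text \<open>Inside the cube the first product is at most \<open>1\<close> and the second at least \<open>1\<close>. Outside, one coordinate with
\<open>2|H| \<le> M\<close> together with \<open>|H| \<le> M\<close> in all others gives \<open>2 |\<Prod>H| \<le> \<Prod>M\<close>.\<close>

lemma product_minorant:
  fixes M H :: "'k \<Rightarrow> real" and \<kappa> :: "'n::finite \<Rightarrow> 'k"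
  assumes M: "\<And>k. 0 \<le> M k"
    and inside: "\<And>k. k \<in> B \<Longrightarrow> 1 \<le> M k \<and> 0 \<le> H k \<and> H k \<le> 1"
    and outside: "\<And>k. k \<notin> B \<Longrightarrow> 2 * \<bar>H k\<bar> \<le> M k"
  shows "2 * (\<Prod>i\<in>UNIV. H (\<kappa> i)) - (\<Prod>i\<in>UNIV. M (\<kappa> i)) \<le> (if \<forall>i. \<kappa> i \<in> B then 1 else 0)"
proof (cases "\<forall>i. \<kappa> i \<in> B")
  case True
  then have "(\<Prod>i\<in>UNIV. H (\<kappa> i)) \<le> 1" "1 \<le> (\<Prod>i\<in>UNIV. M (\<kappa> i))"
    using inside by (auto intro!: prod_le_1 prod_ge_1)
  then show ?thesis using True by simp
next
  case False
  then obtain i where i: "\<kappa> i \<notin> B" by auto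
  have le: "\<bar>H k\<bar> \<le> M k" for k
    using M[of k] inside[of k] outside[of k] by (cases "k \<in> B") auto
  have split: "(\<Prod>j\<in>UNIV. f (\<kappa> j)) = f (\<kappa> i) * (\<Prod>j\<in>UNIV - {i}. f (\<kappa> j))" for f :: "'k \<Rightarrow> real"
    by (rule prod.remove) auto
  have "2 * (\<Prod>j\<in>UNIV. H (\<kappa> j)) \<le> 2 * \<bar>\<Prod>j\<in>UNIV. H (\<kappa> j)\<bar>" by simp
  also have "\<dots> = (2 * \<bar>H (\<kappa> i)\<bar>) * (\<Prod>j\<in>UNIV - {i}. \<bar>H (\<kappa> j)\<bar>)"
    unfolding split[of H] by (simp add: abs_mult abs_prod)
  also have "\<dots> \<le> M (\<kappa> i) * (\<Prod>j\<in>UNIV - {i}. M (\<kappa> j))"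
    using le M outside[OF i] by (intro mult_mono prod_mono prod_nonneg) auto
  also have "\<dots> = (\<Prod>j\<in>UNIV. M (\<kappa> j))" by (rule split[symmetric])
  finally show ?thesis using False by simp
qed

lemma expsum_box_lower:
  fixes a :: "'a \<Rightarrow> 'n::finite \<Rightarrow> real"
  assumes X: "finite X" and M: "band_weight \<delta> M" and H: "band_weight \<delta> H"
    and sep: "\<And>x y. x \<in> X \<Longrightarrow> y \<in> X \<Longrightarrow> x \<noteq> y \<Longrightarrow> \<exists>i. \<forall>j::int. \<delta> \<le> \<bar>a x i - a y i + of_int j\<bar>"
    and M0: "\<And>k. 0 \<le> M k"
    and inside: "\<And>k. \<bar>k\<bar> \<le> int n \<Longrightarrow> 1 \<le> M k \<and> 0 \<le> H k \<and> H k \<le> 1"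
    and outside: "\<And>k. \<not> \<bar>k\<bar> \<le> int n \<Longrightarrow> 2 * \<bar>H k\<bar> \<le> M k"
  shows "(2 * (infsum H UNIV) ^ CARD('n) - (infsum M UNIV) ^ CARD('n)) * (\<Sum>x\<in>X. (cmod (u x))\<^sup>2)
    \<le> (\<Sum>\<kappa>\<in>int_box n. (cmod (expsum X a u \<kappa>))\<^sup>2)"
proof -
  let ?p = "\<lambda>\<kappa>. (cmod (expsum X a u \<kappa>))\<^sup>2" and ?s = "\<Sum>x\<in>X. (cmod (u x))\<^sup>2"
  let ?g = "\<lambda>\<kappa>::'n \<Rightarrow> int. 2 * (\<Prod>i\<in>UNIV. H (\<kappa> i)) - (\<Prod>i\<in>UNIV. M (\<kappa> i))"
  have g: "?g \<kappa> \<le> (if \<kappa> \<in> int_box n then 1 else 0)" for \<kappa>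
    using product_minorant[of M "{k. \<bar>k\<bar> \<le> int n}" H \<kappa>] M0 inside outside by (simp add: int_box_def)
  have "((\<lambda>\<kappa>. 2 * ((\<Prod>i\<in>UNIV. H (\<kappa> i)) * ?p \<kappa>) + (- 1) * ((\<Prod>i\<in>UNIV. M (\<kappa> i)) * ?p \<kappa>)) has_sum
      2 * ((infsum H UNIV) ^ CARD('n) * ?s) + (- 1) * ((infsum M UNIV) ^ CARD('n) * ?s)) UNIV"
    by (intro has_sum_add has_sum_cmult_right quadratic_form_has_sum[OF X M sep] quadratic_form_has_sum[OF X H sep])
  then have "2 * ((infsum H UNIV) ^ CARD('n) * ?s) + (- 1) * ((infsum M UNIV) ^ CARD('n) * ?s) \<le> (\<Sum>\<kappa>\<in>int_box n. ?p \<kappa>)"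
  proof (rule has_sum_mono_neutral)
    show "(?p has_sum (\<Sum>\<kappa>\<in>int_box n. ?p \<kappa>)) (int_box n)"
      by (intro has_sum_finite finite_int_box)
    have factored: "2 * ((\<Prod>i\<in>UNIV. H (\<kappa> i)) * ?p \<kappa>) + (- 1) * ((\<Prod>i\<in>UNIV. M (\<kappa> i)) * ?p \<kappa>) = ?g \<kappa> * ?p \<kappa>" for \<kappa>
      by (simp add: algebra_simps)
    show "2 * ((\<Prod>i\<in>UNIV. H (\<kappa> i)) * ?p \<kappa>) + (- 1) * ((\<Prod>i\<in>UNIV. M (\<kappa> i)) * ?p \<kappa>) \<le> ?p \<kappa>"
      if "\<kappa> \<in> UNIV \<inter> int_box n" for \<kappa>
      unfolding factored using mult_right_mono[OF g[of \<kappa>], of "?p \<kappa>"] that by simp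
    show "2 * ((\<Prod>i\<in>UNIV. H (\<kappa> i)) * ?p \<kappa>) + (- 1) * ((\<Prod>i\<in>UNIV. M (\<kappa> i)) * ?p \<kappa>) \<le> 0"
      if "\<kappa> \<in> UNIV - int_box n" for \<kappa>
      unfolding factored using mult_right_mono[OF g[of \<kappa>], of "?p \<kappa>"] that by simp
  qed auto
  then show ?thesis by (simp add: algebra_simps)
qed

text \<open>If there are two distinct points, then \<open>c/m \<le> 1/2\<close>, since every real number is within \<open>1/2\<close> of an
integer; this provides \<open>L \<ge> 2\<close>. A single exponential has modulus one, so for a single point both bounds are
immediate.\<close>

lemma expsum_box_bounds:
  fixes a :: "'a \<Rightarrow> 'n::finite \<Rightarrow> real" and c m :: real
  assumes X: "finite X" and c: "c \<ge> 1/2" and m: "m > 0" and E2: "exp (real CARD('n) / (2 * c)) \<le> 2"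
    and separated: "\<forall>x\<in>X. \<forall>y\<in>X. x \<noteq> y \<longrightarrow> (\<exists>i. \<forall>j::int. c / m \<le> \<bar>a x i - a y i + of_int j\<bar>)"
  defines "n \<equiv> nat \<lfloor>m\<rfloor>" and "E \<equiv> exp (real CARD('n) / (2 * c))"
  shows "(2 - E) * real ((2 * n + 1) ^ CARD('n)) * (\<Sum>x\<in>X. (cmod (u x))\<^sup>2)
      \<le> (\<Sum>\<kappa>\<in>int_box n. (cmod (expsum X a u \<kappa>))\<^sup>2)" (is "?lower")
    and "(\<Sum>\<kappa>\<in>int_box n. (cmod (expsum X a u \<kappa>))\<^sup>2)
      \<le> E * real ((2 * n + 1) ^ CARD('n)) * (\<Sum>x\<in>X. (cmod (u x))\<^sup>2)" (is "?upper")
proof -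
  let ?s = "\<Sum>x\<in>X. (cmod (u x))\<^sup>2" and ?d = "CARD('n)"
  have sep: "\<exists>i. \<forall>j::int. c / m \<le> \<bar>a x i - a y i + of_int j\<bar>" if "x \<in> X" "y \<in> X" "x \<noteq> y" for x y
    using separated that by blast
  have s0: "0 \<le> ?s" by (intro sum_nonneg) auto
  have E1: "1 \<le> E" using c by (simp add: E_def)
  have "?lower \<and> ?upper"
  proof (cases "\<exists>x\<in>X. \<exists>y\<in>X. x \<noteq> y")
    case False
    have "(cmod (expsum X a u \<kappa>))\<^sup>2 = ?s" for \<kappa>
    proof (cases "X = {}")
      case False
      then obtain x where "X = {x}" using \<open>\<not> (\<exists>x\<in>X. \<exists>y\<in>X. x \<noteq> y)\<close> by blast
      then show ?thesis by (simp add: expsum_def norm_mult)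
    qed (simp add: expsum_def)
    then have eq: "(\<Sum>\<kappa>\<in>int_box n. (cmod (expsum X a u \<kappa>))\<^sup>2) = 1 * (real ((2 * n + 1) ^ ?d) * ?s)"
      by (simp add: card_int_box)
    have "0 \<le> real ((2 * n + 1) ^ ?d) * ?s" using s0 by simp
    then show ?thesis unfolding eq mult.assoc[of "2 - E"] mult.assoc[of E]
      using E1 by (intro conjI mult_right_mono) auto
  next
    case True
    then obtain x y where "x \<in> X" "y \<in> X" "x \<noteq> y" by blast
    then obtain i where i: "\<And>j::int. c / m \<le> \<bar>a x i - a y i + of_int j\<bar>" using sep by blast
    have half: "c / m \<le> 1 / 2"
    proof -
      have "\<bar>a x i - a y i + of_int (- round (a x i - a y i))\<bar> \<le> 1 / 2"
        using of_int_round_abs_le[of "a x i - a y i"] by linarith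
      then show ?thesis using i[of "- round (a x i - a y i)"] by linarith
    qed
    have mn: "m < real n + 1" unfolding n_def using m by linarith
    have "m / c < (real n + 1) / c" using mn c by (intro divide_strict_right_mono) auto
    then obtain L where L: "L \<in> \<rat>" "m / c < L" "L < (real n + 1) / c" using Rats_dense_in_real by blast
    have "2 \<le> m / c" using half m c by (simp add: field_simps)
    then have L2: "L \<ge> 2" using L by simp
    \<comment> \<open>A rational \<open>L\<close> in this interval is large enough for the separation of the points and small enough for both masses.\<close>
    obtain p q :: nat where pq: "q \<noteq> 0" "\<bar>L\<bar> = real p / real q" using Rats_abs_nat_div_natE[OF L(1)] by metis
    have pq': "p > 0" "q > 0" "L = real p / real q"
      using pq L2 by (auto intro: Nat.gr0I)
    have \<delta>: "1 / L < c / m"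
    proof -
      have "1 / L < 1 / (m / c)" using L(2) L2 m c by (intro divide_strict_left_mono mult_pos_pos divide_pos_pos) auto
      then show ?thesis by simp
    qed
    have Lc: "L * c < real n + 1" using L(3) c by (simp add: field_simps)
    have pow: "(1 + 1 / (2 * c)) ^ ?d \<le> E"
    proof -
      have "(1 + 1 / (2 * c)) ^ ?d \<le> exp (1 / (2 * c)) ^ ?d"
        using c exp_ge_add_one_self[of "1 / (2 * c)"] by (intro power_mono) auto
      also have "\<dots> = E" by (simp add: E_def flip: exp_of_nat_mult)
      finally show ?thesis .
    qed
    obtain M H \<sigma> where w: "band_weight (c / m) M" "0 \<le> \<sigma>" "\<sigma> \<le> L" "infsum M UNIV = 2 * real n + \<sigma>"
        "\<And>k. 0 \<le> M k" "\<And>k. \<bar>k\<bar> \<le> int n \<Longrightarrow> 1 \<le> M k"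
      using selberg_weights[OF pq' L2 \<delta>, of n] by metis
    have ?upper
    proof -
      have "(\<Sum>\<kappa>\<in>int_box n. (cmod (expsum X a u \<kappa>))\<^sup>2) \<le> (2 * real n + \<sigma>) ^ ?d * ?s"
        using expsum_box_upper[OF X w(1) sep w(5,6)] unfolding w(4) .
      also have "\<dots> \<le> (E * real ((2 * n + 1) ^ ?d)) * ?s"
      proof (intro mult_right_mono s0)
        have "2 * real n + \<sigma> \<le> (1 + 1 / (2 * c)) * (2 * real n + 1)"
        proof -
          \<comment> \<open>The lower bound on \<open>c\<close> is used here: the two sides differ by \<open>1 - 1/(2c)\<close>.\<close>
          have "(real n + 1) / c \<le> 1 + (2 * real n + 1) / (2 * c)"
            using c by (simp add: field_simps)
          then have "2 * real n + \<sigma> \<le> 2 * real n + 1 + (2 * real n + 1) / (2 * c)" using w(3) L(3) by linarith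
          then show ?thesis by (simp add: distrib_right)
        qed
        then have "(2 * real n + \<sigma>) ^ ?d \<le> ((1 + 1 / (2 * c)) * (2 * real n + 1)) ^ ?d"
          using w(2) by (intro power_mono) auto
        also have "\<dots> = (1 + 1 / (2 * c)) ^ ?d * (2 * real n + 1) ^ ?d" by (simp add: power_mult_distrib)
        also have "\<dots> \<le> E * (2 * real n + 1) ^ ?d" using pow by (intro mult_right_mono) auto
        finally show "(2 * real n + \<sigma>) ^ ?d \<le> E * real ((2 * n + 1) ^ ?d)" by (simp add: add.commute)
      qed
      finally show ?thesis .
    qed
    moreover have ?lower
    proof -
      obtain M H \<sigma> where w: "band_weight (c / m) M" "band_weight (c / m) H" "0 \<le> \<sigma>" "\<sigma> \<le> L"
          "infsum M UNIV = 2 * real (n + 1) + \<sigma>" "infsum H UNIV = 2 * real (n + 1)"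
          "\<And>k. 0 \<le> M k" "\<And>k. \<bar>k\<bar> \<le> int (n + 1) \<Longrightarrow> 1 \<le> M k"
          "\<And>k. \<bar>k\<bar> < int (n + 1) \<Longrightarrow> 0 \<le> H k \<and> H k \<le> 1"
          "\<And>k. L \<le> 2 * real (n + 1) \<Longrightarrow> int (n + 1) \<le> \<bar>k\<bar> \<Longrightarrow> 2 * \<bar>H k\<bar> \<le> M k"
        using selberg_weights[OF pq' L2 \<delta>, of "n + 1"] by metis
      let ?N = "2 * real (n + 1)"
      have LN: "L \<le> ?N"
      proof -
        have "L * (1 / 2) \<le> L * c" using L2 c by (intro mult_left_mono) auto
        then show ?thesis using Lc by simp
      qed
      have "(2 - E) * real ((2 * n + 1) ^ ?d) * ?s \<le> (2 * ?N ^ ?d - (?N + \<sigma>) ^ ?d) * ?s"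
      proof (intro mult_right_mono s0)
        have "(?N + \<sigma>) ^ ?d \<le> ((1 + 1 / (2 * c)) * ?N) ^ ?d"
        proof (intro power_mono)
          have "\<sigma> \<le> (real n + 1) / c" using w(4) L(3) by linarith
          then show "?N + \<sigma> \<le> (1 + 1 / (2 * c)) * ?N" by (simp add: distrib_right add_divide_distrib)
        qed (use w(3) in auto)
        also have "\<dots> = (1 + 1 / (2 * c)) ^ ?d * ?N ^ ?d" by (rule power_mult_distrib)
        also have "\<dots> \<le> E * ?N ^ ?d" using pow by (intro mult_right_mono) auto
        finally have "(2 - E) * ?N ^ ?d \<le> 2 * ?N ^ ?d - (?N + \<sigma>) ^ ?d" by (simp add: left_diff_distrib)
        moreover have "(2 - E) * real ((2 * n + 1) ^ ?d) \<le> (2 - E) * ?N ^ ?d"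
          using E2 unfolding E_def of_nat_power by (intro mult_left_mono power_mono) auto
        ultimately show "(2 - E) * real ((2 * n + 1) ^ ?d) \<le> 2 * ?N ^ ?d - (?N + \<sigma>) ^ ?d" by linarith
      qed
      also have "\<dots> \<le> (\<Sum>\<kappa>\<in>int_box n. (cmod (expsum X a u \<kappa>))\<^sup>2)"
        using expsum_box_lower[OF X w(1,2) sep w(7), where n = n and u = u] w(8-10) LN unfolding w(5,6) by simp
      finally show ?thesis .
    qed
    ultimately show ?thesis by simp
  qed
  then show ?lower ?upper by auto
qed

section \<open>From integer boxes to the operators on the cube\<close>

lemma infnorm_attained:
  fixes x :: "real ^ 'n"
  shows "\<exists>i. infnorm x = \<bar>x $ i\<bar>"
proof -
  have "infnorm x \<in> {\<bar>x \<bullet> b\<bar> |b. b \<in> Basis}"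
    unfolding infnorm_set_image infnorm_Max using Max_in[of "(\<lambda>b. \<bar>x \<bullet> b\<bar>) ` Basis"] by auto
  then obtain b where "b \<in> Basis" "infnorm x = \<bar>x \<bullet> b\<bar>" by auto
  then show ?thesis by (auto simp: Basis_vec_def inner_axis)
qed

lemma Q_cube_iff: "x \<in> Q_cube m \<longleftrightarrow> (\<forall>i. \<bar>x $ i\<bar> \<le> m)"
  unfolding Q_cube_def mem_Collect_eq
  using component_le_infnorm_cart[of x] infnorm_attained[of x] by (metis order_trans)

definition vec_of :: "('n::finite \<Rightarrow> int) \<Rightarrow> real ^ 'n" where
  "vec_of \<kappa> = (\<chi> i. of_int (\<kappa> i))"

lemma vec_of_nth [simp]: "vec_of \<kappa> $ i = of_int (\<kappa> i)" by (simp add: vec_of_def)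

lemma int_box_floor_iff:
  assumes "m \<ge> 0"
  shows "\<kappa> \<in> int_box (nat \<lfloor>m\<rfloor>) \<longleftrightarrow> (\<forall>i. \<bar>real_of_int (\<kappa> i)\<bar> \<le> m)"
proof -
  have "\<bar>k\<bar> \<le> int (nat \<lfloor>m\<rfloor>) \<longleftrightarrow> \<bar>real_of_int k\<bar> \<le> m" for k
    using assms by (simp add: le_floor_iff)
  then show ?thesis unfolding int_box_def mem_Collect_eq by (simp only:)
qed

lemma bij_betw_int_box:
  assumes "m \<ge> 0"
  shows "bij_betw vec_of (int_box (nat \<lfloor>m\<rfloor>)) (Q_cube m \<inter> int_lattice)"
proof (rule bij_betw_byWitness[where f' = "\<lambda>x i. \<lfloor>x $ i\<rfloor>"])
  show "vec_of ` int_box (nat \<lfloor>m\<rfloor>) \<subseteq> Q_cube m \<inter> int_lattice"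
    by (auto simp: Q_cube_iff int_lattice_def int_box_floor_iff[OF assms])
  show "(\<lambda>x i. \<lfloor>x $ i\<rfloor>) ` (Q_cube m \<inter> int_lattice) \<subseteq> int_box (nat \<lfloor>m\<rfloor>)"
    by (auto simp: Q_cube_iff int_lattice_def int_box_floor_iff[OF assms] of_int_floor)
qed (auto simp: int_lattice_def vec_eq_iff of_int_floor)

lemma num_int_points_cube:
  assumes "m \<ge> 0"
  shows "num_int_points (Q_cube m :: (real ^ 'n) set) = real ((2 * nat \<lfloor>m\<rfloor> + 1) ^ CARD('n))"
  unfolding num_int_points_def bij_betw_same_card[OF bij_betw_int_box[OF assms], symmetric] card_int_box ..

lemma expo_eq: "expo \<omega> x = unit_exp (- (\<omega> \<bullet> x))"
  by (simp add: expo_def unit_exp_def cis_conv_exp algebra_simps)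

lemma expo_vec_of: "expo (vec_of \<kappa>) x = unit_exp (- (\<Sum>i\<in>UNIV. of_int (\<kappa> i) * x $ i))"
  by (simp add: expo_eq inner_vec_def)

lemma min_sep_le:
  assumes "ereal r \<le> min_sep \<rho> X" "x \<in> X" "y \<in> X" "x \<noteq> y"
  shows "r \<le> \<rho> (x - y)"
proof -
  have "min_sep \<rho> X \<le> ereal (\<rho> (x - y))"
    unfolding min_sep_def using assms by (intro Inf_lower) auto
  then show ?thesis using assms(1) by (metis ereal_less_eq(3) order_trans)
qed

text \<open>Otherwise, translating each coordinate separately by an integer would make all of them small at once.\<close>

lemma torus_separated:
  fixes z :: "real ^ 'n"
  assumes "r \<le> torus_infnorm z"
  shows "\<exists>i. \<forall>j::int. r \<le> \<bar>z $ i + of_int j\<bar>"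
proof (rule ccontr)
  assume "\<not> ?thesis"
  then have "\<forall>i. \<exists>j::int. \<bar>z $ i + of_int j\<bar> < r" by (simp add: not_le)
  then obtain j :: "'n \<Rightarrow> int" where j: "\<And>i. \<bar>z $ i + of_int (j i)\<bar> < r" by metis
  have "vec_of j \<in> int_lattice" by (simp add: int_lattice_def)
  then have "torus_infnorm z \<le> infnorm (z + vec_of j)" using torus_infnorm_attained[of z] by metis
  moreover have "infnorm (z + vec_of j) < r" using infnorm_attained[of "z + vec_of j"] j by auto
  ultimately show False using assms by linarith
qed

lemma unit_sphere_sum: "u \<in> unit_sphere X \<Longrightarrow> (\<Sum>x\<in>X. (cmod (u x))\<^sup>2) = 1"
  by (simp add: unit_sphere_def L2_set_def)

lemma Phi_norm_bounds:
  fixes X :: "(real ^ 'n) set"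
  assumes X: "finite X" and c: "c \<ge> 1/2" and m: "m > 0" and E2: "exp (real CARD('n) / (2 * c)) \<le> 2"
    and sep: "ereal (c / m) \<le> min_sep torus_infnorm X" and u: "u \<in> unit_sphere X"
  defines "N \<equiv> L2_set (\<lambda>\<omega>. cmod (Phi_op (Q_cube m) X u \<omega>)) (Q_cube m \<inter> int_lattice)"
    and "E \<equiv> exp (real CARD('n) / (2 * c))"
  shows "sqrt ((2 - E) * num_int_points (Q_cube m :: (real ^ 'n) set)) \<le> N"
    and "N \<le> sqrt (E * num_int_points (Q_cube m :: (real ^ 'n) set))"
proof -
  have "(\<Sum>\<omega>\<in>Q_cube m \<inter> int_lattice. (cmod (Phi_op (Q_cube m) X u \<omega>))\<^sup>2)
      = (\<Sum>\<kappa>\<in>int_box (nat \<lfloor>m\<rfloor>). (cmod (Phi_op (Q_cube m) X u (vec_of \<kappa>)))\<^sup>2)"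
    using m by (intro sum.reindex_bij_betw[OF bij_betw_int_box, symmetric]) simp
  also have "\<dots> = (\<Sum>\<kappa>\<in>int_box (nat \<lfloor>m\<rfloor>). (cmod (expsum X (\<lambda>x i. x $ i) u \<kappa>))\<^sup>2)"
  proof (rule sum.cong)
    fix \<kappa> :: "'n \<Rightarrow> int" assume "\<kappa> \<in> int_box (nat \<lfloor>m\<rfloor>)"
    then have "vec_of \<kappa> \<in> Q_cube m \<inter> int_lattice"
      using bij_betw_int_box[of m] m unfolding bij_betw_def by auto
    then show "(cmod (Phi_op (Q_cube m) X u (vec_of \<kappa>)))\<^sup>2 = (cmod (expsum X (\<lambda>x i. x $ i) u \<kappa>))\<^sup>2"
      by (simp add: Phi_op_def expsum_def expo_vec_of mult.commute)
  qed auto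
  finally have N: "N = sqrt (\<Sum>\<kappa>\<in>int_box (nat \<lfloor>m\<rfloor>). (cmod (expsum X (\<lambda>x i. x $ i) u \<kappa>))\<^sup>2)"
    by (simp add: N_def L2_set_def)
  have "\<exists>i. \<forall>j::int. c / m \<le> \<bar>x $ i - y $ i + of_int j\<bar>" if "x \<in> X" "y \<in> X" "x \<noteq> y" for x y
    using torus_separated[OF min_sep_le[OF sep that]] by simp
  then have "\<forall>x\<in>X. \<forall>y\<in>X. x \<noteq> y \<longrightarrow> (\<exists>i. \<forall>j::int. c / m \<le> \<bar>x $ i - y $ i + of_int j\<bar>)" by blast
  note b = expsum_box_bounds[OF X c m E2 this, where u = u, unfolded unit_sphere_sum[OF u] mult_1_right, folded E_def]
  have np: "num_int_points (Q_cube m :: (real ^ 'n) set) = real ((2 * nat \<lfloor>m\<rfloor> + 1) ^ CARD('n))"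
    using m by (intro num_int_points_cube) simp
  show "sqrt ((2 - E) * num_int_points (Q_cube m :: (real ^ 'n) set)) \<le> N"
    "N \<le> sqrt (E * num_int_points (Q_cube m :: (real ^ 'n) set))"
    unfolding N np using b by (intro real_sqrt_le_mono; simp)+
qed

text \<open>Half-open cubes tile the space without overlap, which makes the step function below single-valued.\<close>

lemma half_open_cube:
  fixes a :: "real ^ 'n"
  assumes h: "h > 0"
  defines "C \<equiv> {\<omega>. \<forall>i. a $ i \<le> \<omega> $ i \<and> \<omega> $ i < a $ i + h}"
  shows "C \<in> sets borel" "emeasure lborel C = ennreal (h ^ CARD('n))" "measure lebesgue C = h ^ CARD('n)" "C \<in> lmeasurable"
proof -
  let ?b = "\<chi> i. a $ i + h"
  have C: "C = (\<Inter>i. {\<omega>. a $ i \<le> \<omega> $ i} \<inter> {\<omega>. \<omega> $ i < a $ i + h})" by (auto simp: C_def)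
  have "closed {\<omega>::real^'n. a $ i \<le> \<omega> $ i}" "open {\<omega>::real^'n. \<omega> $ i < a $ i + h}" for i
    by (intro closed_Collect_le open_Collect_less continuous_intros)+
  then show meas: "C \<in> sets borel"
    unfolding C by (intro sets.countable_INT'' sets.Int borel_closed borel_open) auto
  have sub: "box a ?b \<subseteq> C" "C \<subseteq> cbox a ?b"
    by (auto simp: C_def mem_box_cart less_imp_le)
  have le: "\<forall>b\<in>Basis. a \<bullet> b \<le> ?b \<bullet> b"
    using h by (auto simp: Basis_vec_def inner_axis)
  have pr: "(\<Prod>b\<in>Basis. (?b - a) \<bullet> b) = h ^ CARD('n)"
  proof -
    have "(?b - a) \<bullet> b = h" if "b \<in> Basis" for b
      using that by (auto simp: Basis_vec_def inner_axis)
    then have "(\<Prod>b\<in>Basis. (?b - a) \<bullet> b) = (\<Prod>b\<in>(Basis :: (real ^ 'n) set). h)" by (rule prod.cong[OF refl])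
    then show ?thesis by simp
  qed
  have "emeasure lborel (box a ?b) = ennreal (h ^ CARD('n))" "emeasure lborel (cbox a ?b) = ennreal (h ^ CARD('n))"
    using emeasure_lborel_box[of a ?b] emeasure_lborel_cbox[of a ?b] le pr by auto
  then show em: "emeasure lborel C = ennreal (h ^ CARD('n))"
    using emeasure_mono[OF sub(1), of lborel] emeasure_mono[OF sub(2), of lborel] meas by (simp add: order_antisym)
  then show "measure lebesgue C = h ^ CARD('n)"
    using meas h by (simp add: measure_def)
  show "C \<in> lmeasurable"
    using meas em by (intro fmeasurableI) (auto simp: less_top)
qed

lemma vol_Q_cube:
  assumes "m > 0"
  shows "vol (Q_cube m :: (real ^ 'n) set) = (2 * m) ^ CARD('n)"
proof -
  have Q: "(Q_cube m :: (real ^ 'n) set) = cbox (\<chi> i. - m) (\<chi> i. m)"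
  proof -
    have "\<bar>t\<bar> \<le> m \<longleftrightarrow> - m \<le> t \<and> t \<le> m" for t by auto
    then show ?thesis by (auto simp: Q_cube_iff mem_box_cart)
  qed
  have "measure lebesgue (cbox (\<chi> i. - m) (\<chi> i. m) :: (real ^ 'n) set) = (\<Prod>i\<in>(UNIV::'n set). m - (- m))"
    using assms content_cbox_cart[where a = "(\<chi> i. - m) :: real ^ 'n" and b = "\<chi> i. m"] by (simp add: interval_ne_empty_cart)
  then show ?thesis unfolding vol_def Q by simp
qed

text \<open>The Riemann sum is the integral of the step function that takes at \<open>\<omega>\<close> the value of \<open>g\<close> at the nearest
point of the grid, provided that this point lies in the cube. The step functions are dominated on a slightly larger cube
and converge wherever no coordinate of \<open>\<omega>\<close> has modulus \<open>m\<close>, hence almost everywhere.\<close>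

lemma riemann_sum_cube:
  fixes g :: "real ^ 'n \<Rightarrow> real"
  assumes g: "continuous_on UNIV g" and m: "m > 0"
  shows "(\<lambda>K. (1 / real (Suc K)) ^ CARD('n) * (\<Sum>\<kappa>\<in>int_box (nat \<lfloor>real (Suc K) * m\<rfloor>). g ((1 / real (Suc K)) *\<^sub>R vec_of \<kappa>)))
     \<longlonglongrightarrow> (LINT \<omega>:Q_cube m|lebesgue. g \<omega>)"
proof -
  define C where "C K \<kappa> = {\<omega>::real^'n. \<forall>i. (of_int (\<kappa> i) - 1 / 2) / real (Suc K) \<le> \<omega> $ i
      \<and> \<omega> $ i < (of_int (\<kappa> i) - 1 / 2) / real (Suc K) + 1 / real (Suc K)}" for K \<kappa>
  define near where "near K \<omega> = (\<lambda>i. \<lfloor>real (Suc K) * \<omega> $ i + 1 / 2\<rfloor>)" for K and \<omega> :: "real ^ 'n"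
  define B where "B K = (int_box (nat \<lfloor>real (Suc K) * m\<rfloor>) :: ('n \<Rightarrow> int) set)" for K
  define r where "r K \<kappa> = (1 / real (Suc K)) *\<^sub>R (vec_of \<kappa> :: real ^ 'n)" for K and \<kappa> :: "'n \<Rightarrow> int"
  have C_iff: "\<omega> \<in> C K \<kappa> \<longleftrightarrow> near K \<omega> = \<kappa>" for \<omega> K \<kappa>
  proof -
    have "(of_int (\<kappa> i) - 1 / 2) / real (Suc K) \<le> \<omega> $ i \<and> \<omega> $ i < (of_int (\<kappa> i) - 1 / 2) / real (Suc K) + 1 / real (Suc K)
        \<longleftrightarrow> \<lfloor>real (Suc K) * \<omega> $ i + 1 / 2\<rfloor> = \<kappa> i" for i
      unfolding floor_eq_iff add_divide_distrib[symmetric]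
      by (subst pos_divide_le_eq, simp, subst pos_less_divide_eq, simp) (auto simp: algebra_simps)
    then show ?thesis by (auto simp: C_def near_def fun_eq_iff)
  qed
  have cube: "C K \<kappa> \<in> sets borel" "measure lebesgue (C K \<kappa>) = (1 / real (Suc K)) ^ CARD('n)" "C K \<kappa> \<in> lmeasurable" for K \<kappa>
    using half_open_cube[of "1 / real (Suc K)" "\<chi> i. (of_int (\<kappa> i) - 1 / 2) / real (Suc K)"] by (auto simp: C_def)
  define f where "f K \<omega> = (\<Sum>\<kappa>\<in>B K. g (r K \<kappa>) * indicator (C K \<kappa>) \<omega>)" for K \<omega>
  have fin: "finite (B K)" for K unfolding B_def by (rule finite_int_box)
  have f_eq: "f K \<omega> = (if near K \<omega> \<in> B K then g (r K (near K \<omega>)) else 0)" for K \<omega>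
    unfolding f_def indicator_def C_iff using fin[of K] by (simp add: if_distrib[of "\<lambda>x. _ * x"] sum.delta eq_commute[of "near K \<omega>"] cong: if_cong)
  have int_f: "(LINT \<omega>|lebesgue. f K \<omega>) = (1 / real (Suc K)) ^ CARD('n) * (\<Sum>\<kappa>\<in>B K. g (r K \<kappa>))" for K
  proof -
    have i: "integrable lebesgue (\<lambda>\<omega>. g (r K \<kappa>) * indicator (C K \<kappa>) \<omega>)" for \<kappa>
      using cube(3)[of K \<kappa>] by (intro integrable_mult_right integrable_real_indicator) (auto simp: fmeasurable_def)
    have "(LINT \<omega>|lebesgue. f K \<omega>) = (\<Sum>\<kappa>\<in>B K. LINT \<omega>|lebesgue. g (r K \<kappa>) * indicator (C K \<kappa>) \<omega>)"
      unfolding f_def by (rule Bochner_Integration.integral_sum) (rule i)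
    also have "\<dots> = (\<Sum>\<kappa>\<in>B K. g (r K \<kappa>) * (1 / real (Suc K)) ^ CARD('n))"
      using cube(2)[of K] by simp
    finally show ?thesis by (simp only: sum_distrib_right[symmetric] mult.commute)
  qed
  have near_dist: "\<bar>r K (near K \<omega>) $ i - \<omega> $ i\<bar> \<le> 1 / real (Suc K)" for K \<omega> i
  proof -
    have "\<bar>of_int (near K \<omega> i) - real (Suc K) * \<omega> $ i\<bar> \<le> 1" unfolding near_def by linarith
    then have "\<bar>of_int (near K \<omega> i) - real (Suc K) * \<omega> $ i\<bar> / real (Suc K) \<le> 1 / real (Suc K)"
      by (intro divide_right_mono) auto
    also have "\<bar>of_int (near K \<omega> i) - real (Suc K) * \<omega> $ i\<bar> / real (Suc K) = \<bar>(of_int (near K \<omega> i) - real (Suc K) * \<omega> $ i) / real (Suc K)\<bar>"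
      by simp
    also have "(of_int (near K \<omega> i) - real (Suc K) * \<omega> $ i) / real (Suc K) = r K (near K \<omega>) $ i - \<omega> $ i"
      by (simp add: r_def diff_divide_distrib)
    finally show ?thesis .
  qed
  have B_iff: "\<kappa> \<in> B K \<longleftrightarrow> (\<forall>i. \<bar>real_of_int (\<kappa> i)\<bar> \<le> real (Suc K) * m)" for \<kappa> K
    unfolding B_def using m by (intro int_box_floor_iff) simp
  have r_Q: "r K \<kappa> \<in> Q_cube m" if "\<kappa> \<in> B K" for K \<kappa>
    using that unfolding B_iff Q_cube_iff by (auto simp: r_def abs_mult field_simps)
  have "bounded (g ` Q_cube m)"
    by (intro compact_imp_bounded compact_continuous_image continuous_on_subset[OF g] compact_Q_cube) auto
  then obtain b where b: "\<And>\<omega>. \<omega> \<in> Q_cube m \<Longrightarrow> \<bar>g \<omega>\<bar> \<le> b" unfolding bounded_iff by auto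
  have "0 \<in> Q_cube m" using m by (simp add: Q_cube_iff)
  then have "\<bar>g 0\<bar> \<le> b" by (rule b)
  then have b0: "0 \<le> b" by linarith
  have conv: "(\<lambda>K. LINT \<omega>|lebesgue. f K \<omega>) \<longlonglongrightarrow> (LINT \<omega>|lebesgue. indicator (Q_cube m) \<omega> * g \<omega>)"
  proof (rule integral_dominated_convergence[where w = "\<lambda>\<omega>. b * indicator (Q_cube (m + 1)) \<omega>"])
    have gm: "g \<in> borel_measurable borel" using g by (rule borel_measurable_continuous_onI)
    have Qm: "Q_cube c \<in> sets borel" for c using compact_Q_cube by (rule borel_compact)
    show "(\<lambda>\<omega>. indicator (Q_cube m) \<omega> * g \<omega>) \<in> borel_measurable lebesgue"
      using gm Qm by (intro measurable_completion borel_measurable_times borel_measurable_indicator) auto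
    show "f K \<in> borel_measurable lebesgue" for K
      unfolding f_def using cube(1)[of K]
      by (intro measurable_completion borel_measurable_sum borel_measurable_times borel_measurable_indicator) auto
    show "integrable lebesgue (\<lambda>\<omega>. b * indicator (Q_cube (m + 1)) \<omega>)"
      using lmeasurable_compact[OF compact_Q_cube[of "m + 1"]]
      by (intro integrable_mult_right integrable_real_indicator) (auto simp: fmeasurable_def)
    show "AE \<omega> in lebesgue. norm (f K \<omega>) \<le> b * indicator (Q_cube (m + 1)) \<omega>" for K
    proof (rule AE_I2)
      fix \<omega> :: "real ^ 'n"
      show "norm (f K \<omega>) \<le> b * indicator (Q_cube (m + 1)) \<omega>"
      proof (cases "near K \<omega> \<in> B K")
        case True
        have "\<omega> \<in> Q_cube (m + 1)"
          unfolding Q_cube_iff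
        proof
          fix i
          have "1 / real (Suc K) \<le> 1" by simp
          then show "\<bar>\<omega> $ i\<bar> \<le> m + 1"
            using near_dist[of K \<omega> i] r_Q[OF True, unfolded Q_cube_iff, rule_format, of i] by linarith
        qed
        then show ?thesis using True b[OF r_Q[OF True]] by (simp add: f_eq)
      qed (use b0 in \<open>simp add: f_eq\<close>)
    qed
    have "negligible {\<omega>::real^'n. \<omega> $ i = a}" for i a
      using negligible_standard_hyperplane[of "axis i 1 :: real ^ 'n" a] by (simp add: inner_axis axis_in_Basis_iff)
    then have "negligible (\<Union>i\<in>(UNIV::'n set). {\<omega>::real^'n. \<omega> $ i = m} \<union> {\<omega>. \<omega> $ i = - m})"
      by (intro negligible_Union finite_imageI) (auto intro!: negligible_Un)
    then have "AE \<omega> in lebesgue. \<omega> \<notin> (\<Union>i\<in>(UNIV::'n set). {\<omega>::real^'n. \<omega> $ i = m} \<union> {\<omega>. \<omega> $ i = - m})"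
      unfolding negligible_iff_null_sets by (rule AE_not_in)
    then show "AE \<omega> in lebesgue. (\<lambda>K. f K \<omega>) \<longlonglongrightarrow> indicator (Q_cube m) \<omega> * g \<omega>"
    proof (rule AE_mp, intro AE_I2 impI)
      fix \<omega> :: "real ^ 'n"
      assume "\<omega> \<notin> (\<Union>i\<in>(UNIV::'n set). {\<omega>::real^'n. \<omega> $ i = m} \<union> {\<omega>. \<omega> $ i = - m})"
      then have ne: "\<bar>\<omega> $ i\<bar> \<noteq> m" for i by (auto simp: abs_if split: if_splits)
      have small: "\<forall>\<^sub>F K in sequentially. 1 / real (Suc K) < \<epsilon>" if "\<epsilon> > 0" for \<epsilon>
        using order_tendstoD(2)[OF LIMSEQ_Suc[OF lim_inverse_n'] that] by simp
      show "(\<lambda>K. f K \<omega>) \<longlonglongrightarrow> indicator (Q_cube m) \<omega> * g \<omega>"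
      proof (cases "\<omega> \<in> Q_cube m")
        case True
        then have lt: "\<bar>\<omega> $ i\<bar> < m" for i using ne[of i] unfolding Q_cube_iff by (simp add: less_le)
        have "\<forall>\<^sub>F K in sequentially. \<forall>i\<in>UNIV. 1 / real (Suc K) < m - \<bar>\<omega> $ i\<bar>"
          by (intro eventually_ball_finite finite ballI small) (simp add: lt)
        then have inB: "\<forall>\<^sub>F K in sequentially. near K \<omega> \<in> B K"
        proof (rule eventually_mono)
          fix K assume K: "\<forall>i\<in>UNIV. 1 / real (Suc K) < m - \<bar>\<omega> $ i\<bar>"
          show "near K \<omega> \<in> B K"
            unfolding B_iff
          proof
            fix i
            have "\<bar>r K (near K \<omega>) $ i\<bar> \<le> m" using near_dist[of K \<omega> i] K[THEN bspec, OF UNIV_I, of i] by linarith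
            then show "\<bar>real_of_int (near K \<omega> i)\<bar> \<le> real (Suc K) * m"
              by (simp add: r_def abs_mult field_simps)
          qed
        qed
        have "(\<lambda>K. r K (near K \<omega>)) \<longlonglongrightarrow> \<omega>"
        proof (rule vec_tendstoI)
          fix i
          show "(\<lambda>K. r K (near K \<omega>) $ i) \<longlonglongrightarrow> \<omega> $ i"
            using near_dist by (intro Lim_transform_eventually[OF tendsto_const] LIM_zero_cancel[of _ "\<omega> $ i"] Lim_null_comparison[OF _ LIMSEQ_Suc[OF lim_inverse_n']] always_eventually allI) simp
        qed
        then have "(\<lambda>K. g (r K (near K \<omega>))) \<longlonglongrightarrow> g \<omega>"
          using g by (auto intro: continuous_on_tendsto_compose)
        moreover have "\<forall>\<^sub>F K in sequentially. g (r K (near K \<omega>)) = f K \<omega>"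
          using inB by (rule eventually_mono) (simp add: f_eq)
        ultimately have "(\<lambda>K. f K \<omega>) \<longlonglongrightarrow> g \<omega>" by (rule Lim_transform_eventually)
        then show ?thesis using True by simp
      next
        case False
        then obtain i where i: "m < \<bar>\<omega> $ i\<bar>" by (auto simp: Q_cube_iff not_le)
        have "\<forall>\<^sub>F K in sequentially. 0 = f K \<omega>"
        proof (rule eventually_mono[OF small[of "\<bar>\<omega> $ i\<bar> - m"]])
          fix K assume K: "1 / real (Suc K) < \<bar>\<omega> $ i\<bar> - m"
          have "near K \<omega> \<notin> B K"
          proof
            assume "near K \<omega> \<in> B K"
            then have "\<bar>r K (near K \<omega>) $ i\<bar> \<le> m" using r_Q by (auto simp: Q_cube_iff)
            then show False using near_dist[of K \<omega> i] K by linarith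
          qed
          then show "0 = f K \<omega>" by (simp add: f_eq)
        qed (use i in simp)
        then have "(\<lambda>K. f K \<omega>) \<longlonglongrightarrow> 0" by (rule Lim_transform_eventually[OF tendsto_const])
        then show ?thesis using False by simp
      qed
    qed
  qed
  have "(LINT \<omega>|lebesgue. indicator (Q_cube m) \<omega> * g \<omega>) = (LINT \<omega>:Q_cube m|lebesgue. g \<omega>)"
    by (simp add: set_lebesgue_integral_def)
  then show ?thesis using conv unfolding int_f B_def r_def by simp
qed

text \<open>The points of \<open>X/K\<close> have coordinates of modulus at most \<open>1/(2K)\<close>, so for \<open>K \<ge> 2\<close> coordinate differences
modulo 1 are ordinary differences, and the separation modulo 1 of \<open>X/K\<close> is that of \<open>X\<close> divided by \<open>K\<close>.\<close>

lemma F_norm_bounds: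
  fixes X :: "(real ^ 'n) set"
  assumes X: "finite X" "X \<subseteq> unit_box" and c: "c \<ge> 1/2" and m: "m > 0" and E2: "exp (real CARD('n) / (2 * c)) \<le> 2"
    and sep: "ereal (c / m) \<le> min_sep infnorm X" and u: "u \<in> unit_sphere X"
  defines "E \<equiv> exp (real CARD('n) / (2 * c))"
  shows "sqrt ((2 - E) * vol (Q_cube m :: (real ^ 'n) set)) \<le> L2_norm_on (Q_cube m) (F_op X u)"
    and "L2_norm_on (Q_cube m) (F_op X u) \<le> sqrt (E * vol (Q_cube m :: (real ^ 'n) set))"
proof -
  let ?d = "CARD('n)"
  define I where "I = (LINT \<omega>:Q_cube m|lebesgue. (cmod (F_op X u \<omega>))\<^sup>2)"
  define R where "R K = (1 / real (Suc K)) ^ ?d * (\<Sum>\<kappa>\<in>int_box (nat \<lfloor>real (Suc K) * m\<rfloor>). (cmod (F_op X u ((1 / real (Suc K)) *\<^sub>R vec_of \<kappa>)))\<^sup>2)" for K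
  define N where "N K = (1 / real (Suc K)) ^ ?d * real ((2 * nat \<lfloor>real (Suc K) * m\<rfloor> + 1) ^ ?d)" for K
  have R: "R \<longlonglongrightarrow> I"
    unfolding R_def I_def by (rule riemann_sum_cube) (use m in \<open>auto intro!: continuous_intros continuous_F_op\<close>)
  have N: "N \<longlonglongrightarrow> (2 * m) ^ ?d"
  proof -
    have "(\<lambda>K. 2 * (real (nat \<lfloor>real (Suc K) * m\<rfloor>) / real (Suc K)) + 1 / real (Suc K)) \<longlonglongrightarrow> 2 * m + 0"
    proof (intro tendsto_intros LIMSEQ_Suc[OF lim_inverse_n'])
      show "(\<lambda>K. real (nat \<lfloor>real (Suc K) * m\<rfloor>) / real (Suc K)) \<longlonglongrightarrow> m"
      proof (rule LIM_zero_cancel, rule Lim_null_comparison[OF _ LIMSEQ_Suc[OF lim_inverse_n']], rule always_eventually, rule allI)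
        fix K
        have "0 \<le> real (Suc K) * m" using m by simp
        then have "\<bar>real (nat \<lfloor>real (Suc K) * m\<rfloor>) - real (Suc K) * m\<bar> \<le> 1" by linarith
        then have "\<bar>real (nat \<lfloor>real (Suc K) * m\<rfloor>) - real (Suc K) * m\<bar> / real (Suc K) \<le> 1 / real (Suc K)"
          by (intro divide_right_mono) auto
        also have "\<bar>real (nat \<lfloor>real (Suc K) * m\<rfloor>) - real (Suc K) * m\<bar> / real (Suc K) = \<bar>(real (nat \<lfloor>real (Suc K) * m\<rfloor>) - real (Suc K) * m) / real (Suc K)\<bar>" by simp
        also have "(real (nat \<lfloor>real (Suc K) * m\<rfloor>) - real (Suc K) * m) / real (Suc K) = real (nat \<lfloor>real (Suc K) * m\<rfloor>) / real (Suc K) - m"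
          by (simp add: diff_divide_distrib)
        finally show "norm (real (nat \<lfloor>real (Suc K) * m\<rfloor>) / real (Suc K) - m) \<le> 1 / real (Suc K)" by simp
      qed
    qed
    then have "(\<lambda>K. (2 * (real (nat \<lfloor>real (Suc K) * m\<rfloor>) / real (Suc K)) + 1 / real (Suc K)) ^ ?d) \<longlonglongrightarrow> (2 * m) ^ ?d"
      using tendsto_power by fastforce
    moreover have "N K = (2 * (real (nat \<lfloor>real (Suc K) * m\<rfloor>) / real (Suc K)) + 1 / real (Suc K)) ^ ?d" for K
    proof -
      have "1 / real (Suc K) * real (2 * nat \<lfloor>real (Suc K) * m\<rfloor> + 1) = 2 * (real (nat \<lfloor>real (Suc K) * m\<rfloor>) / real (Suc K)) + 1 / real (Suc K)"
        by (simp add: add_divide_distrib)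
      then show ?thesis unfolding N_def of_nat_power power_mult_distrib[symmetric] by (simp only:)
    qed
    then have "N = (\<lambda>K. (2 * (real (nat \<lfloor>real (Suc K) * m\<rfloor>) / real (Suc K)) + 1 / real (Suc K)) ^ ?d)" by (rule ext)
    ultimately show ?thesis by (simp only:)
  qed
  have bounds: "(2 - E) * N K \<le> R K \<and> R K \<le> E * N K" if K: "K \<ge> 1" for K
  proof -
    define h where "h = 1 / real (Suc K)"
    have h: "h > 0" "h \<le> 1 / 2" using K by (auto simp: h_def field_simps)
    have mK: "real (Suc K) * m > 0" using m by simp
    have "\<exists>i. \<forall>j::int. c / (real (Suc K) * m) \<le> \<bar>h * x $ i - h * y $ i + of_int j\<bar>" if xy: "x \<in> X" "y \<in> X" "x \<noteq> y" for x y
    proof -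
      obtain i where i: "infnorm (x - y) = \<bar>x $ i - y $ i\<bar>" using infnorm_attained[of "x - y"] by auto
      have s: "c / m \<le> \<bar>x $ i - y $ i\<bar>" using min_sep_le[OF sep xy] i by simp
      have "- (1/2) \<le> x $ i" "x $ i < 1/2" "- (1/2) \<le> y $ i" "y $ i < 1/2"
        using X(2) xy by (auto simp: unit_box_def)
      then have lt1: "\<bar>x $ i - y $ i\<bar> \<le> 1" by linarith
      have hs: "h * (c / m) \<le> h * \<bar>x $ i - y $ i\<bar>" using s h by (intro mult_left_mono) auto
      have ha: "\<bar>h * x $ i - h * y $ i\<bar> = h * \<bar>x $ i - y $ i\<bar>"
        using h by (simp add: abs_mult flip: right_diff_distrib)
      have "h * \<bar>x $ i - y $ i\<bar> \<le> (1 / 2) * 1" using lt1 h by (intro mult_mono) auto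
      then have half: "\<bar>h * x $ i - h * y $ i\<bar> \<le> 1 / 2" using ha by simp
      have "h * (c / m) \<le> \<bar>h * x $ i - h * y $ i + of_int j\<bar>" for j :: int
      proof (cases "j = 0")
        case False
        then have "1 \<le> \<bar>real_of_int j\<bar>" by linarith
        then show ?thesis using half hs ha by linarith
      qed (use hs ha in simp)
      then show ?thesis by (intro exI[of _ i]) (simp add: h_def mult.commute)
    qed
    then have "\<forall>x\<in>X. \<forall>y\<in>X. x \<noteq> y \<longrightarrow> (\<exists>i. \<forall>j::int. c / (real (Suc K) * m) \<le> \<bar>h * x $ i - h * y $ i + of_int j\<bar>)" by blast
    note b = expsum_box_bounds[OF X(1) c mK E2 this, where u = u, unfolded unit_sphere_sum[OF u] mult_1_right, folded E_def]
    have eq: "F_op X u (h *\<^sub>R vec_of \<kappa>) = expsum X (\<lambda>x i. h * x $ i) u \<kappa>" for \<kappa>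
      unfolding F_op_def expsum_def expo_eq by (simp add: inner_vec_def sum_distrib_left mult_ac)
    have R_eq: "R K = h ^ ?d * (\<Sum>\<kappa>\<in>int_box (nat \<lfloor>real (Suc K) * m\<rfloor>). (cmod (expsum X (\<lambda>x i. h * x $ i) u \<kappa>))\<^sup>2)"
      unfolding R_def h_def[symmetric] eq ..
    have hd: "0 \<le> h ^ ?d" using h by simp
    show ?thesis
      using mult_left_mono[OF b(1) hd] mult_left_mono[OF b(2) hd]
      unfolding R_eq N_def h_def[symmetric] by (simp only: mult_ac)
  qed
  have "(2 - E) * (2 * m) ^ ?d \<le> I"
    by (rule tendsto_le[OF _ R tendsto_mult[OF tendsto_const N]])
       (auto intro!: eventually_sequentiallyI[of 1] simp: bounds)
  moreover have "I \<le> E * (2 * m) ^ ?d"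
    by (rule tendsto_le[OF _ tendsto_mult[OF tendsto_const N] R])
       (auto intro!: eventually_sequentiallyI[of 1] simp: bounds)
  ultimately show "sqrt ((2 - E) * vol (Q_cube m :: (real ^ 'n) set)) \<le> L2_norm_on (Q_cube m) (F_op X u)"
    "L2_norm_on (Q_cube m) (F_op X u) \<le> sqrt (E * vol (Q_cube m :: (real ^ 'n) set))"
    unfolding L2_norm_on_def I_def[symmetric] vol_Q_cube[OF m] by auto
qed

theorem theorem2p3:
  fixes X :: "(real ^ 'n) set" and m \<beta> :: real
  assumes "CARD('n) \<ge> 2"
    and "m \<ge> 1"
    and "\<beta> \<ge> 1 / (2 * ln 2)"
    and "finite X" and "X \<noteq> {}"
    and "X \<subseteq> unit_box"
  shows "(min_sep infnorm X \<ge> ereal (\<beta> * real CARD('n) / m) \<longrightarrow>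
           sqrt ((2 - exp (1 / (2 * \<beta>))) * vol (Q_cube m :: (real ^ 'n) set)) \<le> sigma_min_F (Q_cube m) X \<and>
           sigma_min_F (Q_cube m) X \<le> sigma_max_F (Q_cube m) X \<and>
           sigma_max_F (Q_cube m) X \<le> sqrt (exp (1 / (2 * \<beta>)) * vol (Q_cube m :: (real ^ 'n) set)))
       \<and> (min_sep torus_infnorm X \<ge> ereal (\<beta> * real CARD('n) / m) \<longrightarrow>
           sqrt ((2 - exp (1 / (2 * \<beta>))) * num_int_points (Q_cube m :: (real ^ 'n) set)) \<le> sigma_min_Phi (Q_cube m) X \<and>
           sigma_min_Phi (Q_cube m) X \<le> sigma_max_Phi (Q_cube m) X \<and>
           sigma_max_Phi (Q_cube m) X \<le> sqrt (exp (1 / (2 * \<beta>)) * num_int_points (Q_cube m :: (real ^ 'n) set)))"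
proof -
  let ?c = "\<beta> * real CARD('n)"
  have ln2: "0 < ln (2::real)" "ln (2::real) \<le> 1" using ln_le_minus_one[of "2::real"] by auto
  have "1 / 2 \<le> 1 / (2 * ln (2::real))" using ln2 by (simp add: field_simps)
  then have \<beta>: "1 / 2 \<le> \<beta>" using assms(3) by linarith
  have c: "1 / 2 \<le> ?c"
  proof -
    have "\<beta> * 1 \<le> ?c" using assms(1) \<beta> by (intro mult_left_mono) auto
    then show ?thesis using \<beta> by linarith
  qed
  have E: "real CARD('n) / (2 * ?c) = 1 / (2 * \<beta>)" by simp
  have "1 / (2 * \<beta>) \<le> ln 2"
    using assms(3) ln2 \<beta> by (simp add: field_simps)
  then have "exp (1 / (2 * \<beta>)) \<le> exp (ln 2)" by (simp only: exp_le_cancel_iff)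
  then have E2: "exp (real CARD('n) / (2 * ?c)) \<le> 2" unfolding E by simp
  have m: "m > 0" using assms(2) by simp
  show ?thesis
  proof (intro conjI[of "_ \<longrightarrow> _"] impI)
    assume sep: "min_sep infnorm X \<ge> ereal (?c / m)"
    note b = F_norm_bounds[OF assms(4,6) c m E2 sep, unfolded E]
    show "sqrt ((2 - exp (1 / (2 * \<beta>))) * vol (Q_cube m :: (real ^ 'n) set)) \<le> sigma_min_F (Q_cube m) X \<and>
           sigma_min_F (Q_cube m) X \<le> sigma_max_F (Q_cube m) X \<and>
           sigma_max_F (Q_cube m) X \<le> sqrt (exp (1 / (2 * \<beta>)) * vol (Q_cube m :: (real ^ 'n) set))"
      using sigma_F_attained[OF compact_Q_cube[of m] assms(4,5)] b by metis
  next
    assume sep: "min_sep torus_infnorm X \<ge> ereal (?c / m)"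
    note b = Phi_norm_bounds[OF assms(4) c m E2 sep, unfolded E]
    show "sqrt ((2 - exp (1 / (2 * \<beta>))) * num_int_points (Q_cube m :: (real ^ 'n) set)) \<le> sigma_min_Phi (Q_cube m) X \<and>
           sigma_min_Phi (Q_cube m) X \<le> sigma_max_Phi (Q_cube m) X \<and>
           sigma_max_Phi (Q_cube m) X \<le> sqrt (exp (1 / (2 * \<beta>)) * num_int_points (Q_cube m :: (real ^ 'n) set))"
      using sigma_Phi_attained[OF assms(4,5), of "Q_cube m"] b by metis
  qed
qed

end
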